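(* Let $(\mathcal C,\circ,I,\bullet,J)$ be a $\bullet$-braided duoidal category with a reversion. Assume that $\mathcal C$ has, and $\bullet$ preserves, binary intersections. Let $(\pi:A\to H,\ \sigma:H\to A)$ and $(\pi':A'\to H',\ \sigma':H'\to A')$ be pairs of morphisms in $\mathrm{Bimon}(\mathcal C,\circ,\bullet)$ with $\pi\sigma=\mathrm{Id}_H$, $\pi'\sigma'=\mathrm{Id}_{H'}$, where $A,A'$ are cocommutative Hopf monoids, $H,H'$ are Hopf monoids, and $u_H:I\to H$, $u_{H'}:I\to H'$ are monomorphisms in $\mathcal C$. Let $(K,k)$ and $(K',k')$ be the kernels of $\pi$ and $\pi'$, respectively. Let $f:K\to K'$, $\phi:A\to A'$, $g:H\to H'$ be morphisms in $\mathrm{Bimon}(\mathcal C,\circ,\bullet)$ with $\phi k=k'f$, $\pi'\phi=g\pi$ and $\phi\sigma=\sigma'g$. If $f$ and $g$ are both isomorphisms in $\mathrm{Bimon}(\mathcal C,\circ,\bullet)$, then so is $\phi$.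
   Context: Conventions: composition is juxtaposition (right to left), an object also denotes its identity morphism, associativity constraints are suppressed. Duoidal category $(\mathcal C,\circ,I,\bullet,J)$: a category with monoidal structures $(\mathcal C,\circ,I)$, $(\mathcal C,\bullet,J)$ (left/right unit constraints $l^\circ,r^\circ$, resp. $l^\bullet,r^\bullet$), a natural transformation $\zeta_{A,B,C,D}:(A\bullet B)\circ(C\bullet D)\to(A\circ C)\bullet(B\circ D)$ and morphisms $\Delta_I:I\to I\bullet I$, $m_J:J\circ J\to J$, $\varepsilon_I=u_J:I\to J$ such that $(J,m_J,u_J)$ is a monoid in $(\mathcal C,\circ,I)$, $(I,\Delta_I,\varepsilon_I)$ is a comonoid in $(\mathcal C,\bullet,J)$, and $\zeta_{A,B,C\circ E,D\circ F}((A\bullet B)\circ\zeta_{C,D,E,F})=\zeta_{A\circ C,B\circ D,E,F}(\zeta_{A,B,C,D}\circ(E\bullet F))$, $((A\circ D)\bullet\zeta_{B,C,E,F})\zeta_{A,B\bullet C,D,E\bullet F}=(\zeta_{A,B,D,E}\bullet(C\circ F))\zeta_{A\bullet B,C,D\bullet E,F}$, $(l^\circ_A\bullet l^\circ_B)\zeta_{I,I,A,B}(\Delta_I\circ(A\bullet B))=l^\circ_{A\bullet B}$, $(r^\circ_A\bullet r^\circ_B)\zeta_{A,B,I,I}((A\bullet B)\circ\Delta_I)=r^\circ_{A\bullet B}$, $l^\bullet_{A\circ B}(m_J\bullet(A\circ B))\zeta_{J,A,J,B}=l^\bullet_A\circ l^\bullet_B$, $r^\bullet_{A\circ B}((A\circ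 B)\bullet m_J)\zeta_{A,J,B,J}=r^\bullet_A\circ r^\bullet_B$. It is $\bullet$-braided if $(\mathcal C,\bullet,J)$ has a braiding, here denoted $\sigma_{X,Y}:X\bullet Y\to Y\bullet X$, with $\sigma_{A\circ C,B\circ D}\zeta_{A,B,C,D}=\zeta_{B,A,D,C}(\sigma_{A,B}\circ\sigma_{C,D})$ and $\sigma_{I,I}\Delta_I=\Delta_I$. A binary intersection is a pullback of two monomorphisms with common codomain; "$\bullet$ preserves binary intersections" means all functors $X\bullet(-)$ and $(-)\bullet X$ do. Bimonoid: $(H,m_H,u_H,\Delta_H,\varepsilon_H)$ with $(H,m_H,u_H)$ a monoid in $(\mathcal C,\circ,I)$, $(H,\Delta_H,\varepsilon_H)$ a comonoid in $(\mathcal C,\bullet,J)$ and $\Delta_Hm_H=(m_H\bullet m_H)\zeta_{H,H,H,H}(\Delta_H\circ\Delta_H)$, $\varepsilon_Hm_H=m_J(\varepsilon_H\circ\varepsilon_H)$, $\Delta_Hu_H=(u_H\bullet u_H)\Delta_I$, $\varepsilon_Hu_H=\varepsilon_I$; morphisms are morphisms of monoids and comonoids. $H$ is cocommutative if $\sigma_{H,H}\Delta_H=\Delta_H$. The kernel of $\pi:A\to H$ is its pullback along $u_H:I\to H$ in $\mathrm{Bimon}(\mathcal C,\circ,\bullet)$ ($I$ being initial there), with projection $k:K\to A$; under the stated hypotheses it exists. Reversion: a functor $(-)^-:\mathcal C\to\mathcal C$ with lax monoidal structures $(\phi^\circ_{X,Y}:X^-\circ Y^-\to(Y\circ X)^-,\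 \phi^\circ_0:I\to I^-)$ from $(\mathcal C,\circ^{\mathrm{rev}})$ to $(\mathcal C,\circ)$ and $(\phi^\bullet_{X,Y}:X^-\bullet Y^-\to(Y\bullet X)^-,\ \phi^\bullet_0:J\to J^-)$ from $(\mathcal C,\bullet^{\mathrm{rev}})$ to $(\mathcal C,\bullet)$ ($\mathrm{rev}$ = reversed tensor product), forming a double lax monoidal functor $(\mathcal C,\circ^{\mathrm{rev}},\bullet^{\mathrm{rev}})\to(\mathcal C,\circ,\bullet)$, i.e. $\phi^\bullet_{C\circ A,D\circ B}(\phi^\circ_{A,C}\bullet\phi^\circ_{B,D})\zeta_{A^-,B^-,C^-,D^-}=(\zeta_{D,C,B,A})^-\phi^\circ_{B\bullet A,D\bullet C}(\phi^\bullet_{A,B}\circ\phi^\bullet_{C,D})$, $\phi^\bullet_{I,I}(\phi^\circ_0\bullet\phi^\circ_0)\Delta_I=(\Delta_I)^-\phi^\circ_0$, $(m_J)^-\phi^\circ_{J,J}(\phi^\bullet_0\circ\phi^\bullet_0)=\phi^\bullet_0m_J$, $\phi^\bullet_0\varepsilon_I=(\varepsilon_I)^-\phi^\circ_0$; together with natural transformations $\gamma_{X,Y,Z,T}:((X\bullet Y^-)\circ Z)\bullet T\to X\circ(Z\bullet(Y\circ T))$, $\delta_{X,Y,Z,T}:X\bullet(Y\circ(Z^-\bullet T))\to((X\circ Z)\bullet Y)\circ T$, $\widetilde\gamma_{X,Y,Z,T}:X^-\bullet((Y\bullet Z)\circ T)\to Z\circ((X\circ Y)^-\bullet T)$, $\widetilde\delta_{X,Y,Z,T}:(X\circ(Y\bullet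 Z))\bullet T^-\to(X\bullet(Z\circ T)^-)\circ Y$. Put $\psi_{X,Y}=\gamma_{J,X,I,Y}(((l^\bullet_{X^-})^{-1}\circ I)\bullet Y)((r^\circ_{X^-})^{-1}\bullet Y):X^-\bullet Y\to J\circ(I\bullet(X\circ Y))$, $\varphi_{X,Y}=\delta_{X,I,Y,J}(X\bullet(I\circ(r^\bullet_{Y^-})^{-1}))(X\bullet(l^\circ_{Y^-})^{-1}):X\bullet Y^-\to((X\circ Y)\bullet I)\circ J$, $\widetilde\psi_{X,Y}=l^\circ_{(X\circ Y)^-}(I\circ r^\bullet_{(X\circ Y)^-})\widetilde\gamma_{X,Y,I,J}:X^-\bullet((Y\bullet I)\circ J)\to(X\circ Y)^-$, $\widetilde\varphi_{X,Y}=r^\circ_{(X\circ Y)^-}(l^\bullet_{(X\circ Y)^-}\circ I)\widetilde\delta_{J,I,X,Y}:(J\circ(I\bullet X))\bullet Y^-\to(X\circ Y)^-$. Axioms, for all objects ($\Delta_J:J\to J\bullet J$ is the inverse unit constraint): (R1) $\gamma_{X,Y,Z\circ U,T\circ V}\zeta_{(X\bullet Y^-)\circ Z,T,U,V}=(X\circ\zeta_{Z,Y\circ T,U,V})(\gamma_{X,Y,Z,T}\circ(U\bullet V))$. (R2) $((X\circ T)\bullet\gamma_{Y,Z,U,V})(\zeta_{X,Y\bullet Z^-,T,U}\bullet V)=\zeta_{X,Y,T,U\bullet(Z\circ V)}\gamma_{X\bullet Y,Z,T\bullet U,V}$. (R3) $\delta_{X\circ Z,Y\circ T,U,V}\zeta_{X,Y,Z,T\circ(U^-\bullet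 V)}=(\zeta_{X,Y,Z\circ U,T}\circ V)((X\bullet Y)\circ\delta_{Z,T,U,V})$. (R4) $(\delta_{X,Y,T,U}\bullet(Z\circ V))(X\bullet\zeta_{Y,Z,T^-\bullet U,V})=\zeta_{(X\circ T)\bullet Y,Z,U,V}\delta_{X,Y\bullet Z,T,U\bullet V}$. (R5) $\delta_{X,Y,T,U\bullet(Z\circ V)}(X\bullet\gamma_{Y,Z,T^-\bullet U,V})=\gamma_{(X\circ T)\bullet Y,Z,U,V}(\delta_{X,Y\bullet Z^-,T,U}\bullet V)$. (R6) $l^\circ_{I\bullet I}(I\circ(I\bullet l^\circ_I))\gamma_{I,I,I,I}(((I\bullet\phi^\circ_0)\Delta_I\circ I)\bullet I)=l^\circ_I\bullet I$. (R7) $r^\circ_{I\bullet I}((r^\circ_I\bullet I)\circ I)\delta_{I,I,I,I}(I\bullet(I\circ(\phi^\circ_0\bullet I)\Delta_I))=I\bullet r^\circ_I$. (R8) $\gamma_{X\circ Z,Y,J\circ J,U}((\delta_{X,Y^-,Z,J}\circ J)\bullet U)(((X\bullet(Y^-\circ(r^\bullet_{Z^-})^{-1}))\circ J)\bullet U)=(X\circ Z\circ\zeta_{J,Y,J,U})(X\circ Z\circ(l^\bullet_Y)^{-1}\circ(l^\bullet_U)^{-1})(X\circ l^\bullet_{Z\circ Y\circ U})\gamma_{X,Z\circ Y,J,U}(((X\bullet\phi^\circ_{Y,Z})\circ J)\bullet U)$. (R9) $\delta_{X,J\circ J,Z,Y\circ U}(X\bullet(J\circ\gamma_{J,Y,Z^-,U}))(X\bullet(J\circ(((l^\bullet_{Y^-})^{-1}\circ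 Z^-)\bullet U)))=(\zeta_{X,J,Z,J}\circ Y\circ U)((r^\bullet_X)^{-1}\circ(r^\bullet_Z)^{-1}\circ Y\circ U)(r^\bullet_{X\circ Z\circ Y}\circ U)\delta_{X,J,Z\circ Y,U}(X\bullet(J\circ(\phi^\circ_{Y,Z}\bullet U)))$. (R10) $\widetilde\varphi_{X\circ Y,Z}(\psi_{X,Y}\bullet Z^-)=\widetilde\psi_{X,Y\circ Z}(X^-\bullet\varphi_{Y,Z})$. (R11) $(r^\circ_X)^-l^\circ_{(X\circ I)^-}(I\circ r^\bullet_{(X\circ I)^-})\widetilde\gamma_{X,I,I,J}(X^-\bullet(\Delta_I\circ J))=r^\bullet_{X^-}(X^-\bullet l^\circ_J)$. (R12) $(l^\circ_X)^-r^\circ_{(I\circ X)^-}(l^\bullet_{(I\circ X)^-}\circ I)\widetilde\delta_{J,I,I,X}((J\circ\Delta_I)\bullet X^-)=l^\bullet_{X^-}(r^\circ_J\bullet X^-)$. (R13) $\gamma_{X,Y,T\bullet(Z\circ U),V}(\gamma_{X\bullet Y^-,Z,T,U}\bullet V)=(X\circ(T\bullet\zeta_{Z,Y,U,V}))\gamma_{X,Z\bullet Y,T,U\bullet V}(((X\bullet\phi^\bullet_{Y,Z})\circ T)\bullet U\bullet V)$. (R14) $\delta_{X,(Y\circ T)\bullet Z,U,V}(X\bullet\delta_{Y,Z,T,U^-\bullet V})=((\zeta_{X,Y,U,T}\bullet Z)\circ V)\delta_{X\bullet Y,Z,U\bullet T,V}(X\bullet Y\bullet(Z\circ(\phi^\bullet_{T,U}\bullet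 V)))$. (R15) $(X\circ\gamma_{Z,T,U,Y\circ V})\gamma_{X,Y,(Z\bullet T^-)\circ U,V}=\gamma_{X\circ Z,T\circ Y,U,V}((((X\circ Z)\bullet\phi^\circ_{Y,T})\circ U)\bullet V)((\zeta_{X,Y^-,Z,T^-}\circ U)\bullet V)$. (R16) $(\delta_{X\circ U,Y,Z,T}\circ V)\delta_{X,Y\circ(Z^-\bullet T),U,V}=\delta_{X,Y,U\circ Z,T\circ V}(X\bullet(Y\circ(\phi^\circ_{Z,U}\bullet(T\circ V))))(X\bullet(Y\circ\zeta_{Z^-,T,U^-,V}))$. (R17) $r^\circ_J(J\circ r^\bullet_I)(J\circ(I\bullet m_J))\gamma_{J,J,I,J}(((J\bullet\phi^\bullet_0)\Delta_J\circ I)\bullet J)=r^\bullet_J(r^\circ_J\bullet J)$. (R18) $l^\circ_J(l^\bullet_I\circ J)((m_J\bullet I)\circ J)\delta_{J,I,J,J}(J\bullet(I\circ(\phi^\bullet_0\bullet J)\Delta_J))=l^\bullet_J(J\bullet l^\circ_J)$. Hopf monoid: a bimonoid $H$ with an antipode, i.e. a morphism $\Sigma_H:H\to H^-$ in $\mathcal C$ such that $((m_H\bullet I)\circ J)\varphi_{H,H}(H\bullet\Sigma_H)\Delta_H=((u_H\bullet I)\circ J)(\Delta_I\circ J)(l^\circ_J)^{-1}\varepsilon_H$ and $(J\circ(I\bullet m_H))\psi_{H,H}(\Sigma_H\bullet H)\Delta_H=(J\circ(I\bullet u_H))(J\circ\Delta_I)(r^\circ_J)^{-1}\varepsilon_H$.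 *)

theory Defs
  imports Main
begin

section \<open>Categories\<close>

text \<open>
  Every element of the type \<open>'o\<close> is an object and every element of the type \<open>'m\<close> is a morphism. Composition is a total function whose value
  is meaningful only if the domain of the left factor is the codomain of the right factor.
\<close>

record ('o, 'm) category =
  Dom :: "'m \<Rightarrow> 'o"
  Cod :: "'m \<Rightarrow> 'o"
  Ident :: "'o \<Rightarrow> 'm" ("\<one>\<index>")
  Comp :: "'m \<Rightarrow> 'm \<Rightarrow> 'm" (infixl "\<cdot>\<index>" 60)

locale category =
  fixes C :: "('o, 'm, 'z) category_scheme" (structure)
  assumes dom_ident [simp]: "Dom C (\<one> X) = X"
    and cod_ident [simp]: "Cod C (\<one> X) = X"
    and dom_comp [simp]: "Dom C g = Cod C f \<Longrightarrow> Dom C (g \<cdot> f) = Dom C f"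
    and cod_comp [simp]: "Dom C g = Cod C f \<Longrightarrow> Cod C (g \<cdot> f) = Cod C g"
    and comp_ident [simp]: "f \<cdot> \<one> (Dom C f) = f"
    and ident_comp [simp]: "\<one> (Cod C f) \<cdot> f = f"
    and comp_assoc: "Dom C h = Cod C g \<Longrightarrow> Dom C g = Cod C f \<Longrightarrow> h \<cdot> g \<cdot> f = h \<cdot> (g \<cdot> f)"

definition hom :: "('o, 'm, 'z) category_scheme \<Rightarrow> 'o \<Rightarrow> 'o \<Rightarrow> 'm set" where
  "hom C X Y = {f. Dom C f = X \<and> Cod C f = Y}"

definition monic :: "('o, 'm, 'z) category_scheme \<Rightarrow> 'm \<Rightarrow> bool" where
  "monic C f \<longleftrightarrow> (\<forall>g h. Cod C g = Dom C f \<and> Cod C h = Dom C f \<and> Dom C g = Dom C h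
      \<and> f \<cdot>\<^bsub>C\<^esub> g = f \<cdot>\<^bsub>C\<^esub> h \<longrightarrow> g = h)"

text \<open>
  Isomorphisms and pullbacks are needed both in a category \<open>C\<close> and in the category of bimonoids
  in \<open>C\<close>, whose hom sets consist of morphisms of \<open>C\<close> and whose composition and identities are
  those of \<open>C\<close>. They are therefore defined relative to a family \<open>Hom\<close> of hom sets, indexed by the
  objects of the category in question, and an identity and a composition operation.
\<close>

definition iso_in :: "('x \<Rightarrow> 'x \<Rightarrow> 'm set) \<Rightarrow> ('x \<Rightarrow> 'm) \<Rightarrow> ('m \<Rightarrow> 'm \<Rightarrow> 'm) \<Rightarrow> 'x \<Rightarrow> 'x \<Rightarrow> 'm \<Rightarrow> bool"
  where
  "iso_in Hom idt cmp X Y f \<longleftrightarrow>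
     f \<in> Hom X Y \<and> (\<exists>g \<in> Hom Y X. cmp g f = idt X \<and> cmp f g = idt Y)"

text \<open>
  \<open>pullback_in Hom cmp P X Y Z p q f g\<close>: the object \<open>P\<close> with projections \<open>p : P \<rightarrow> X\<close> and
  \<open>q : P \<rightarrow> Y\<close> is a pullback of \<open>f : X \<rightarrow> Z\<close> and \<open>g : Y \<rightarrow> Z\<close>.
\<close>

definition pullback_in :: "('x \<Rightarrow> 'x \<Rightarrow> 'm set) \<Rightarrow> ('m \<Rightarrow> 'm \<Rightarrow> 'm) \<Rightarrow>
    'x \<Rightarrow> 'x \<Rightarrow> 'x \<Rightarrow> 'x \<Rightarrow> 'm \<Rightarrow> 'm \<Rightarrow> 'm \<Rightarrow> 'm \<Rightarrow> bool"
  where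
  "pullback_in Hom cmp P X Y Z p q f g \<longleftrightarrow>
     f \<in> Hom X Z \<and> g \<in> Hom Y Z \<and> p \<in> Hom P X \<and> q \<in> Hom P Y \<and> cmp f p = cmp g q \<and>
     (\<forall>Q. \<forall>p' \<in> Hom Q X. \<forall>q' \<in> Hom Q Y. cmp f p' = cmp g q' \<longrightarrow>
        (\<exists>!h. h \<in> Hom Q P \<and> cmp p h = p' \<and> cmp q h = q'))"

abbreviation iso :: "('o, 'm, 'z) category_scheme \<Rightarrow> 'm \<Rightarrow> bool" where
  "iso C f \<equiv> iso_in (hom C) (Ident C) (Comp C) (Dom C f) (Cod C f) f"

definition inverse_of :: "('o, 'm, 'z) category_scheme \<Rightarrow> 'm \<Rightarrow> 'm" ("inv\<index> _" [1000] 999) where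
  "inv\<^bsub>C\<^esub> f = (THE g. g \<in> hom C (Cod C f) (Dom C f) \<and>
      g \<cdot>\<^bsub>C\<^esub> f = \<one>\<^bsub>C\<^esub> (Dom C f) \<and> f \<cdot>\<^bsub>C\<^esub> g = \<one>\<^bsub>C\<^esub> (Cod C f))"

text \<open>
  A functor that preserves pullbacks of pairs of monomorphisms preserves monomorphisms, since \<open>f\<close>
  is monic iff it has a kernel pair with identity projections. So requiring the image square
  to consist of monomorphisms again is no extra condition.
\<close>

definition binary_intersection ::
    "('o, 'm, 'z) category_scheme \<Rightarrow> 'o \<Rightarrow> 'm \<Rightarrow> 'm \<Rightarrow> 'm \<Rightarrow> 'm \<Rightarrow> bool" where
  "binary_intersection C P p q f g \<longleftrightarrow> monic C f \<and> monic C g \<and>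
     pullback_in (hom C) (Comp C) P (Dom C f) (Dom C g) (Cod C f) p q f g"

definition has_binary_intersections :: "('o, 'm, 'z) category_scheme \<Rightarrow> bool" where
  "has_binary_intersections C \<longleftrightarrow>
     (\<forall>f g. monic C f \<and> monic C g \<and> Cod C f = Cod C g \<longrightarrow> (\<exists>P p q. binary_intersection C P p q f g))"

definition preserves_binary_intersections ::
    "('o, 'm, 'z) category_scheme \<Rightarrow> ('o \<Rightarrow> 'o) \<Rightarrow> ('m \<Rightarrow> 'm) \<Rightarrow> bool" where
  "preserves_binary_intersections C FO FM \<longleftrightarrow>
     (\<forall>P p q f g. binary_intersection C P p q f g \<longrightarrow>
        binary_intersection C (FO P) (FM p) (FM q) (FM f) (FM g))"

locale endofunctor = category C
  for C :: "('o, 'm, 'z) category_scheme" (structure) +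
  fixes FO :: "'o \<Rightarrow> 'o" and FM :: "'m \<Rightarrow> 'm"
  assumes functor_dom [simp]: "Dom C (FM f) = FO (Dom C f)"
    and functor_cod [simp]: "Cod C (FM f) = FO (Cod C f)"
    and functor_ident [simp]: "FM (\<one> X) = \<one> (FO X)"
    and functor_comp: "Dom C g = Cod C f \<Longrightarrow> FM (g \<cdot> f) = FM g \<cdot> FM f"


section \<open>Monoidal categories\<close>

record ('o, 'm) tensor =
  tob :: "'o \<Rightarrow> 'o \<Rightarrow> 'o"
  tmor :: "'m \<Rightarrow> 'm \<Rightarrow> 'm"
  tunit :: 'o
  tassoc :: "'o \<Rightarrow> 'o \<Rightarrow> 'o \<Rightarrow> 'm"
  tlunit :: "'o \<Rightarrow> 'm"
  trunit :: "'o \<Rightarrow> 'm"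

locale monoidal_category = category C
  for C :: "('o, 'm, 'z) category_scheme" (structure) +
  fixes T :: "('o, 'm) tensor"
  assumes tensor_dom [simp]: "Dom C (tmor T f g) = tob T (Dom C f) (Dom C g)"
    and tensor_cod [simp]: "Cod C (tmor T f g) = tob T (Cod C f) (Cod C g)"
    and tensor_ident [simp]: "tmor T (\<one> X) (\<one> Y) = \<one> (tob T X Y)"
    and tensor_comp: "Dom C g = Cod C f \<Longrightarrow> Dom C k = Cod C h \<Longrightarrow>
          tmor T (g \<cdot> f) (k \<cdot> h) = tmor T g k \<cdot> tmor T f h"
    and assoc_dom [simp]: "Dom C (tassoc T X Y Z) = tob T (tob T X Y) Z"
    and assoc_cod [simp]: "Cod C (tassoc T X Y Z) = tob T X (tob T Y Z)"
    and assoc_iso: "iso C (tassoc T X Y Z)"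
    and assoc_natural: "tassoc T (Cod C f) (Cod C g) (Cod C h) \<cdot> tmor T (tmor T f g) h
          = tmor T f (tmor T g h) \<cdot> tassoc T (Dom C f) (Dom C g) (Dom C h)"
    and lunit_dom [simp]: "Dom C (tlunit T X) = tob T (tunit T) X"
    and lunit_cod [simp]: "Cod C (tlunit T X) = X"
    and lunit_iso: "iso C (tlunit T X)"
    and lunit_natural: "tlunit T (Cod C f) \<cdot> tmor T (\<one> (tunit T)) f = f \<cdot> tlunit T (Dom C f)"
    and runit_dom [simp]: "Dom C (trunit T X) = tob T X (tunit T)"
    and runit_cod [simp]: "Cod C (trunit T X) = X"
    and runit_iso: "iso C (trunit T X)"
    and runit_natural: "trunit T (Cod C f) \<cdot> tmor T f (\<one> (tunit T)) = f \<cdot> trunit T (Dom C f)"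
    and pentagon: "tassoc T X Y (tob T Z W) \<cdot> tassoc T (tob T X Y) Z W
          = tmor T (\<one> X) (tassoc T Y Z W) \<cdot> tassoc T X (tob T Y Z) W \<cdot> tmor T (tassoc T X Y Z) (\<one> W)"
    and triangle: "tmor T (\<one> X) (tlunit T Y) \<cdot> tassoc T X (tunit T) Y = tmor T (trunit T X) (\<one> Y)"

definition rev_tensor :: "('o, 'm, 'z) category_scheme \<Rightarrow> ('o, 'm) tensor \<Rightarrow> ('o, 'm) tensor" where
  "rev_tensor C T =
     \<lparr> tob = (\<lambda>X Y. tob T Y X), tmor = (\<lambda>f g. tmor T g f), tunit = tunit T,
       tassoc = (\<lambda>X Y Z. inv\<^bsub>C\<^esub> (tassoc T Z Y X)), tlunit = trunit T, trunit = tlunit T \<rparr>"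

locale lax_monoidal_endofunctor = endofunctor C FO FM
  for C :: "('o, 'm, 'z) category_scheme" (structure)
    and T T' :: "('o, 'm) tensor" and FO :: "'o \<Rightarrow> 'o" and FM :: "'m \<Rightarrow> 'm" +
  fixes \<phi> :: "'o \<Rightarrow> 'o \<Rightarrow> 'm" and \<phi>0 :: 'm
  assumes lax_hom: "\<phi> X Y \<in> hom C (tob T' (FO X) (FO Y)) (FO (tob T X Y))"
    and lax_unit_hom: "\<phi>0 \<in> hom C (tunit T') (FO (tunit T))"
    and lax_natural: "\<phi> (Cod C f) (Cod C g) \<cdot> tmor T' (FM f) (FM g)
          = FM (tmor T f g) \<cdot> \<phi> (Dom C f) (Dom C g)"
    and lax_assoc: "FM (tassoc T X Y Z) \<cdot> \<phi> (tob T X Y) Z \<cdot> tmor T' (\<phi> X Y) (\<one> (FO Z))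
          = \<phi> X (tob T Y Z) \<cdot> tmor T' (\<one> (FO X)) (\<phi> Y Z) \<cdot> tassoc T' (FO X) (FO Y) (FO Z)"
    and lax_lunit: "FM (tlunit T X) \<cdot> \<phi> (tunit T) X \<cdot> tmor T' \<phi>0 (\<one> (FO X)) = tlunit T' (FO X)"
    and lax_runit: "FM (trunit T X) \<cdot> \<phi> X (tunit T) \<cdot> tmor T' (\<one> (FO X)) \<phi>0 = trunit T' (FO X)"

definition monoid_in ::
    "('o, 'm, 'z) category_scheme \<Rightarrow> ('o, 'm) tensor \<Rightarrow> 'o \<Rightarrow> 'm \<Rightarrow> 'm \<Rightarrow> bool" where
  "monoid_in C T M m u \<longleftrightarrow>
     m \<in> hom C (tob T M M) M \<and> u \<in> hom C (tunit T) M \<and>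
     m \<cdot>\<^bsub>C\<^esub> tmor T m (\<one>\<^bsub>C\<^esub> M) = m \<cdot>\<^bsub>C\<^esub> tmor T (\<one>\<^bsub>C\<^esub> M) m \<cdot>\<^bsub>C\<^esub> tassoc T M M M \<and>
     m \<cdot>\<^bsub>C\<^esub> tmor T u (\<one>\<^bsub>C\<^esub> M) = tlunit T M \<and>
     m \<cdot>\<^bsub>C\<^esub> tmor T (\<one>\<^bsub>C\<^esub> M) u = trunit T M"

definition comonoid_in ::
    "('o, 'm, 'z) category_scheme \<Rightarrow> ('o, 'm) tensor \<Rightarrow> 'o \<Rightarrow> 'm \<Rightarrow> 'm \<Rightarrow> bool" where
  "comonoid_in C T M d e \<longleftrightarrow>
     d \<in> hom C M (tob T M M) \<and> e \<in> hom C M (tunit T) \<and>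
     tassoc T M M M \<cdot>\<^bsub>C\<^esub> tmor T d (\<one>\<^bsub>C\<^esub> M) \<cdot>\<^bsub>C\<^esub> d = tmor T (\<one>\<^bsub>C\<^esub> M) d \<cdot>\<^bsub>C\<^esub> d \<and>
     tlunit T M \<cdot>\<^bsub>C\<^esub> tmor T e (\<one>\<^bsub>C\<^esub> M) \<cdot>\<^bsub>C\<^esub> d = \<one>\<^bsub>C\<^esub> M \<and>
     trunit T M \<cdot>\<^bsub>C\<^esub> tmor T (\<one>\<^bsub>C\<^esub> M) e \<cdot>\<^bsub>C\<^esub> d = \<one>\<^bsub>C\<^esub> M"

locale braiding = monoidal_category C T
  for C :: "('o, 'm, 'z) category_scheme" (structure) and T :: "('o, 'm) tensor" +
  fixes s :: "'o \<Rightarrow> 'o \<Rightarrow> 'm"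
  assumes braid_dom [simp]: "Dom C (s X Y) = tob T X Y"
    and braid_cod [simp]: "Cod C (s X Y) = tob T Y X"
    and braid_iso: "iso C (s X Y)"
    and braid_natural: "s (Cod C f) (Cod C g) \<cdot> tmor T f g = tmor T g f \<cdot> s (Dom C f) (Dom C g)"
    and hexagon1: "tassoc T Y Z X \<cdot> s X (tob T Y Z) \<cdot> tassoc T X Y Z
          = tmor T (\<one> Y) (s X Z) \<cdot> tassoc T Y X Z \<cdot> tmor T (s X Y) (\<one> Z)"
    and hexagon2: "inv (tassoc T Z X Y) \<cdot> s (tob T X Y) Z \<cdot> inv (tassoc T X Y Z)
          = tmor T (s X Z) (\<one> Y) \<cdot> inv (tassoc T X Z Y) \<cdot> tmor T (\<one> X) (s Y Z)"


section \<open>Duoidal categories\<close>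

text \<open>
  Tensoring of objects is written \<open>\<odot>\<close> and \<open>\<bullet>\<close>, tensoring of morphisms \<open>\<odot>\<^sub>m\<close> and \<open>\<bullet>\<^sub>m\<close>.
  The common value of the counit of \<open>I\<close> and the unit of \<open>J\<close> is \<open>\<epsilon>\<^sub>I\<close>. No monoidal structure is
  assumed to be strict, so the associativity constraints appear explicitly in all formulas.
\<close>

record ('o, 'm) duoidal = "('o, 'm) category" +
  circ :: "('o, 'm) tensor"
  bul :: "('o, 'm) tensor"
  interchange :: "'o \<Rightarrow> 'o \<Rightarrow> 'o \<Rightarrow> 'o \<Rightarrow> 'm" ("\<zeta>\<index>")
  DeltaI :: 'm ("\<Delta>\<^sub>I\<index>")
  mJ :: 'm ("m\<^sub>J\<index>")
  epsI :: 'm ("\<epsilon>\<^sub>I\<index>")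

abbreviation circ_ob (infixl "\<odot>\<index>" 70) where "X \<odot>\<^bsub>C\<^esub> Y \<equiv> tob (circ C) X Y"
abbreviation circ_mor (infixl "\<odot>\<^sub>m\<index>" 70) where "f \<odot>\<^sub>m\<^bsub>C\<^esub> g \<equiv> tmor (circ C) f g"
abbreviation circ_unit ("\<I>\<index>") where "\<I>\<^bsub>C\<^esub> \<equiv> tunit (circ C)"
abbreviation circ_assoc ("a\<^sub>\<odot>\<index>") where "a\<^sub>\<odot>\<^bsub>C\<^esub> \<equiv> tassoc (circ C)"
abbreviation circ_lunit ("l\<^sub>\<odot>\<index>") where "l\<^sub>\<odot>\<^bsub>C\<^esub> \<equiv> tlunit (circ C)"
abbreviation circ_runit ("r\<^sub>\<odot>\<index>") where "r\<^sub>\<odot>\<^bsub>C\<^esub> \<equiv> trunit (circ C)"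
abbreviation bul_ob (infixl "\<bullet>\<index>" 70) where "X \<bullet>\<^bsub>C\<^esub> Y \<equiv> tob (bul C) X Y"
abbreviation bul_mor (infixl "\<bullet>\<^sub>m\<index>" 70) where "f \<bullet>\<^sub>m\<^bsub>C\<^esub> g \<equiv> tmor (bul C) f g"
abbreviation bul_unit ("\<J>\<index>") where "\<J>\<^bsub>C\<^esub> \<equiv> tunit (bul C)"
abbreviation bul_assoc ("a\<^sub>\<bullet>\<index>") where "a\<^sub>\<bullet>\<^bsub>C\<^esub> \<equiv> tassoc (bul C)"
abbreviation bul_lunit ("l\<^sub>\<bullet>\<index>") where "l\<^sub>\<bullet>\<^bsub>C\<^esub> \<equiv> tlunit (bul C)"
abbreviation bul_runit ("r\<^sub>\<bullet>\<index>") where "r\<^sub>\<bullet>\<^bsub>C\<^esub> \<equiv> trunit (bul C)"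

locale duoidal_category =
  category C +
  circ: monoidal_category C "circ C" +
  bul: monoidal_category C "bul C"
  for C :: "('o, 'm, 'z) duoidal_scheme" (structure) +
  assumes zeta_dom [simp]: "Dom C (\<zeta> X Y Z T) = (X \<bullet> Y) \<odot> (Z \<bullet> T)"
    and zeta_cod [simp]: "Cod C (\<zeta> X Y Z T) = (X \<odot> Z) \<bullet> (Y \<odot> T)"
    and zeta_natural: "\<zeta> (Cod C x) (Cod C y) (Cod C z) (Cod C t) \<cdot> ((x \<bullet>\<^sub>m y) \<odot>\<^sub>m (z \<bullet>\<^sub>m t))
          = ((x \<odot>\<^sub>m z) \<bullet>\<^sub>m (y \<odot>\<^sub>m t)) \<cdot> \<zeta> (Dom C x) (Dom C y) (Dom C z) (Dom C t)"
    and J_monoid: "monoid_in C (circ C) \<J> m\<^sub>J \<epsilon>\<^sub>I"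
    and I_comonoid: "comonoid_in C (bul C) \<I> \<Delta>\<^sub>I \<epsilon>\<^sub>I"
    and zeta_circ_assoc:
      "\<zeta> X Y (Z \<odot> U) (T \<odot> V) \<cdot> (\<one> (X \<bullet> Y) \<odot>\<^sub>m \<zeta> Z T U V) \<cdot> a\<^sub>\<odot> (X \<bullet> Y) (Z \<bullet> T) (U \<bullet> V)
         = (a\<^sub>\<odot> X Z U \<bullet>\<^sub>m a\<^sub>\<odot> Y T V) \<cdot> \<zeta> (X \<odot> Z) (Y \<odot> T) U V \<cdot> (\<zeta> X Y Z T \<odot>\<^sub>m \<one> (U \<bullet> V))"
    and zeta_bul_assoc:
      "(\<one> (X \<odot> T) \<bullet>\<^sub>m \<zeta> Y Z U V) \<cdot> \<zeta> X (Y \<bullet> Z) T (U \<bullet> V) \<cdot> (a\<^sub>\<bullet> X Y Z \<odot>\<^sub>m a\<^sub>\<bullet> T U V)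
         = a\<^sub>\<bullet> (X \<odot> T) (Y \<odot> U) (Z \<odot> V) \<cdot> (\<zeta> X Y T U \<bullet>\<^sub>m \<one> (Z \<odot> V)) \<cdot> \<zeta> (X \<bullet> Y) Z (T \<bullet> U) V"
    and zeta_circ_lunit:
      "(l\<^sub>\<odot> X \<bullet>\<^sub>m l\<^sub>\<odot> Y) \<cdot> \<zeta> \<I> \<I> X Y \<cdot> (\<Delta>\<^sub>I \<odot>\<^sub>m \<one> (X \<bullet> Y)) = l\<^sub>\<odot> (X \<bullet> Y)"
    and zeta_circ_runit:
      "(r\<^sub>\<odot> X \<bullet>\<^sub>m r\<^sub>\<odot> Y) \<cdot> \<zeta> X Y \<I> \<I> \<cdot> (\<one> (X \<bullet> Y) \<odot>\<^sub>m \<Delta>\<^sub>I) = r\<^sub>\<odot> (X \<bullet> Y)"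
    and zeta_bul_lunit:
      "l\<^sub>\<bullet> (X \<odot> Y) \<cdot> (m\<^sub>J \<bullet>\<^sub>m \<one> (X \<odot> Y)) \<cdot> \<zeta> \<J> X \<J> Y = l\<^sub>\<bullet> X \<odot>\<^sub>m l\<^sub>\<bullet> Y"
    and zeta_bul_runit:
      "r\<^sub>\<bullet> (X \<odot> Y) \<cdot> (\<one> (X \<odot> Y) \<bullet>\<^sub>m m\<^sub>J) \<cdot> \<zeta> X \<J> Y \<J> = r\<^sub>\<bullet> X \<odot>\<^sub>m r\<^sub>\<bullet> Y"

locale bullet_braided_duoidal_category =
  duoidal_category C + braiding C "bul C" s
  for C :: "('o, 'm, 'z) duoidal_scheme" (structure) and s :: "'o \<Rightarrow> 'o \<Rightarrow> 'm" +
  assumes braid_zeta: "s (X \<odot> Z) (Y \<odot> T) \<cdot> \<zeta> X Y Z T = \<zeta> Y X T Z \<cdot> (s X Y \<odot>\<^sub>m s Z T)"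
    and braid_DeltaI: "s \<I> \<I> \<cdot> \<Delta>\<^sub>I = \<Delta>\<^sub>I"

definition bullet_preserves_binary_intersections :: "('o, 'm, 'z) duoidal_scheme \<Rightarrow> bool" where
  "bullet_preserves_binary_intersections C \<longleftrightarrow>
     (\<forall>X. preserves_binary_intersections C (\<lambda>Y. X \<bullet>\<^bsub>C\<^esub> Y) (\<lambda>f. \<one>\<^bsub>C\<^esub> X \<bullet>\<^sub>m\<^bsub>C\<^esub> f) \<and>
          preserves_binary_intersections C (\<lambda>Y. Y \<bullet>\<^bsub>C\<^esub> X) (\<lambda>f. f \<bullet>\<^sub>m\<^bsub>C\<^esub> \<one>\<^bsub>C\<^esub> X))"


section \<open>Bimonoids\<close>

record ('o, 'm) bimonoid =
  obj :: 'o
  mult :: 'm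
  unit :: 'm
  comult :: 'm
  counit :: 'm

context
  fixes C :: "('o, 'm, 'z) duoidal_scheme" (structure)
begin

definition is_bimonoid :: "('o, 'm) bimonoid \<Rightarrow> bool" where
  "is_bimonoid H \<longleftrightarrow>
     monoid_in C (circ C) (obj H) (mult H) (unit H) \<and>
     comonoid_in C (bul C) (obj H) (comult H) (counit H) \<and>
     comult H \<cdot> mult H = (mult H \<bullet>\<^sub>m mult H) \<cdot> \<zeta> (obj H) (obj H) (obj H) (obj H) \<cdot> (comult H \<odot>\<^sub>m comult H) \<and>
     counit H \<cdot> mult H = m\<^sub>J \<cdot> (counit H \<odot>\<^sub>m counit H) \<and>
     comult H \<cdot> unit H = (unit H \<bullet>\<^sub>m unit H) \<cdot> \<Delta>\<^sub>I \<and>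
     counit H \<cdot> unit H = \<epsilon>\<^sub>I"

definition bimon_hom :: "('o, 'm) bimonoid \<Rightarrow> ('o, 'm) bimonoid \<Rightarrow> 'm set" where
  "bimon_hom H H' = {f. is_bimonoid H \<and> is_bimonoid H' \<and> f \<in> hom C (obj H) (obj H') \<and>
     f \<cdot> mult H = mult H' \<cdot> (f \<odot>\<^sub>m f) \<and> f \<cdot> unit H = unit H' \<and>
     comult H' \<cdot> f = (f \<bullet>\<^sub>m f) \<cdot> comult H \<and> counit H' \<cdot> f = counit H}"

abbreviation bimon_ident :: "('o, 'm) bimonoid \<Rightarrow> 'm" where
  "bimon_ident H \<equiv> \<one> (obj H)"

definition bimon_iso :: "('o, 'm) bimonoid \<Rightarrow> ('o, 'm) bimonoid \<Rightarrow> 'm \<Rightarrow> bool" where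
  "bimon_iso = iso_in bimon_hom bimon_ident (Comp C)"

definition I_bimonoid :: "('o, 'm) bimonoid" where
  "I_bimonoid = \<lparr> obj = \<I>, mult = l\<^sub>\<odot> \<I>, unit = \<one> \<I>, comult = \<Delta>\<^sub>I, counit = \<epsilon>\<^sub>I \<rparr>"

definition is_kernel :: "('o, 'm) bimonoid \<Rightarrow> ('o, 'm) bimonoid \<Rightarrow> 'm \<Rightarrow> ('o, 'm) bimonoid \<Rightarrow> 'm \<Rightarrow> bool"
  where
  "is_kernel A H \<pi> K k \<longleftrightarrow>
     (\<exists>q. pullback_in bimon_hom (Comp C) K A I_bimonoid H k q \<pi> (unit H))"

definition cocommutative :: "('o \<Rightarrow> 'o \<Rightarrow> 'm) \<Rightarrow> ('o, 'm) bimonoid \<Rightarrow> bool" where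
  "cocommutative s H \<longleftrightarrow> s (obj H) (obj H) \<cdot> comult H = comult H"

end


section \<open>Reversions\<close>

text \<open>
  The reversion on objects and on morphisms is \<open>X\<^sup>-\<close> and \<open>f\<^sup>-\<^sub>m\<close>. The transformations
  decorated with a tilde in the mathematical notation are primed here.
\<close>

record ('o, 'm) reversible_duoidal = "('o, 'm) duoidal" +
  rev_ob :: "'o \<Rightarrow> 'o" ("_\<^sup>-\<index>" [1000] 1000)
  rev_mor :: "'m \<Rightarrow> 'm" ("_\<^sup>-\<^sub>m\<index>" [1000] 1000)
  phi_circ :: "'o \<Rightarrow> 'o \<Rightarrow> 'm" ("\<phi>\<^sub>\<odot>\<index>")
  phi_circ_unit :: 'm ("\<phi>0\<^sub>\<odot>\<index>")
  phi_bul :: "'o \<Rightarrow> 'o \<Rightarrow> 'm" ("\<phi>\<^sub>\<bullet>\<index>")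
  phi_bul_unit :: 'm ("\<phi>0\<^sub>\<bullet>\<index>")
  gamma :: "'o \<Rightarrow> 'o \<Rightarrow> 'o \<Rightarrow> 'o \<Rightarrow> 'm" ("\<gamma>\<index>")
  delta :: "'o \<Rightarrow> 'o \<Rightarrow> 'o \<Rightarrow> 'o \<Rightarrow> 'm" ("\<delta>\<index>")
  gamma' :: "'o \<Rightarrow> 'o \<Rightarrow> 'o \<Rightarrow> 'o \<Rightarrow> 'm" ("\<gamma>''\<index>")
  delta' :: "'o \<Rightarrow> 'o \<Rightarrow> 'o \<Rightarrow> 'o \<Rightarrow> 'm" ("\<delta>''\<index>")

context
  fixes C :: "('o, 'm, 'z) reversible_duoidal_scheme" (structure)
begin

definition psi :: "'o \<Rightarrow> 'o \<Rightarrow> 'm" where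
  "psi X Y = \<gamma> \<J> X \<I> Y \<cdot> ((inv (l\<^sub>\<bullet> X\<^sup>-) \<odot>\<^sub>m \<one> \<I>) \<bullet>\<^sub>m \<one> Y) \<cdot> (inv (r\<^sub>\<odot> X\<^sup>-) \<bullet>\<^sub>m \<one> Y)"

definition varphi :: "'o \<Rightarrow> 'o \<Rightarrow> 'm" where
  "varphi X Y = \<delta> X \<I> Y \<J> \<cdot> (\<one> X \<bullet>\<^sub>m (\<one> \<I> \<odot>\<^sub>m inv (r\<^sub>\<bullet> Y\<^sup>-))) \<cdot> (\<one> X \<bullet>\<^sub>m inv (l\<^sub>\<odot> Y\<^sup>-))"

definition psi' :: "'o \<Rightarrow> 'o \<Rightarrow> 'm" where
  "psi' X Y = l\<^sub>\<odot> (X \<odot> Y)\<^sup>- \<cdot> (\<one> \<I> \<odot>\<^sub>m r\<^sub>\<bullet> (X \<odot> Y)\<^sup>-) \<cdot> \<gamma>' X Y \<I> \<J>"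

definition varphi' :: "'o \<Rightarrow> 'o \<Rightarrow> 'm" where
  "varphi' X Y = r\<^sub>\<odot> (X \<odot> Y)\<^sup>- \<cdot> (l\<^sub>\<bullet> (X \<odot> Y)\<^sup>- \<odot>\<^sub>m \<one> \<I>) \<cdot> \<delta>' \<J> \<I> X Y"

definition is_antipode :: "('o, 'm) bimonoid \<Rightarrow> 'm \<Rightarrow> bool" where
  "is_antipode H S \<longleftrightarrow>
     S \<in> hom C (obj H) (obj H)\<^sup>- \<and>
     ((mult H \<bullet>\<^sub>m \<one> \<I>) \<odot>\<^sub>m \<one> \<J>) \<cdot> varphi (obj H) (obj H) \<cdot> (\<one> (obj H) \<bullet>\<^sub>m S) \<cdot> comult H
       = ((unit H \<bullet>\<^sub>m \<one> \<I>) \<odot>\<^sub>m \<one> \<J>) \<cdot> (\<Delta>\<^sub>I \<odot>\<^sub>m \<one> \<J>) \<cdot> inv (l\<^sub>\<odot> \<J>) \<cdot> counit H \<and>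
     (\<one> \<J> \<odot>\<^sub>m (\<one> \<I> \<bullet>\<^sub>m mult H)) \<cdot> psi (obj H) (obj H) \<cdot> (S \<bullet>\<^sub>m \<one> (obj H)) \<cdot> comult H
       = (\<one> \<J> \<odot>\<^sub>m (\<one> \<I> \<bullet>\<^sub>m unit H)) \<cdot> (\<one> \<J> \<odot>\<^sub>m \<Delta>\<^sub>I) \<cdot> inv (r\<^sub>\<odot> \<J>) \<cdot> counit H"

definition hopf_monoid :: "('o, 'm) bimonoid \<Rightarrow> bool" where
  "hopf_monoid H \<longleftrightarrow> is_bimonoid C H \<and> (\<exists>S. is_antipode H S)"

end

text \<open>
  In the axioms below the associativity constraints, which are usually suppressed, are
  inserted so that both sides have the same domain and codomain; by coherence and naturality the
  meaning does not depend on how this is done. The comultiplication of \<open>J\<close> is the inverse of the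
  unit constraint of \<open>\<bullet>\<close>.
\<close>

locale duoidal_category_with_reversion =
  duoidal_category C +
  rev_circ: lax_monoidal_endofunctor C "rev_tensor C (circ C)" "circ C" "rev_ob C" "rev_mor C"
    "\<phi>\<^sub>\<odot>" "\<phi>0\<^sub>\<odot>" +
  rev_bul: lax_monoidal_endofunctor C "rev_tensor C (bul C)" "bul C" "rev_ob C" "rev_mor C"
    "\<phi>\<^sub>\<bullet>" "\<phi>0\<^sub>\<bullet>"
  for C :: "('o, 'm, 'z) reversible_duoidal_scheme" (structure) +
  assumes rev_zeta:
      "\<phi>\<^sub>\<bullet> (Z \<odot> X) (T \<odot> Y) \<cdot> (\<phi>\<^sub>\<odot> X Z \<bullet>\<^sub>m \<phi>\<^sub>\<odot> Y T) \<cdot> \<zeta> X\<^sup>- Y\<^sup>- Z\<^sup>- T\<^sup>-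
         = (\<zeta> T Z Y X)\<^sup>-\<^sub>m \<cdot> \<phi>\<^sub>\<odot> (Y \<bullet> X) (T \<bullet> Z) \<cdot> (\<phi>\<^sub>\<bullet> X Y \<odot>\<^sub>m \<phi>\<^sub>\<bullet> Z T)"
    and rev_DeltaI: "\<phi>\<^sub>\<bullet> \<I> \<I> \<cdot> (\<phi>0\<^sub>\<odot> \<bullet>\<^sub>m \<phi>0\<^sub>\<odot>) \<cdot> \<Delta>\<^sub>I = \<Delta>\<^sub>I\<^sup>-\<^sub>m \<cdot> \<phi>0\<^sub>\<odot>"
    and rev_mJ: "m\<^sub>J\<^sup>-\<^sub>m \<cdot> \<phi>\<^sub>\<odot> \<J> \<J> \<cdot> (\<phi>0\<^sub>\<bullet> \<odot>\<^sub>m \<phi>0\<^sub>\<bullet>) = \<phi>0\<^sub>\<bullet> \<cdot> m\<^sub>J"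
    and rev_epsI: "\<phi>0\<^sub>\<bullet> \<cdot> \<epsilon>\<^sub>I = \<epsilon>\<^sub>I\<^sup>-\<^sub>m \<cdot> \<phi>0\<^sub>\<odot>"
    and gamma_dom [simp]: "Dom C (\<gamma> X Y Z T) = ((X \<bullet> Y\<^sup>-) \<odot> Z) \<bullet> T"
    and gamma_cod [simp]: "Cod C (\<gamma> X Y Z T) = X \<odot> (Z \<bullet> (Y \<odot> T))"
    and gamma_natural:
      "\<gamma> (Cod C x) (Cod C y) (Cod C z) (Cod C t) \<cdot> (((x \<bullet>\<^sub>m y\<^sup>-\<^sub>m) \<odot>\<^sub>m z) \<bullet>\<^sub>m t)
         = (x \<odot>\<^sub>m (z \<bullet>\<^sub>m (y \<odot>\<^sub>m t))) \<cdot> \<gamma> (Dom C x) (Dom C y) (Dom C z) (Dom C t)"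
    and delta_dom [simp]: "Dom C (\<delta> X Y Z T) = X \<bullet> (Y \<odot> (Z\<^sup>- \<bullet> T))"
    and delta_cod [simp]: "Cod C (\<delta> X Y Z T) = ((X \<odot> Z) \<bullet> Y) \<odot> T"
    and delta_natural:
      "\<delta> (Cod C x) (Cod C y) (Cod C z) (Cod C t) \<cdot> (x \<bullet>\<^sub>m (y \<odot>\<^sub>m (z\<^sup>-\<^sub>m \<bullet>\<^sub>m t)))
         = (((x \<odot>\<^sub>m z) \<bullet>\<^sub>m y) \<odot>\<^sub>m t) \<cdot> \<delta> (Dom C x) (Dom C y) (Dom C z) (Dom C t)"
    and gamma'_dom [simp]: "Dom C (\<gamma>' X Y Z T) = X\<^sup>- \<bullet> ((Y \<bullet> Z) \<odot> T)"
    and gamma'_cod [simp]: "Cod C (\<gamma>' X Y Z T) = Z \<odot> ((X \<odot> Y)\<^sup>- \<bullet> T)"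
    and gamma'_natural:
      "\<gamma>' (Cod C x) (Cod C y) (Cod C z) (Cod C t) \<cdot> (x\<^sup>-\<^sub>m \<bullet>\<^sub>m ((y \<bullet>\<^sub>m z) \<odot>\<^sub>m t))
         = (z \<odot>\<^sub>m ((x \<odot>\<^sub>m y)\<^sup>-\<^sub>m \<bullet>\<^sub>m t)) \<cdot> \<gamma>' (Dom C x) (Dom C y) (Dom C z) (Dom C t)"
    and delta'_dom [simp]: "Dom C (\<delta>' X Y Z T) = (X \<odot> (Y \<bullet> Z)) \<bullet> T\<^sup>-"
    and delta'_cod [simp]: "Cod C (\<delta>' X Y Z T) = (X \<bullet> (Z \<odot> T)\<^sup>-) \<odot> Y"
    and delta'_natural:
      "\<delta>' (Cod C x) (Cod C y) (Cod C z) (Cod C t) \<cdot> ((x \<odot>\<^sub>m (y \<bullet>\<^sub>m z)) \<bullet>\<^sub>m t\<^sup>-\<^sub>m)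
         = ((x \<bullet>\<^sub>m (z \<odot>\<^sub>m t)\<^sup>-\<^sub>m) \<odot>\<^sub>m y) \<cdot> \<delta>' (Dom C x) (Dom C y) (Dom C z) (Dom C t)"
    and R1:
      "\<gamma> X Y (Z \<odot> U) (T \<odot> V) \<cdot> (a\<^sub>\<odot> (X \<bullet> Y\<^sup>-) Z U \<bullet>\<^sub>m \<one> (T \<odot> V)) \<cdot> \<zeta> ((X \<bullet> Y\<^sup>-) \<odot> Z) T U V
         = (\<one> X \<odot>\<^sub>m (\<one> (Z \<odot> U) \<bullet>\<^sub>m a\<^sub>\<odot> Y T V)) \<cdot> (\<one> X \<odot>\<^sub>m \<zeta> Z (Y \<odot> T) U V)
           \<cdot> a\<^sub>\<odot> X (Z \<bullet> (Y \<odot> T)) (U \<bullet> V) \<cdot> (\<gamma> X Y Z T \<odot>\<^sub>m \<one> (U \<bullet> V))"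
    and R2:
      "(\<one> (X \<odot> T) \<bullet>\<^sub>m \<gamma> Y Z U V) \<cdot> a\<^sub>\<bullet> (X \<odot> T) ((Y \<bullet> Z\<^sup>-) \<odot> U) V
           \<cdot> (\<zeta> X (Y \<bullet> Z\<^sup>-) T U \<bullet>\<^sub>m \<one> V) \<cdot> ((a\<^sub>\<bullet> X Y Z\<^sup>- \<odot>\<^sub>m \<one> (T \<bullet> U)) \<bullet>\<^sub>m \<one> V)
         = \<zeta> X Y T (U \<bullet> (Z \<odot> V)) \<cdot> (\<one> (X \<bullet> Y) \<odot>\<^sub>m a\<^sub>\<bullet> T U (Z \<odot> V)) \<cdot> \<gamma> (X \<bullet> Y) Z (T \<bullet> U) V"
    and R3:
      "((a\<^sub>\<odot> X Z U \<bullet>\<^sub>m \<one> (Y \<odot> T)) \<odot>\<^sub>m \<one> V) \<cdot> \<delta> (X \<odot> Z) (Y \<odot> T) U V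
           \<cdot> (\<one> (X \<odot> Z) \<bullet>\<^sub>m inv (a\<^sub>\<odot> Y T (U\<^sup>- \<bullet> V))) \<cdot> \<zeta> X Y Z (T \<odot> (U\<^sup>- \<bullet> V))
         = (\<zeta> X Y (Z \<odot> U) T \<odot>\<^sub>m \<one> V) \<cdot> inv (a\<^sub>\<odot> (X \<bullet> Y) ((Z \<odot> U) \<bullet> T) V) \<cdot> (\<one> (X \<bullet> Y) \<odot>\<^sub>m \<delta> Z T U V)"
    and R4:
      "(\<delta> X Y T U \<bullet>\<^sub>m \<one> (Z \<odot> V)) \<cdot> inv (a\<^sub>\<bullet> X (Y \<odot> (T\<^sup>- \<bullet> U)) (Z \<odot> V))
           \<cdot> (\<one> X \<bullet>\<^sub>m \<zeta> Y Z (T\<^sup>- \<bullet> U) V) \<cdot> (\<one> X \<bullet>\<^sub>m (\<one> (Y \<bullet> Z) \<odot>\<^sub>m inv (a\<^sub>\<bullet> T\<^sup>- U V)))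
         = \<zeta> ((X \<odot> T) \<bullet> Y) Z U V \<cdot> (inv (a\<^sub>\<bullet> (X \<odot> T) Y Z) \<odot>\<^sub>m \<one> (U \<bullet> V)) \<cdot> \<delta> X (Y \<bullet> Z) T (U \<bullet> V)"
    and R5:
      "\<delta> X Y T (U \<bullet> (Z \<odot> V)) \<cdot> (\<one> X \<bullet>\<^sub>m (\<one> Y \<odot>\<^sub>m a\<^sub>\<bullet> T\<^sup>- U (Z \<odot> V)))
           \<cdot> (\<one> X \<bullet>\<^sub>m \<gamma> Y Z (T\<^sup>- \<bullet> U) V) \<cdot> a\<^sub>\<bullet> X ((Y \<bullet> Z\<^sup>-) \<odot> (T\<^sup>- \<bullet> U)) V
         = \<gamma> ((X \<odot> T) \<bullet> Y) Z U V \<cdot> ((inv (a\<^sub>\<bullet> (X \<odot> T) Y Z\<^sup>-) \<odot>\<^sub>m \<one> U) \<bullet>\<^sub>m \<one> V)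
           \<cdot> (\<delta> X (Y \<bullet> Z\<^sup>-) T U \<bullet>\<^sub>m \<one> V)"
    and R6:
      "l\<^sub>\<odot> (\<I> \<bullet> \<I>) \<cdot> (\<one> \<I> \<odot>\<^sub>m (\<one> \<I> \<bullet>\<^sub>m l\<^sub>\<odot> \<I>)) \<cdot> \<gamma> \<I> \<I> \<I> \<I>
           \<cdot> ((((\<one> \<I> \<bullet>\<^sub>m \<phi>0\<^sub>\<odot>) \<cdot> \<Delta>\<^sub>I) \<odot>\<^sub>m \<one> \<I>) \<bullet>\<^sub>m \<one> \<I>)
         = l\<^sub>\<odot> \<I> \<bullet>\<^sub>m \<one> \<I>"
    and R7:
      "r\<^sub>\<odot> (\<I> \<bullet> \<I>) \<cdot> ((r\<^sub>\<odot> \<I> \<bullet>\<^sub>m \<one> \<I>) \<odot>\<^sub>m \<one> \<I>) \<cdot> \<delta> \<I> \<I> \<I> \<I>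
           \<cdot> (\<one> \<I> \<bullet>\<^sub>m (\<one> \<I> \<odot>\<^sub>m ((\<phi>0\<^sub>\<odot> \<bullet>\<^sub>m \<one> \<I>) \<cdot> \<Delta>\<^sub>I)))
         = \<one> \<I> \<bullet>\<^sub>m r\<^sub>\<odot> \<I>"
    and R8:
      "\<gamma> (X \<odot> Z) Y (\<J> \<odot> \<J>) U \<cdot> (a\<^sub>\<odot> ((X \<odot> Z) \<bullet> Y\<^sup>-) \<J> \<J> \<bullet>\<^sub>m \<one> U)
           \<cdot> ((\<delta> X Y\<^sup>- Z \<J> \<odot>\<^sub>m \<one> \<J>) \<bullet>\<^sub>m \<one> U)
           \<cdot> (((\<one> X \<bullet>\<^sub>m (\<one> Y\<^sup>- \<odot>\<^sub>m inv (r\<^sub>\<bullet> Z\<^sup>-))) \<odot>\<^sub>m \<one> \<J>) \<bullet>\<^sub>m \<one> U)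
         = (\<one> (X \<odot> Z) \<odot>\<^sub>m \<zeta> \<J> Y \<J> U) \<cdot> (\<one> (X \<odot> Z) \<odot>\<^sub>m (inv (l\<^sub>\<bullet> Y) \<odot>\<^sub>m inv (l\<^sub>\<bullet> U)))
           \<cdot> inv (a\<^sub>\<odot> X Z (Y \<odot> U)) \<cdot> (\<one> X \<odot>\<^sub>m a\<^sub>\<odot> Z Y U) \<cdot> (\<one> X \<odot>\<^sub>m l\<^sub>\<bullet> ((Z \<odot> Y) \<odot> U))
           \<cdot> \<gamma> X (Z \<odot> Y) \<J> U \<cdot> (((\<one> X \<bullet>\<^sub>m \<phi>\<^sub>\<odot> Y Z) \<odot>\<^sub>m \<one> \<J>) \<bullet>\<^sub>m \<one> U)"
    and R9:
      "\<delta> X (\<J> \<odot> \<J>) Z (Y \<odot> U) \<cdot> (\<one> X \<bullet>\<^sub>m inv (a\<^sub>\<odot> \<J> \<J> (Z\<^sup>- \<bullet> (Y \<odot> U))))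
           \<cdot> (\<one> X \<bullet>\<^sub>m (\<one> \<J> \<odot>\<^sub>m \<gamma> \<J> Y Z\<^sup>- U))
           \<cdot> (\<one> X \<bullet>\<^sub>m (\<one> \<J> \<odot>\<^sub>m ((inv (l\<^sub>\<bullet> Y\<^sup>-) \<odot>\<^sub>m \<one> Z\<^sup>-) \<bullet>\<^sub>m \<one> U)))
         = (\<zeta> X \<J> Z \<J> \<odot>\<^sub>m \<one> (Y \<odot> U)) \<cdot> ((inv (r\<^sub>\<bullet> X) \<odot>\<^sub>m inv (r\<^sub>\<bullet> Z)) \<odot>\<^sub>m \<one> (Y \<odot> U))
           \<cdot> a\<^sub>\<odot> (X \<odot> Z) Y U \<cdot> (inv (a\<^sub>\<odot> X Z Y) \<odot>\<^sub>m \<one> U) \<cdot> (r\<^sub>\<bullet> (X \<odot> (Z \<odot> Y)) \<odot>\<^sub>m \<one> U)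
           \<cdot> \<delta> X \<J> (Z \<odot> Y) U \<cdot> (\<one> X \<bullet>\<^sub>m (\<one> \<J> \<odot>\<^sub>m (\<phi>\<^sub>\<odot> Y Z \<bullet>\<^sub>m \<one> U)))"
    and R10:
      "(a\<^sub>\<odot> X Y Z)\<^sup>-\<^sub>m \<cdot> varphi' C (X \<odot> Y) Z \<cdot> (psi C X Y \<bullet>\<^sub>m \<one> Z\<^sup>-)
         = psi' C X (Y \<odot> Z) \<cdot> (\<one> X\<^sup>- \<bullet>\<^sub>m varphi C Y Z) \<cdot> a\<^sub>\<bullet> X\<^sup>- Y Z\<^sup>-"
    and R11:
      "(r\<^sub>\<odot> X)\<^sup>-\<^sub>m \<cdot> l\<^sub>\<odot> (X \<odot> \<I>)\<^sup>- \<cdot> (\<one> \<I> \<odot>\<^sub>m r\<^sub>\<bullet> (X \<odot> \<I>)\<^sup>-) \<cdot> \<gamma>' X \<I> \<I> \<J> \<cdot> (\<one> X\<^sup>- \<bullet>\<^sub>m (\<Delta>\<^sub>I \<odot>\<^sub>m \<one> \<J>))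
         = r\<^sub>\<bullet> X\<^sup>- \<cdot> (\<one> X\<^sup>- \<bullet>\<^sub>m l\<^sub>\<odot> \<J>)"
    and R12:
      "(l\<^sub>\<odot> X)\<^sup>-\<^sub>m \<cdot> r\<^sub>\<odot> (\<I> \<odot> X)\<^sup>- \<cdot> (l\<^sub>\<bullet> (\<I> \<odot> X)\<^sup>- \<odot>\<^sub>m \<one> \<I>) \<cdot> \<delta>' \<J> \<I> \<I> X \<cdot> ((\<one> \<J> \<odot>\<^sub>m \<Delta>\<^sub>I) \<bullet>\<^sub>m \<one> X\<^sup>-)
         = l\<^sub>\<bullet> X\<^sup>- \<cdot> (r\<^sub>\<odot> \<J> \<bullet>\<^sub>m \<one> X\<^sup>-)"
    and R13:
      "(\<one> X \<odot>\<^sub>m a\<^sub>\<bullet> T (Z \<odot> U) (Y \<odot> V)) \<cdot> \<gamma> X Y (T \<bullet> (Z \<odot> U)) V \<cdot> (\<gamma> (X \<bullet> Y\<^sup>-) Z T U \<bullet>\<^sub>m \<one> V)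
         = (\<one> X \<odot>\<^sub>m (\<one> T \<bullet>\<^sub>m \<zeta> Z Y U V)) \<cdot> \<gamma> X (Z \<bullet> Y) T (U \<bullet> V)
           \<cdot> (((\<one> X \<bullet>\<^sub>m \<phi>\<^sub>\<bullet> Y Z) \<odot>\<^sub>m \<one> T) \<bullet>\<^sub>m \<one> (U \<bullet> V))
           \<cdot> ((a\<^sub>\<bullet> X Y\<^sup>- Z\<^sup>- \<odot>\<^sub>m \<one> T) \<bullet>\<^sub>m \<one> (U \<bullet> V)) \<cdot> a\<^sub>\<bullet> (((X \<bullet> Y\<^sup>-) \<bullet> Z\<^sup>-) \<odot> T) U V"
    and R14:
      "(inv (a\<^sub>\<bullet> (X \<odot> U) (Y \<odot> T) Z) \<odot>\<^sub>m \<one> V) \<cdot> \<delta> X ((Y \<odot> T) \<bullet> Z) U V \<cdot> (\<one> X \<bullet>\<^sub>m \<delta> Y Z T (U\<^sup>- \<bullet> V))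
         = ((\<zeta> X Y U T \<bullet>\<^sub>m \<one> Z) \<odot>\<^sub>m \<one> V) \<cdot> \<delta> (X \<bullet> Y) Z (U \<bullet> T) V
           \<cdot> (\<one> (X \<bullet> Y) \<bullet>\<^sub>m (\<one> Z \<odot>\<^sub>m (\<phi>\<^sub>\<bullet> T U \<bullet>\<^sub>m \<one> V)))
           \<cdot> (\<one> (X \<bullet> Y) \<bullet>\<^sub>m (\<one> Z \<odot>\<^sub>m inv (a\<^sub>\<bullet> T\<^sup>- U\<^sup>- V))) \<cdot> inv (a\<^sub>\<bullet> X Y (Z \<odot> (T\<^sup>- \<bullet> (U\<^sup>- \<bullet> V))))"
    and R15:
      "(\<one> X \<odot>\<^sub>m \<gamma> Z T U (Y \<odot> V)) \<cdot> \<gamma> X Y ((Z \<bullet> T\<^sup>-) \<odot> U) V \<cdot> (a\<^sub>\<odot> (X \<bullet> Y\<^sup>-) (Z \<bullet> T\<^sup>-) U \<bullet>\<^sub>m \<one> V)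
         = a\<^sub>\<odot> X Z (U \<bullet> (T \<odot> (Y \<odot> V))) \<cdot> (\<one> (X \<odot> Z) \<odot>\<^sub>m (\<one> U \<bullet>\<^sub>m a\<^sub>\<odot> T Y V))
           \<cdot> \<gamma> (X \<odot> Z) (T \<odot> Y) U V \<cdot> (((\<one> (X \<odot> Z) \<bullet>\<^sub>m \<phi>\<^sub>\<odot> Y T) \<odot>\<^sub>m \<one> U) \<bullet>\<^sub>m \<one> V)
           \<cdot> ((\<zeta> X Y\<^sup>- Z T\<^sup>- \<odot>\<^sub>m \<one> U) \<bullet>\<^sub>m \<one> V)"
    and R16:
      "((a\<^sub>\<odot> X U Z \<bullet>\<^sub>m \<one> Y) \<odot>\<^sub>m \<one> (T \<odot> V)) \<cdot> a\<^sub>\<odot> (((X \<odot> U) \<odot> Z) \<bullet> Y) T V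
           \<cdot> (\<delta> (X \<odot> U) Y Z T \<odot>\<^sub>m \<one> V) \<cdot> \<delta> X (Y \<odot> (Z\<^sup>- \<bullet> T)) U V
         = \<delta> X Y (U \<odot> Z) (T \<odot> V) \<cdot> (\<one> X \<bullet>\<^sub>m (\<one> Y \<odot>\<^sub>m (\<phi>\<^sub>\<odot> Z U \<bullet>\<^sub>m \<one> (T \<odot> V))))
           \<cdot> (\<one> X \<bullet>\<^sub>m (\<one> Y \<odot>\<^sub>m \<zeta> Z\<^sup>- T U\<^sup>- V)) \<cdot> (\<one> X \<bullet>\<^sub>m a\<^sub>\<odot> Y (Z\<^sup>- \<bullet> T) (U\<^sup>- \<bullet> V))"
    and R17:
      "r\<^sub>\<odot> \<J> \<cdot> (\<one> \<J> \<odot>\<^sub>m r\<^sub>\<bullet> \<I>) \<cdot> (\<one> \<J> \<odot>\<^sub>m (\<one> \<I> \<bullet>\<^sub>m m\<^sub>J)) \<cdot> \<gamma> \<J> \<J> \<I> \<J>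
           \<cdot> ((((\<one> \<J> \<bullet>\<^sub>m \<phi>0\<^sub>\<bullet>) \<cdot> inv (l\<^sub>\<bullet> \<J>)) \<odot>\<^sub>m \<one> \<I>) \<bullet>\<^sub>m \<one> \<J>)
         = r\<^sub>\<bullet> \<J> \<cdot> (r\<^sub>\<odot> \<J> \<bullet>\<^sub>m \<one> \<J>)"
    and R18:
      "l\<^sub>\<odot> \<J> \<cdot> (l\<^sub>\<bullet> \<I> \<odot>\<^sub>m \<one> \<J>) \<cdot> ((m\<^sub>J \<bullet>\<^sub>m \<one> \<I>) \<odot>\<^sub>m \<one> \<J>) \<cdot> \<delta> \<J> \<I> \<J> \<J>
           \<cdot> (\<one> \<J> \<bullet>\<^sub>m (\<one> \<I> \<odot>\<^sub>m ((\<phi>0\<^sub>\<bullet> \<bullet>\<^sub>m \<one> \<J>) \<cdot> inv (l\<^sub>\<bullet> \<J>))))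
         = l\<^sub>\<bullet> \<J> \<cdot> (\<one> \<J> \<bullet>\<^sub>m l\<^sub>\<odot> \<J>)"

end

theory Submission
  imports Defs
begin

text \<open>
  Regard elements as loops and arrows, as in the duoidal category of spans, where a Hopf monoid is a groupoid.
  The inclusion of the kernel and the section assemble to \<open>K \<odot> H \<rightarrow> A\<close>, which would be inverted by
  \<open>a \<mapsto> (a (\<sigma> (\<pi> a))\<^sup>-\<^sup>1, \<pi> a)\<close>. Since \<open>\<odot>\<close> need not preserve the intersection defining \<open>K\<close>, this
  formula only lands in \<open>(A \<bullet> I) \<odot> H\<close> at first. It is the coaction \<open>A \<rightarrow> A \<bullet> H\<close> followed by the
  inverse of the Galois map \<open>(X \<bullet> I) \<odot> H \<rightarrow> X \<bullet> H\<close> of the right \<open>H\<close>-module \<open>X = A\<close>.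
  The transformation \<open>\<gamma>\<close> turns the first component into a morphism \<open>A \<bullet> I \<rightarrow> A\<close> whose values are coinvariant,
  so that it factors through \<open>K\<close>; thus \<open>A \<bullet> I\<close> retracts to \<open>K\<close>, and retractions are preserved by \<open>\<odot> H\<close>.
  Hence \<open>K \<odot> H \<rightarrow> A\<close> has a right inverse, natural in the split epimorphism, and composing with the inverses
  of \<open>f\<close> and \<open>g\<close> yields the inverse of \<open>\<phi>\<close>. That \<open>K\<close>, defined by a universal property among bimonoids,
  can be computed in \<open>C\<close> requires cocommutativity. The only antipode used is that of \<open>H\<close>.
\<close>

section \<open>Categories and monoidal categories\<close>

text \<open>The antipode identities end in a factor \<open>J\<close> where a further arrow has been
  forgotten, so they do not directly control a third copy \<open>h3\<close> of an element. Inverting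
  the Galois map requires \<open>h3\<close> to survive. For this reason \<open>varphi\<close> is
  extended to an arbitrary last factor; (R5) reduces the extension to \<open>varphi\<close> itself,
  and (R9) rewrites \<open>(x y^-1) u\<close> as \<open>x (y^-1 u)\<close>, which is where
  \<open>psi\<close> appears. The Galois map is inverted for all right modules because two of them
  matter: \<open>A\<close>, which produces \<open>w\<close>, and the diagonal module
  \<open>A \<bullet> H\<close>, whose Galois map detects that \<open>w\<close> is coinvariant. Since
  \<open>w\<close> is characterised by its image under an isomorphism, its naturality needs no
  relation between the two antipodes. On the kernel side the difficulty is that \<open>K\<close> can
  be tested only by bimonoids, whereas \<open>e0\<close> is merely a morphism of \<open>C\<close>.
  The intersection of \<open>\<chi>\<close> and \<open>1 \<bullet> u_H\<close> mediates: it can be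
  tested by all morphisms of \<open>C\<close>, and it carries a bimonoid structure, through which it
  maps to \<open>K\<close>. The delicate point is its comultiplication, which has to be restricted
  in both tensor factors.\<close>

context category
begin

lemma ident_comp' [simp]: "Cod C f = X \<Longrightarrow> \<one> X \<cdot> f = f"
  using ident_comp by blast

lemma comp_ident' [simp]: "Dom C f = X \<Longrightarrow> f \<cdot> \<one> X = f"
  using comp_ident by blast

lemma comp_reduce: "f \<cdot> g = h \<Longrightarrow> Dom C f = Cod C g \<Longrightarrow> Dom C g = Cod C x \<Longrightarrow> f \<cdot> (g \<cdot> x) = h \<cdot> x"
  by (simp flip: comp_assoc)

lemma comp_reduce3: "f \<cdot> (g \<cdot> k) = h \<Longrightarrow> Dom C f = Cod C g \<Longrightarrow> Dom C g = Cod C k \<Longrightarrow> Dom C k = Cod C x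
    \<Longrightarrow> f \<cdot> (g \<cdot> (k \<cdot> x)) = h \<cdot> x"
  by (simp flip: comp_assoc)

lemma inverse_of:
  assumes "iso C f"
  shows "Dom C (inv f) = Cod C f" "Cod C (inv f) = Dom C f"
    "inv f \<cdot> f = \<one> (Dom C f)" "f \<cdot> inv f = \<one> (Cod C f)"
proof -
  let ?P = "\<lambda>g. g \<in> hom C (Cod C f) (Dom C f) \<and> g \<cdot> f = \<one> (Dom C f) \<and> f \<cdot> g = \<one> (Cod C f)"
  obtain g where g: "?P g" using assms unfolding iso_in_def by blast
  have "h = g" if h: "?P h" for h
  proof -
    have "h \<cdot> f \<cdot> g = h \<cdot> (f \<cdot> g)" by (rule comp_assoc) (use g h in \<open>simp_all add: hom_def\<close>)
    then show ?thesis using g h ident_comp comp_ident by (metis (mono_tags, lifting) hom_def mem_Collect_eq)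
  qed
  with g have "?P (inv f)" unfolding inverse_of_def by (rule theI)
  then show "Dom C (inv f) = Cod C f" "Cod C (inv f) = Dom C f"
    "inv f \<cdot> f = \<one> (Dom C f)" "f \<cdot> inv f = \<one> (Cod C f)" unfolding hom_def by blast+
qed

lemma inverse_of_comp:
  assumes "iso C f"
  shows "Cod C x = Dom C f \<Longrightarrow> inv f \<cdot> (f \<cdot> x) = x" "Cod C x = Cod C f \<Longrightarrow> f \<cdot> (inv f \<cdot> x) = x"
  by (simp_all add: assms inverse_of flip: comp_assoc)

lemma iso_cancel_left:
  assumes "iso C f" "Cod C x = Dom C f" "Cod C y = Dom C f" "f \<cdot> x = f \<cdot> y"
  shows "x = y"
proof -
  have "x = inv f \<cdot> (f \<cdot> x)" using inverse_of_comp(1)[OF assms(1,2)] by simp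
  also have "\<dots> = y" unfolding assms(4) by (rule inverse_of_comp(1)[OF assms(1,3)])
  finally show ?thesis .
qed

lemma iso_cancel_right:
  assumes "iso C f" "Dom C x = Cod C f" "Dom C y = Cod C f" "x \<cdot> f = y \<cdot> f"
  shows "x = y"
proof -
  have *: "z \<cdot> f \<cdot> inv f = z" if "Dom C z = Cod C f" for z
    using that inverse_of[OF assms(1)] by (simp add: comp_assoc)
  have "x = x \<cdot> f \<cdot> inv f" using *[OF assms(2)] by simp
  also have "\<dots> = y" unfolding assms(4) by (rule *[OF assms(3)])
  finally show ?thesis .
qed

lemma monicD:
  "monic C f \<Longrightarrow> Cod C x = Dom C f \<Longrightarrow> Cod C y = Dom C f \<Longrightarrow> Dom C x = Dom C y \<Longrightarrow> f \<cdot> x = f \<cdot> y \<Longrightarrow> x = y"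
  by (simp add: monic_def)

lemma monic_comp:
  assumes "monic C f" "monic C g" "Dom C f = Cod C g"
  shows "monic C (f \<cdot> g)"
  unfolding monic_def
proof clarify
  fix x y
  assume xy: "Cod C x = Dom C (f \<cdot> g)" "Cod C y = Dom C (f \<cdot> g)" "Dom C x = Dom C y"
    and eq: "f \<cdot> g \<cdot> x = f \<cdot> g \<cdot> y"
  have cod: "Cod C x = Dom C g" "Cod C y = Dom C g" using xy assms(3) by simp_all
  have "f \<cdot> (g \<cdot> x) = f \<cdot> (g \<cdot> y)" using eq cod assms(3) by (simp add: comp_assoc)
  then have "g \<cdot> x = g \<cdot> y"
    by (rule monicD[OF assms(1), rotated 3]) (simp_all add: cod xy(3) assms(3))
  then show "x = y" by (rule monicD[OF assms(2), rotated 3]) (simp_all add: cod xy(3))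
qed

lemma split_monic:
  assumes "g \<cdot> f = \<one> (Dom C f)" "Dom C g = Cod C f"
  shows "monic C f"
  unfolding monic_def
proof clarify
  fix x y assume cod: "Cod C x = Dom C f" "Cod C y = Dom C f" and eq: "f \<cdot> x = f \<cdot> y"
  have "x = g \<cdot> (f \<cdot> x)" using cod(1) assms(2) by (simp add: comp_reduce[OF assms(1)])
  also have "\<dots> = y" unfolding eq using cod(2) assms(2) by (simp add: comp_reduce[OF assms(1)])
  finally show "x = y" .
qed

end

section \<open>Unit coherence in a monoidal category\<close>

context monoidal_category
begin

abbreviation ob (infixl "\<otimes>" 70) where "X \<otimes> Y \<equiv> tob T X Y"
abbreviation mor (infixl "\<otimes>\<^sub>m" 70) where "f \<otimes>\<^sub>m g \<equiv> tmor T f g"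

lemma merge: "Dom C g = Cod C f \<Longrightarrow> Dom C k = Cod C h \<Longrightarrow> (g \<otimes>\<^sub>m k) \<cdot> (f \<otimes>\<^sub>m h) = (g \<cdot> f) \<otimes>\<^sub>m (k \<cdot> h)"
  by (rule tensor_comp[symmetric])

lemma merge': "Dom C g = Cod C f \<Longrightarrow> Dom C k = Cod C h \<Longrightarrow> Cod C x = Dom C f \<otimes> Dom C h \<Longrightarrow>
    (g \<otimes>\<^sub>m k) \<cdot> ((f \<otimes>\<^sub>m h) \<cdot> x) = ((g \<cdot> f) \<otimes>\<^sub>m (k \<cdot> h)) \<cdot> x"
  by (subst tensor_comp) (simp_all add: comp_assoc)

lemmas merges = merge merge'

lemma unit_invs [simp]:
  "Dom C (inv (tlunit T X)) = X" "Cod C (inv (tlunit T X)) = tunit T \<otimes> X"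
  "Dom C (inv (trunit T X)) = X" "Cod C (inv (trunit T X)) = X \<otimes> tunit T"
  "Dom C (inv (tassoc T X Y Z)) = X \<otimes> (Y \<otimes> Z)" "Cod C (inv (tassoc T X Y Z)) = (X \<otimes> Y) \<otimes> Z"
  using inverse_of[OF lunit_iso] inverse_of[OF runit_iso] inverse_of[OF assoc_iso] by simp_all

lemma inv_cancel [simp]:
  "inv (tlunit T X) \<cdot> tlunit T X = \<one> (tunit T \<otimes> X)" "tlunit T X \<cdot> inv (tlunit T X) = \<one> X"
  "inv (trunit T X) \<cdot> trunit T X = \<one> (X \<otimes> tunit T)" "trunit T X \<cdot> inv (trunit T X) = \<one> X"
  "inv (tassoc T X Y Z) \<cdot> tassoc T X Y Z = \<one> (X \<otimes> Y \<otimes> Z)"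
  "tassoc T X Y Z \<cdot> inv (tassoc T X Y Z) = \<one> (X \<otimes> (Y \<otimes> Z))"
  using inverse_of[OF lunit_iso] inverse_of[OF runit_iso] inverse_of[OF assoc_iso] by simp_all

lemma inv_cancel' [simp]:
  "Cod C f = tunit T \<otimes> X \<Longrightarrow> inv (tlunit T X) \<cdot> (tlunit T X \<cdot> f) = f"
  "Cod C f = X \<Longrightarrow> tlunit T X \<cdot> (inv (tlunit T X) \<cdot> f) = f"
  "Cod C f = X \<otimes> tunit T \<Longrightarrow> inv (trunit T X) \<cdot> (trunit T X \<cdot> f) = f"
  "Cod C f = X \<Longrightarrow> trunit T X \<cdot> (inv (trunit T X) \<cdot> f) = f"
  "Cod C f = X \<otimes> Y \<otimes> Z \<Longrightarrow> inv (tassoc T X Y Z) \<cdot> (tassoc T X Y Z \<cdot> f) = f"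
  "Cod C f = X \<otimes> (Y \<otimes> Z) \<Longrightarrow> tassoc T X Y Z \<cdot> (inv (tassoc T X Y Z) \<cdot> f) = f"
  by (simp_all flip: comp_assoc)

lemma nat_l: "Cod C f = X \<Longrightarrow> tlunit T X \<cdot> (\<one> (tunit T) \<otimes>\<^sub>m f) = f \<cdot> tlunit T (Dom C f)"
  using lunit_natural by blast

lemma nat_r: "Cod C f = X \<Longrightarrow> trunit T X \<cdot> (f \<otimes>\<^sub>m \<one> (tunit T)) = f \<cdot> trunit T (Dom C f)"
  using runit_natural by blast

lemma nat_a: "Cod C f = X \<Longrightarrow> Cod C g = Y \<Longrightarrow> Cod C h = Z \<Longrightarrow>
    tassoc T X Y Z \<cdot> (f \<otimes>\<^sub>m g \<otimes>\<^sub>m h) = (f \<otimes>\<^sub>m (g \<otimes>\<^sub>m h)) \<cdot> tassoc T (Dom C f) (Dom C g) (Dom C h)"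
  using assoc_natural by blast

lemma nat_li: "Dom C f = X \<Longrightarrow> (\<one> (tunit T) \<otimes>\<^sub>m f) \<cdot> inv (tlunit T X) = inv (tlunit T (Cod C f)) \<cdot> f"
  by (rule iso_cancel_left[OF lunit_iso[of "Cod C f"]]) (simp_all add: comp_reduce[OF nat_l] comp_assoc)

lemma nat_ri: "Dom C f = X \<Longrightarrow> (f \<otimes>\<^sub>m \<one> (tunit T)) \<cdot> inv (trunit T X) = inv (trunit T (Cod C f)) \<cdot> f"
  by (rule iso_cancel_left[OF runit_iso[of "Cod C f"]]) (simp_all add: comp_reduce[OF nat_r] comp_assoc)

lemma nat_ai: "Cod C f = X \<Longrightarrow> Cod C g = Y \<Longrightarrow> Cod C h = Z \<Longrightarrow>
    inv (tassoc T X Y Z) \<cdot> (f \<otimes>\<^sub>m (g \<otimes>\<^sub>m h)) = (f \<otimes>\<^sub>m g \<otimes>\<^sub>m h) \<cdot> inv (tassoc T (Dom C f) (Dom C g) (Dom C h))"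
  by (rule iso_cancel_left[OF assoc_iso[of X Y Z]]) (simp_all add: comp_reduce[OF nat_a] comp_assoc)

lemma nat_l': "Cod C f = X \<Longrightarrow> Cod C x = tunit T \<otimes> Dom C f \<Longrightarrow>
    tlunit T X \<cdot> ((\<one> (tunit T) \<otimes>\<^sub>m f) \<cdot> x) = f \<cdot> (tlunit T (Dom C f) \<cdot> x)"
  by (simp add: comp_reduce[OF nat_l] comp_assoc)

lemma nat_r': "Cod C f = X \<Longrightarrow> Cod C x = Dom C f \<otimes> tunit T \<Longrightarrow>
    trunit T X \<cdot> ((f \<otimes>\<^sub>m \<one> (tunit T)) \<cdot> x) = f \<cdot> (trunit T (Dom C f) \<cdot> x)"
  by (simp add: comp_reduce[OF nat_r] comp_assoc)

lemma nat_a': "Cod C f = X \<Longrightarrow> Cod C g = Y \<Longrightarrow> Cod C h = Z \<Longrightarrow> Cod C x = Dom C f \<otimes> Dom C g \<otimes> Dom C h \<Longrightarrow>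
    tassoc T X Y Z \<cdot> ((f \<otimes>\<^sub>m g \<otimes>\<^sub>m h) \<cdot> x) = (f \<otimes>\<^sub>m (g \<otimes>\<^sub>m h)) \<cdot> (tassoc T (Dom C f) (Dom C g) (Dom C h) \<cdot> x)"
  by (simp add: comp_reduce[OF nat_a] comp_assoc)

lemma nat_li': "Dom C f = X \<Longrightarrow> Cod C x = X \<Longrightarrow>
    (\<one> (tunit T) \<otimes>\<^sub>m f) \<cdot> (inv (tlunit T X) \<cdot> x) = inv (tlunit T (Cod C f)) \<cdot> (f \<cdot> x)"
  by (simp add: comp_reduce[OF nat_li] comp_assoc)

lemma nat_ri': "Dom C f = X \<Longrightarrow> Cod C x = X \<Longrightarrow>
    (f \<otimes>\<^sub>m \<one> (tunit T)) \<cdot> (inv (trunit T X) \<cdot> x) = inv (trunit T (Cod C f)) \<cdot> (f \<cdot> x)"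
  by (simp add: comp_reduce[OF nat_ri] comp_assoc)

lemma nat_ai': "Cod C f = X \<Longrightarrow> Cod C g = Y \<Longrightarrow> Cod C h = Z \<Longrightarrow> Cod C x = Dom C f \<otimes> (Dom C g \<otimes> Dom C h) \<Longrightarrow>
    inv (tassoc T X Y Z) \<cdot> ((f \<otimes>\<^sub>m (g \<otimes>\<^sub>m h)) \<cdot> x)
      = (f \<otimes>\<^sub>m g \<otimes>\<^sub>m h) \<cdot> (inv (tassoc T (Dom C f) (Dom C g) (Dom C h)) \<cdot> x)"
  by (simp add: comp_reduce[OF nat_ai] comp_assoc)

lemmas nats = nat_l nat_r nat_a nat_li nat_ri nat_ai nat_l' nat_r' nat_a' nat_li' nat_ri' nat_ai'

text \<open>Tensoring with the unit is isomorphic to the identity functor. Kelly's derivation of the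
  remaining unit coherences tests equations after such a tensoring.\<close>

lemma lunit_faithful:
  assumes "\<one> (tunit T) \<otimes>\<^sub>m f = \<one> (tunit T) \<otimes>\<^sub>m g" "Dom C f = Dom C g" "Cod C f = Cod C g"
  shows "f = g"
  by (rule iso_cancel_right[OF lunit_iso[of "Dom C f"]])
    (use assms lunit_natural[of f] lunit_natural[of g] in simp_all)

lemma runit_faithful:
  assumes "f \<otimes>\<^sub>m \<one> (tunit T) = g \<otimes>\<^sub>m \<one> (tunit T)" "Dom C f = Dom C g" "Cod C f = Cod C g"
  shows "f = g"
  by (rule iso_cancel_right[OF runit_iso[of "Dom C f"]])
    (use assms runit_natural[of f] runit_natural[of g] in simp_all)

lemma triangle_comp: "Cod C f = X \<otimes> tunit T \<otimes> Y \<Longrightarrow>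
    (\<one> X \<otimes>\<^sub>m tlunit T Y) \<cdot> (tassoc T X (tunit T) Y \<cdot> f) = (trunit T X \<otimes>\<^sub>m \<one> Y) \<cdot> f"
  by (simp add: comp_reduce[OF triangle])

lemma split_l: "Dom C g = Cod C f \<Longrightarrow> \<one> X \<otimes>\<^sub>m (g \<cdot> f) = (\<one> X \<otimes>\<^sub>m g) \<cdot> (\<one> X \<otimes>\<^sub>m f)"
  by (simp add: merge)

lemma split_r: "Dom C g = Cod C f \<Longrightarrow> (g \<cdot> f) \<otimes>\<^sub>m \<one> X = (g \<otimes>\<^sub>m \<one> X) \<cdot> (f \<otimes>\<^sub>m \<one> X)"
  by (simp add: merge)

text \<open>Kelly's argument: with one more unit in front, both sides are compared through the
  pentagon and two triangles.\<close>

lemma lunit_tensor: "tlunit T (X \<otimes> Y) \<cdot> tassoc T (tunit T) X Y = tlunit T X \<otimes>\<^sub>m \<one> Y"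
proof (rule lunit_faithful)
  let ?I = "tunit T"
  have nat: "(trunit T ?I \<otimes>\<^sub>m \<one> (X \<otimes> Y)) \<cdot> tassoc T (?I \<otimes> ?I) X Y = tassoc T ?I X Y \<cdot> (trunit T ?I \<otimes>\<^sub>m \<one> X \<otimes>\<^sub>m \<one> Y)"
    using nat_a[of "trunit T ?I" ?I "\<one> X" X "\<one> Y" Y] by simp
  \<comment> \<open>These two associators form one side of the pentagon. They are invertible, so the
    equation may be tested after composing with them.\<close>
  have iso: "f = g" if "f \<cdot> (tassoc T ?I (?I \<otimes> X) Y \<cdot> (tassoc T ?I ?I X \<otimes>\<^sub>m \<one> Y)) = g \<cdot> (tassoc T ?I (?I \<otimes> X) Y \<cdot> (tassoc T ?I ?I X \<otimes>\<^sub>m \<one> Y))"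
    "Dom C f = ?I \<otimes> (?I \<otimes> X \<otimes> Y)" "Dom C g = ?I \<otimes> (?I \<otimes> X \<otimes> Y)" for f g
  proof -
    let ?b = "(inv (tassoc T ?I ?I X) \<otimes>\<^sub>m \<one> Y) \<cdot> inv (tassoc T ?I (?I \<otimes> X) Y)"
    have "f \<cdot> (tassoc T ?I (?I \<otimes> X) Y \<cdot> (tassoc T ?I ?I X \<otimes>\<^sub>m \<one> Y)) \<cdot> ?b = g \<cdot> (tassoc T ?I (?I \<otimes> X) Y \<cdot> (tassoc T ?I ?I X \<otimes>\<^sub>m \<one> Y)) \<cdot> ?b"
      unfolding that(1) ..
    then show ?thesis using that(2,3) by (simp add: comp_assoc merges)
  qed
  show "\<one> ?I \<otimes>\<^sub>m (tlunit T (X \<otimes> Y) \<cdot> tassoc T ?I X Y) = \<one> ?I \<otimes>\<^sub>m (tlunit T X \<otimes>\<^sub>m \<one> Y)"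
  proof (rule iso)
    have "(\<one> ?I \<otimes>\<^sub>m (tlunit T (X \<otimes> Y) \<cdot> tassoc T ?I X Y)) \<cdot> (tassoc T ?I (?I \<otimes> X) Y \<cdot> (tassoc T ?I ?I X \<otimes>\<^sub>m \<one> Y))
       = (\<one> ?I \<otimes>\<^sub>m tlunit T (X \<otimes> Y)) \<cdot> (tassoc T ?I ?I (X \<otimes> Y) \<cdot> tassoc T (?I \<otimes> ?I) X Y)"
      by (simp add: pentagon comp_assoc split_l)
    also have "\<dots> = tassoc T ?I X Y \<cdot> (((\<one> ?I \<otimes>\<^sub>m tlunit T X) \<cdot> tassoc T ?I ?I X) \<otimes>\<^sub>m \<one> Y)"
      by (simp add: triangle_comp triangle nat)
    also have "\<dots> = (\<one> ?I \<otimes>\<^sub>m (tlunit T X \<otimes>\<^sub>m \<one> Y)) \<cdot> (tassoc T ?I (?I \<otimes> X) Y \<cdot> (tassoc T ?I ?I X \<otimes>\<^sub>m \<one> Y))"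
      by (simp add: split_r nats)
    finally show "(\<one> ?I \<otimes>\<^sub>m (tlunit T (X \<otimes> Y) \<cdot> tassoc T ?I X Y)) \<cdot> (tassoc T ?I (?I \<otimes> X) Y \<cdot> (tassoc T ?I ?I X \<otimes>\<^sub>m \<one> Y))
       = (\<one> ?I \<otimes>\<^sub>m (tlunit T X \<otimes>\<^sub>m \<one> Y)) \<cdot> (tassoc T ?I (?I \<otimes> X) Y \<cdot> (tassoc T ?I ?I X \<otimes>\<^sub>m \<one> Y))" .
  qed simp_all
qed simp_all

lemma runit_tensor: "(\<one> X \<otimes>\<^sub>m trunit T Y) \<cdot> tassoc T X Y (tunit T) = trunit T (X \<otimes> Y)"
proof (rule runit_faithful)
  let ?I = "tunit T"
  have nat: "(\<one> X \<otimes>\<^sub>m (\<one> Y \<otimes>\<^sub>m tlunit T ?I)) \<cdot> (tassoc T X Y (?I \<otimes> ?I) \<cdot> f) = tassoc T X Y ?I \<cdot> ((\<one> (X \<otimes> Y) \<otimes>\<^sub>m tlunit T ?I) \<cdot> f)"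
    if "Cod C f = X \<otimes> Y \<otimes> (?I \<otimes> ?I)" for f
    using nat_a'[of "\<one> X" X "\<one> Y" Y "tlunit T ?I" ?I f] that by simp
  have "tassoc T X Y ?I \<cdot> (((\<one> X \<otimes>\<^sub>m trunit T Y) \<cdot> tassoc T X Y ?I) \<otimes>\<^sub>m \<one> ?I)
    = (\<one> X \<otimes>\<^sub>m (trunit T Y \<otimes>\<^sub>m \<one> ?I)) \<cdot> (tassoc T X (Y \<otimes> ?I) ?I \<cdot> (tassoc T X Y ?I \<otimes>\<^sub>m \<one> ?I))"
    by (simp add: split_r nats)
  also have "\<dots> = (\<one> X \<otimes>\<^sub>m (\<one> Y \<otimes>\<^sub>m tlunit T ?I)) \<cdot> ((\<one> X \<otimes>\<^sub>m tassoc T Y ?I ?I) \<cdot> (tassoc T X (Y \<otimes> ?I) ?I \<cdot> (tassoc T X Y ?I \<otimes>\<^sub>m \<one> ?I)))"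
    by (simp add: merges triangle)
  also have "\<dots> = (\<one> X \<otimes>\<^sub>m (\<one> Y \<otimes>\<^sub>m tlunit T ?I)) \<cdot> (tassoc T X Y (?I \<otimes> ?I) \<cdot> tassoc T (X \<otimes> Y) ?I ?I)"
    by (simp add: pentagon comp_assoc)
  also have "\<dots> = tassoc T X Y ?I \<cdot> (trunit T (X \<otimes> Y) \<otimes>\<^sub>m \<one> ?I)"
    by (simp add: nat triangle)
  finally show "((\<one> X \<otimes>\<^sub>m trunit T Y) \<cdot> tassoc T X Y ?I) \<otimes>\<^sub>m \<one> ?I = trunit T (X \<otimes> Y) \<otimes>\<^sub>m \<one> ?I"
    by (rule iso_cancel_left[OF assoc_iso, rotated 2]) simp_all
qed simp_all

text \<open>Cancelling \<open>l\<close> in its own naturality square gives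
  \<open>1 \<otimes> l\<close> as its value at the tensor square of the unit. Then
  \<open>lunit_tensor\<close> and the triangle have equal left-hand sides.\<close>

lemma lunit_runit_unit: "tlunit T (tunit T) = trunit T (tunit T)"
proof (rule runit_faithful)
  let ?I = "tunit T"
  have "tlunit T (?I \<otimes> ?I) = \<one> ?I \<otimes>\<^sub>m tlunit T ?I"
    by (rule iso_cancel_left[OF lunit_iso[of ?I]]) (simp_all add: nat_l)
  then show "tlunit T ?I \<otimes>\<^sub>m \<one> ?I = trunit T ?I \<otimes>\<^sub>m \<one> ?I"
    using lunit_tensor[of ?I ?I] triangle[of ?I ?I] by simp
qed simp_all

lemma lunit_tensor_inv: "tassoc T (tunit T) X Y \<cdot> (inv (tlunit T X) \<otimes>\<^sub>m \<one> Y) = inv (tlunit T (X \<otimes> Y))"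
  by (rule iso_cancel_left[OF lunit_iso[of "X \<otimes> Y"]]) (simp_all add: comp_reduce[OF lunit_tensor] merges)

lemma lunit_tensor': "(tlunit T X \<otimes>\<^sub>m \<one> Y) \<cdot> inv (tassoc T (tunit T) X Y) = tlunit T (X \<otimes> Y)"
  by (rule iso_cancel_right[OF assoc_iso[of "tunit T" X Y]]) (simp_all add: lunit_tensor comp_assoc)

lemma triangle': "(trunit T X \<otimes>\<^sub>m \<one> Y) \<cdot> inv (tassoc T X (tunit T) Y) = \<one> X \<otimes>\<^sub>m tlunit T Y"
  by (rule iso_cancel_right[OF assoc_iso[of X "tunit T" Y]]) (simp_all add: triangle comp_assoc)

lemma triangle_inv: "tassoc T X (tunit T) Y \<cdot> (inv (trunit T X) \<otimes>\<^sub>m \<one> Y) = \<one> X \<otimes>\<^sub>m inv (tlunit T Y)"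
proof -
  have "tassoc T X (tunit T) Y \<cdot> (inv (trunit T X) \<otimes>\<^sub>m \<one> Y)
    = (\<one> X \<otimes>\<^sub>m inv (tlunit T Y)) \<cdot> ((\<one> X \<otimes>\<^sub>m tlunit T Y) \<cdot> (tassoc T X (tunit T) Y \<cdot> (inv (trunit T X) \<otimes>\<^sub>m \<one> Y)))"
    by (simp add: merges)
  also have "\<dots> = \<one> X \<otimes>\<^sub>m inv (tlunit T Y)"
    by (simp add: triangle_comp merges)
  finally show ?thesis .
qed

lemma triangle_inv': "inv (tassoc T X (tunit T) Y) \<cdot> (\<one> X \<otimes>\<^sub>m inv (tlunit T Y)) = inv (trunit T X) \<otimes>\<^sub>m \<one> Y"
  by (rule iso_cancel_left[OF assoc_iso[of X "tunit T" Y]]) (simp_all add: triangle_inv)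

lemma runit_tensor': "trunit T (X \<otimes> Y) \<cdot> inv (tassoc T X Y (tunit T)) = \<one> X \<otimes>\<^sub>m trunit T Y"
  by (rule iso_cancel_right[OF assoc_iso[of X Y "tunit T"]]) (simp_all add: runit_tensor comp_assoc)

lemma runit_tensor_inv: "inv (tassoc T X Y (tunit T)) \<cdot> (\<one> X \<otimes>\<^sub>m inv (trunit T Y)) = inv (trunit T (X \<otimes> Y))"
  by (rule iso_cancel_left[OF runit_iso[of "X \<otimes> Y"]]) (simp_all add: comp_reduce[OF runit_tensor'] merges)

end

section \<open>Duoidal categories with reversion\<close>

context duoidal_category
begin

lemma unit_object_simps [simp]:
  "Dom C \<Delta>\<^sub>I = \<I>" "Cod C \<Delta>\<^sub>I = \<I> \<bullet> \<I>" "Dom C m\<^sub>J = \<J> \<odot> \<J>" "Cod C m\<^sub>J = \<J>" "Dom C \<epsilon>\<^sub>I = \<I>" "Cod C \<epsilon>\<^sub>I = \<J>"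
  using I_comonoid J_monoid by (simp_all add: comonoid_in_def monoid_in_def hom_def)

lemma mJ_epsI: "m\<^sub>J \<cdot> (\<epsilon>\<^sub>I \<odot>\<^sub>m \<one> \<J>) = l\<^sub>\<odot> \<J>"
  using J_monoid by (simp add: monoid_in_def)

lemma I_coassoc: "a\<^sub>\<bullet> \<I> \<I> \<I> \<cdot> ((\<Delta>\<^sub>I \<bullet>\<^sub>m \<one> \<I>) \<cdot> \<Delta>\<^sub>I) = (\<one> \<I> \<bullet>\<^sub>m \<Delta>\<^sub>I) \<cdot> \<Delta>\<^sub>I"
  using I_comonoid by (simp add: comonoid_in_def comp_assoc)

lemma I_lcounit: "l\<^sub>\<bullet> \<I> \<cdot> ((\<epsilon>\<^sub>I \<bullet>\<^sub>m \<one> \<I>) \<cdot> \<Delta>\<^sub>I) = \<one> \<I>"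
  using I_comonoid by (simp add: comonoid_in_def comp_assoc)

lemma I_rcounit: "r\<^sub>\<bullet> \<I> \<cdot> ((\<one> \<I> \<bullet>\<^sub>m \<epsilon>\<^sub>I) \<cdot> \<Delta>\<^sub>I) = \<one> \<I>"
  using I_comonoid by (simp add: comonoid_in_def comp_assoc)

lemma nat_zeta: "Cod C x = X \<Longrightarrow> Cod C y = Y \<Longrightarrow> Cod C z = Z \<Longrightarrow> Cod C t = U \<Longrightarrow>
    \<zeta> X Y Z U \<cdot> ((x \<bullet>\<^sub>m y) \<odot>\<^sub>m (z \<bullet>\<^sub>m t))
      = ((x \<odot>\<^sub>m z) \<bullet>\<^sub>m (y \<odot>\<^sub>m t)) \<cdot> \<zeta> (Dom C x) (Dom C y) (Dom C z) (Dom C t)"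
  using zeta_natural by blast

lemma nat_zeta': "Cod C x = X \<Longrightarrow> Cod C y = Y \<Longrightarrow> Cod C z = Z \<Longrightarrow> Cod C t = U \<Longrightarrow>
    Cod C f = (Dom C x \<bullet> Dom C y) \<odot> (Dom C z \<bullet> Dom C t) \<Longrightarrow>
    \<zeta> X Y Z U \<cdot> (((x \<bullet>\<^sub>m y) \<odot>\<^sub>m (z \<bullet>\<^sub>m t)) \<cdot> f)
      = ((x \<odot>\<^sub>m z) \<bullet>\<^sub>m (y \<odot>\<^sub>m t)) \<cdot> (\<zeta> (Dom C x) (Dom C y) (Dom C z) (Dom C t) \<cdot> f)"
  by (simp add: comp_reduce[OF nat_zeta] comp_assoc)

text \<open>The unit axiom of \<open>\<zeta>\<close> solved for the inverse constraints, since the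
  later calculations insert units instead of removing them.\<close>

lemma zeta_lunit_inv: "\<zeta> \<I> \<I> X Y \<cdot> ((\<Delta>\<^sub>I \<odot>\<^sub>m \<one> (X \<bullet> Y)) \<cdot> inv (l\<^sub>\<odot> (X \<bullet> Y))) = inv (l\<^sub>\<odot> X) \<bullet>\<^sub>m inv (l\<^sub>\<odot> Y)"
proof -
  have "\<zeta> \<I> \<I> X Y \<cdot> ((\<Delta>\<^sub>I \<odot>\<^sub>m \<one> (X \<bullet> Y)) \<cdot> inv (l\<^sub>\<odot> (X \<bullet> Y)))
    = (inv (l\<^sub>\<odot> X) \<bullet>\<^sub>m inv (l\<^sub>\<odot> Y)) \<cdot> ((l\<^sub>\<odot> X \<bullet>\<^sub>m l\<^sub>\<odot> Y) \<cdot> \<zeta> \<I> \<I> X Y \<cdot> (\<Delta>\<^sub>I \<odot>\<^sub>m \<one> (X \<bullet> Y)) \<cdot> inv (l\<^sub>\<odot> (X \<bullet> Y)))"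
    by (simp add: comp_assoc bul.merges)
  then show ?thesis by (simp add: zeta_circ_lunit)
qed

lemma zeta_runit_inv: "\<zeta> X Y \<I> \<I> \<cdot> ((\<one> (X \<bullet> Y) \<odot>\<^sub>m \<Delta>\<^sub>I) \<cdot> inv (r\<^sub>\<odot> (X \<bullet> Y))) = inv (r\<^sub>\<odot> X) \<bullet>\<^sub>m inv (r\<^sub>\<odot> Y)"
proof -
  have "\<zeta> X Y \<I> \<I> \<cdot> ((\<one> (X \<bullet> Y) \<odot>\<^sub>m \<Delta>\<^sub>I) \<cdot> inv (r\<^sub>\<odot> (X \<bullet> Y)))
    = (inv (r\<^sub>\<odot> X) \<bullet>\<^sub>m inv (r\<^sub>\<odot> Y)) \<cdot> ((r\<^sub>\<odot> X \<bullet>\<^sub>m r\<^sub>\<odot> Y) \<cdot> \<zeta> X Y \<I> \<I> \<cdot> (\<one> (X \<bullet> Y) \<odot>\<^sub>m \<Delta>\<^sub>I) \<cdot> inv (r\<^sub>\<odot> (X \<bullet> Y)))"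
    by (simp add: comp_assoc bul.merges)
  then show ?thesis by (simp add: zeta_circ_runit)
qed

end

section \<open>The reversion transformations at unit objects, and division with an extra
  factor\<close>

context duoidal_category_with_reversion
begin

lemma rev_simps [simp]:
  "Dom C (\<phi>\<^sub>\<odot> X Y) = X\<^sup>- \<odot> Y\<^sup>-" "Cod C (\<phi>\<^sub>\<odot> X Y) = (Y \<odot> X)\<^sup>-" "Dom C \<phi>0\<^sub>\<odot> = \<I>" "Cod C \<phi>0\<^sub>\<odot> = \<I>\<^sup>-"
  using rev_circ.lax_hom[of X Y] rev_circ.lax_unit_hom by (simp_all add: rev_tensor_def hom_def)

text \<open>The unit paired with its own reversal. These are the arguments on which (R6) evaluates
  \<open>\<gamma>\<close> and (R7) evaluates \<open>\<delta>\<close>.\<close>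

definition coact_rev_r :: 'm where "coact_rev_r = (\<one> \<I> \<bullet>\<^sub>m \<phi>0\<^sub>\<odot>) \<cdot> \<Delta>\<^sub>I"
definition coact_rev_l :: 'm where "coact_rev_l = (\<phi>0\<^sub>\<odot> \<bullet>\<^sub>m \<one> \<I>) \<cdot> \<Delta>\<^sub>I"

lemma coact_rev_simps [simp]:
  "Dom C coact_rev_r = \<I>" "Cod C coact_rev_r = \<I> \<bullet> \<I>\<^sup>-" "Dom C coact_rev_l = \<I>" "Cod C coact_rev_l = \<I>\<^sup>- \<bullet> \<I>"
  by (simp_all add: coact_rev_r_def coact_rev_l_def)

lemma gamma_nat: "Cod C x = X \<Longrightarrow> Cod C y = Y \<Longrightarrow> Cod C z = Z \<Longrightarrow> Cod C t = U \<Longrightarrow>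
    \<gamma> X Y Z U \<cdot> (((x \<bullet>\<^sub>m y\<^sup>-\<^sub>m) \<odot>\<^sub>m z) \<bullet>\<^sub>m t)
      = (x \<odot>\<^sub>m (z \<bullet>\<^sub>m (y \<odot>\<^sub>m t))) \<cdot> \<gamma> (Dom C x) (Dom C y) (Dom C z) (Dom C t)"
  using gamma_natural by blast

lemma delta_nat: "Cod C x = X \<Longrightarrow> Cod C y = Y \<Longrightarrow> Cod C z = Z \<Longrightarrow> Cod C t = U \<Longrightarrow>
    \<delta> X Y Z U \<cdot> (x \<bullet>\<^sub>m (y \<odot>\<^sub>m (z\<^sup>-\<^sub>m \<bullet>\<^sub>m t)))
      = (((x \<odot>\<^sub>m z) \<bullet>\<^sub>m y) \<odot>\<^sub>m t) \<cdot> \<delta> (Dom C x) (Dom C y) (Dom C z) (Dom C t)"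
  using delta_natural by blast

lemma gamma_nat': "Cod C x = X \<Longrightarrow> Cod C y = Y \<Longrightarrow> Cod C z = Z \<Longrightarrow> Cod C t = U \<Longrightarrow>
    Cod C f = (((Dom C x \<bullet> (Dom C y)\<^sup>-) \<odot> Dom C z) \<bullet> Dom C t) \<Longrightarrow>
    \<gamma> X Y Z U \<cdot> ((((x \<bullet>\<^sub>m y\<^sup>-\<^sub>m) \<odot>\<^sub>m z) \<bullet>\<^sub>m t) \<cdot> f)
      = (x \<odot>\<^sub>m (z \<bullet>\<^sub>m (y \<odot>\<^sub>m t))) \<cdot> (\<gamma> (Dom C x) (Dom C y) (Dom C z) (Dom C t) \<cdot> f)"
  by (simp add: comp_reduce[OF gamma_nat] comp_assoc)

lemma delta_nat': "Cod C x = X \<Longrightarrow> Cod C y = Y \<Longrightarrow> Cod C z = Z \<Longrightarrow> Cod C t = U \<Longrightarrow>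
    Cod C f = Dom C x \<bullet> (Dom C y \<odot> ((Dom C z)\<^sup>- \<bullet> Dom C t)) \<Longrightarrow>
    \<delta> X Y Z U \<cdot> ((x \<bullet>\<^sub>m (y \<odot>\<^sub>m (z\<^sup>-\<^sub>m \<bullet>\<^sub>m t))) \<cdot> f)
      = (((x \<odot>\<^sub>m z) \<bullet>\<^sub>m y) \<odot>\<^sub>m t) \<cdot> (\<delta> (Dom C x) (Dom C y) (Dom C z) (Dom C t) \<cdot> f)"
  by (simp add: comp_reduce[OF delta_nat] comp_assoc)

text \<open>
  The axioms (R6) and (R7) concern the unit object only; (R1) and (R3) propagate them to arbitrary objects.
\<close>

lemma gamma_unit:
  "\<gamma> \<I> \<I> U V \<cdot> ((coact_rev_r \<odot>\<^sub>m \<one> U) \<bullet>\<^sub>m \<one> V) = (\<one> \<I> \<odot>\<^sub>m (\<one> U \<bullet>\<^sub>m inv (l\<^sub>\<odot> V))) \<cdot> (inv (l\<^sub>\<odot> (U \<bullet> V)) \<cdot> (l\<^sub>\<odot> U \<bullet>\<^sub>m \<one> V))"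
proof -
  \<comment> \<open>The two sides of (R1) with \<open>X\<close>, \<open>Y\<close>, \<open>Z\<close>,
    \<open>T\<close> all equal to the unit. \<open>?E\<close> inserts the units they expect:
    naturality turns \<open>?L\<close> into the wanted composite, while (R6) evaluates the
    \<open>\<gamma>\<close> in \<open>?R\<close>.\<close>
  let ?L = "\<gamma> \<I> \<I> (\<I> \<odot> U) (\<I> \<odot> V) \<cdot> (a\<^sub>\<odot> (\<I> \<bullet> \<I>\<^sup>-) \<I> U \<bullet>\<^sub>m \<one> (\<I> \<odot> V)) \<cdot> \<zeta> ((\<I> \<bullet> \<I>\<^sup>-) \<odot> \<I>) \<I> U V"
  let ?R = "(\<one> \<I> \<odot>\<^sub>m (\<one> (\<I> \<odot> U) \<bullet>\<^sub>m a\<^sub>\<odot> \<I> \<I> V)) \<cdot> (\<one> \<I> \<odot>\<^sub>m \<zeta> \<I> (\<I> \<odot> \<I>) U V)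
           \<cdot> a\<^sub>\<odot> \<I> (\<I> \<bullet> (\<I> \<odot> \<I>)) (U \<bullet> V) \<cdot> (\<gamma> \<I> \<I> \<I> \<I> \<odot>\<^sub>m \<one> (U \<bullet> V))"
  let ?E = "((((coact_rev_r \<odot>\<^sub>m \<one> \<I>) \<cdot> inv (l\<^sub>\<odot> \<I>)) \<bullet>\<^sub>m \<one> \<I>) \<odot>\<^sub>m \<one> (U \<bullet> V)) \<cdot> ((\<Delta>\<^sub>I \<odot>\<^sub>m \<one> (U \<bullet> V)) \<cdot> inv (l\<^sub>\<odot> (U \<bullet> V)))"
  let ?F = "\<gamma> \<I> \<I> U V \<cdot> (((coact_rev_r \<odot>\<^sub>m \<one> U) \<cdot> inv (l\<^sub>\<odot> U)) \<bullet>\<^sub>m \<one> V)"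
  let ?i = "\<one> \<I> \<bullet>\<^sub>m inv (l\<^sub>\<odot> \<I>)"
  let ?d = "(coact_rev_r \<odot>\<^sub>m \<one> \<I>) \<cdot> inv (l\<^sub>\<odot> \<I>)"
  let ?D = "?i \<cdot> \<Delta>\<^sub>I"
  let ?a = "\<one> (\<I> \<odot> U) \<bullet>\<^sub>m a\<^sub>\<odot> \<I> \<I> V"
  \<comment> \<open>(R6) with its unit constraints moved to the other side.\<close>
  have gI: "\<gamma> \<I> \<I> \<I> \<I> \<cdot> (?d \<bullet>\<^sub>m \<one> \<I>) = (\<one> \<I> \<odot>\<^sub>m ?i) \<cdot> inv (l\<^sub>\<odot> (\<I> \<bullet> \<I>))"
  proof -
    have "\<gamma> \<I> \<I> \<I> \<I> \<cdot> ((coact_rev_r \<odot>\<^sub>m \<one> \<I>) \<bullet>\<^sub>m \<one> \<I>) = (\<one> \<I> \<odot>\<^sub>m ?i) \<cdot> (inv (l\<^sub>\<odot> (\<I> \<bullet> \<I>)) \<cdot>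
       (l\<^sub>\<odot> (\<I> \<bullet> \<I>) \<cdot> (\<one> \<I> \<odot>\<^sub>m (\<one> \<I> \<bullet>\<^sub>m l\<^sub>\<odot> \<I>)) \<cdot> \<gamma> \<I> \<I> \<I> \<I> \<cdot> ((((\<one> \<I> \<bullet>\<^sub>m \<phi>0\<^sub>\<odot>) \<cdot> \<Delta>\<^sub>I) \<odot>\<^sub>m \<one> \<I>) \<bullet>\<^sub>m \<one> \<I>)))"
      by (simp add: coact_rev_r_def comp_assoc circ.merges bul.merges)
    also have "\<dots> = (\<one> \<I> \<odot>\<^sub>m ?i) \<cdot> (inv (l\<^sub>\<odot> (\<I> \<bullet> \<I>)) \<cdot> (l\<^sub>\<odot> \<I> \<bullet>\<^sub>m \<one> \<I>))"
      unfolding R6 ..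
    finally have "\<gamma> \<I> \<I> \<I> \<I> \<cdot> ((coact_rev_r \<odot>\<^sub>m \<one> \<I>) \<bullet>\<^sub>m \<one> \<I>) \<cdot> (inv (l\<^sub>\<odot> \<I>) \<bullet>\<^sub>m \<one> \<I>) = \<dots> \<cdot> (inv (l\<^sub>\<odot> \<I>) \<bullet>\<^sub>m \<one> \<I>)"
      by simp
    then show ?thesis by (simp add: comp_assoc bul.merges)
  qed
  \<comment> \<open>By naturality, a second unit may be inserted outside or inside the first with
    the same result.\<close>
  have aux: "(coact_rev_r \<odot>\<^sub>m \<one> (\<I> \<odot> U)) \<cdot> (inv (l\<^sub>\<odot> (\<I> \<odot> U)) \<cdot> inv (l\<^sub>\<odot> U)) = (coact_rev_r \<odot>\<^sub>m inv (l\<^sub>\<odot> U)) \<cdot> inv (l\<^sub>\<odot> U)"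
  proof -
    have "(coact_rev_r \<odot>\<^sub>m \<one> (\<I> \<odot> U)) \<cdot> ((\<one> \<I> \<odot>\<^sub>m inv (l\<^sub>\<odot> U)) \<cdot> inv (l\<^sub>\<odot> U)) = (coact_rev_r \<odot>\<^sub>m inv (l\<^sub>\<odot> U)) \<cdot> inv (l\<^sub>\<odot> U)"
      by (simp add: circ.merges)
    then show ?thesis by (simp add: circ.nats)
  qed
  have "?L \<cdot> ?E = (\<gamma> \<I> \<I> (\<I> \<odot> U) (\<I> \<odot> V) \<cdot> ((a\<^sub>\<odot> (\<I> \<bullet> \<I>\<^sup>-) \<I> U \<cdot> (?d \<odot>\<^sub>m \<one> U)) \<bullet>\<^sub>m \<one> (\<I> \<odot> V))) \<cdot> (inv (l\<^sub>\<odot> U) \<bullet>\<^sub>m inv (l\<^sub>\<odot> V))"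
    using nat_zeta'[of "(coact_rev_r \<odot>\<^sub>m \<one> \<I>) \<cdot> inv (l\<^sub>\<odot> \<I>)" "(\<I> \<bullet> \<I>\<^sup>-) \<odot> \<I>" "\<one> \<I>" \<I> "\<one> U" U "\<one> V" V "(\<Delta>\<^sub>I \<odot>\<^sub>m \<one> (U \<bullet> V)) \<cdot> inv (l\<^sub>\<odot> (U \<bullet> V))"]
    by (simp add: comp_assoc zeta_lunit_inv bul.merges)
  also have "a\<^sub>\<odot> (\<I> \<bullet> \<I>\<^sup>-) \<I> U \<cdot> (?d \<odot>\<^sub>m \<one> U) = (coact_rev_r \<odot>\<^sub>m \<one> (\<I> \<odot> U)) \<cdot> inv (l\<^sub>\<odot> (\<I> \<odot> U))"
    by (simp add: circ.split_r circ.nats circ.lunit_tensor_inv)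
  also have "(\<gamma> \<I> \<I> (\<I> \<odot> U) (\<I> \<odot> V) \<cdot> (((coact_rev_r \<odot>\<^sub>m \<one> (\<I> \<odot> U)) \<cdot> inv (l\<^sub>\<odot> (\<I> \<odot> U))) \<bullet>\<^sub>m \<one> (\<I> \<odot> V))) \<cdot> (inv (l\<^sub>\<odot> U) \<bullet>\<^sub>m inv (l\<^sub>\<odot> V))
     = \<gamma> \<I> \<I> (\<I> \<odot> U) (\<I> \<odot> V) \<cdot> (((\<one> (\<I> \<bullet> \<I>\<^sup>-) \<odot>\<^sub>m inv (l\<^sub>\<odot> U)) \<bullet>\<^sub>m inv (l\<^sub>\<odot> V)) \<cdot> (((coact_rev_r \<odot>\<^sub>m \<one> U) \<cdot> inv (l\<^sub>\<odot> U)) \<bullet>\<^sub>m \<one> V))"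
    by (simp add: comp_assoc bul.merges circ.merges aux)
  also have "\<dots> = (\<one> \<I> \<odot>\<^sub>m (inv (l\<^sub>\<odot> U) \<bullet>\<^sub>m (\<one> \<I> \<odot>\<^sub>m inv (l\<^sub>\<odot> V)))) \<cdot> ?F"
    using gamma_nat'[of "\<one> \<I>" \<I> "\<one> \<I>" \<I> "inv (l\<^sub>\<odot> U)" "\<I> \<odot> U" "inv (l\<^sub>\<odot> V)" "\<I> \<odot> V" "((coact_rev_r \<odot>\<^sub>m \<one> U) \<cdot> inv (l\<^sub>\<odot> U)) \<bullet>\<^sub>m \<one> V"]
    by simp
  finally have L: "?L \<cdot> ?E = \<dots>" .
  have "?R \<cdot> ?E = (\<one> \<I> \<odot>\<^sub>m ?a) \<cdot> ((\<one> \<I> \<odot>\<^sub>m \<zeta> \<I> (\<I> \<odot> \<I>) U V) \<cdot> (a\<^sub>\<odot> \<I> (\<I> \<bullet> (\<I> \<odot> \<I>)) (U \<bullet> V)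
      \<cdot> ((((\<one> \<I> \<odot>\<^sub>m ?i) \<cdot> inv (l\<^sub>\<odot> (\<I> \<bullet> \<I>)) \<cdot> \<Delta>\<^sub>I) \<odot>\<^sub>m \<one> (U \<bullet> V)) \<cdot> inv (l\<^sub>\<odot> (U \<bullet> V)))))"
    by (simp add: comp_assoc circ.merges flip: gI)
  also have "(\<one> \<I> \<odot>\<^sub>m ?i) \<cdot> inv (l\<^sub>\<odot> (\<I> \<bullet> \<I>)) \<cdot> \<Delta>\<^sub>I = (\<one> \<I> \<odot>\<^sub>m ?D) \<cdot> inv (l\<^sub>\<odot> \<I>)"
    by (simp add: circ.nats comp_assoc)
  also have "a\<^sub>\<odot> \<I> (\<I> \<bullet> (\<I> \<odot> \<I>)) (U \<bullet> V) \<cdot> ((\<dots> \<odot>\<^sub>m \<one> (U \<bullet> V)) \<cdot> inv (l\<^sub>\<odot> (U \<bullet> V)))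
      = (\<one> \<I> \<odot>\<^sub>m (?D \<odot>\<^sub>m \<one> (U \<bullet> V))) \<cdot> (inv (l\<^sub>\<odot> (\<I> \<odot> (U \<bullet> V))) \<cdot> inv (l\<^sub>\<odot> (U \<bullet> V)))"
    using circ.nat_a'[of "\<one> \<I>" \<I> "?i \<cdot> \<Delta>\<^sub>I" "\<I> \<bullet> (\<I> \<odot> \<I>)" "\<one> (U \<bullet> V)" "U \<bullet> V" "(inv (l\<^sub>\<odot> \<I>) \<odot>\<^sub>m \<one> (U \<bullet> V)) \<cdot> inv (l\<^sub>\<odot> (U \<bullet> V))"]
    by (simp add: comp_assoc circ.split_r comp_reduce[OF circ.lunit_tensor_inv])
  also have "(\<one> \<I> \<odot>\<^sub>m ?a) \<cdot> ((\<one> \<I> \<odot>\<^sub>m \<zeta> \<I> (\<I> \<odot> \<I>) U V) \<cdot> \<dots>)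
      = inv (l\<^sub>\<odot> ((\<I> \<odot> U) \<bullet> (\<I> \<odot> (\<I> \<odot> V)))) \<cdot> (?a \<cdot> (\<zeta> \<I> (\<I> \<odot> \<I>) U V \<cdot> 
        ((?i \<odot>\<^sub>m \<one> (U \<bullet> V)) \<cdot> ((\<Delta>\<^sub>I \<odot>\<^sub>m \<one> (U \<bullet> V)) \<cdot> inv (l\<^sub>\<odot> (U \<bullet> V))))))"
    by (simp add: comp_assoc circ.nats circ.split_r)
  also have "\<dots> = inv (l\<^sub>\<odot> ((\<I> \<odot> U) \<bullet> (\<I> \<odot> (\<I> \<odot> V)))) \<cdot> ((inv (l\<^sub>\<odot> U) \<bullet>\<^sub>m inv (l\<^sub>\<odot> (\<I> \<odot> V))) \<cdot> (\<one> U \<bullet>\<^sub>m inv (l\<^sub>\<odot> V)))"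
    using nat_zeta'[of "\<one> \<I>" \<I> "inv (l\<^sub>\<odot> \<I>)" "\<I> \<odot> \<I>" "\<one> U" U "\<one> V" V "(\<Delta>\<^sub>I \<odot>\<^sub>m \<one> (U \<bullet> V)) \<cdot> inv (l\<^sub>\<odot> (U \<bullet> V))"]
    by (simp add: comp_assoc zeta_lunit_inv bul.merges circ.lunit_tensor_inv comp_reduce[OF circ.lunit_tensor_inv])
  finally have R: "?R \<cdot> ?E = \<dots>" .
  have "\<gamma> \<I> \<I> U V \<cdot> ((coact_rev_r \<odot>\<^sub>m \<one> U) \<bullet>\<^sub>m \<one> V) = (\<one> \<I> \<odot>\<^sub>m (l\<^sub>\<odot> U \<bullet>\<^sub>m (\<one> \<I> \<odot>\<^sub>m l\<^sub>\<odot> V))) \<cdot> (?L \<cdot> ?E) \<cdot> (l\<^sub>\<odot> U \<bullet>\<^sub>m \<one> V)"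
    unfolding L by (simp add: comp_assoc bul.merges circ.merges)
  also have "\<dots> = (\<one> \<I> \<odot>\<^sub>m (\<one> U \<bullet>\<^sub>m inv (l\<^sub>\<odot> V))) \<cdot> (inv (l\<^sub>\<odot> (U \<bullet> V)) \<cdot> (l\<^sub>\<odot> U \<bullet>\<^sub>m \<one> V))"
    unfolding R1 R by (simp add: comp_assoc circ.nats bul.merges)
  finally show ?thesis .
qed

lemma delta_unit:
  "\<delta> X Y \<I> \<I> \<cdot> (\<one> X \<bullet>\<^sub>m (\<one> Y \<odot>\<^sub>m coact_rev_l)) = ((inv (r\<^sub>\<odot> X) \<bullet>\<^sub>m \<one> Y) \<odot>\<^sub>m \<one> \<I>) \<cdot> (inv (r\<^sub>\<odot> (X \<bullet> Y)) \<cdot> (\<one> X \<bullet>\<^sub>m r\<^sub>\<odot> Y))"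
proof -
  let ?L = "((a\<^sub>\<odot> X \<I> \<I> \<bullet>\<^sub>m \<one> (Y \<odot> \<I>)) \<odot>\<^sub>m \<one> \<I>) \<cdot> \<delta> (X \<odot> \<I>) (Y \<odot> \<I>) \<I> \<I>
           \<cdot> (\<one> (X \<odot> \<I>) \<bullet>\<^sub>m inv (a\<^sub>\<odot> Y \<I> (\<I>\<^sup>- \<bullet> \<I>))) \<cdot> \<zeta> X Y \<I> (\<I> \<odot> (\<I>\<^sup>- \<bullet> \<I>))"
  let ?R = "(\<zeta> X Y (\<I> \<odot> \<I>) \<I> \<odot>\<^sub>m \<one> \<I>) \<cdot> inv (a\<^sub>\<odot> (X \<bullet> Y) ((\<I> \<odot> \<I>) \<bullet> \<I>) \<I>) \<cdot> (\<one> (X \<bullet> Y) \<odot>\<^sub>m \<delta> \<I> \<I> \<I> \<I>)"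
  let ?E = "(\<one> (X \<bullet> Y) \<odot>\<^sub>m (\<one> \<I> \<bullet>\<^sub>m ((\<one> \<I> \<odot>\<^sub>m coact_rev_l) \<cdot> inv (r\<^sub>\<odot> \<I>)))) \<cdot> ((\<one> (X \<bullet> Y) \<odot>\<^sub>m \<Delta>\<^sub>I) \<cdot> inv (r\<^sub>\<odot> (X \<bullet> Y)))"
  let ?F = "\<delta> X Y \<I> \<I> \<cdot> (\<one> X \<bullet>\<^sub>m ((\<one> Y \<odot>\<^sub>m coact_rev_l) \<cdot> inv (r\<^sub>\<odot> Y)))"
  let ?i = "inv (r\<^sub>\<odot> \<I>) \<bullet>\<^sub>m \<one> \<I>"
  let ?d = "(\<one> \<I> \<odot>\<^sub>m coact_rev_l) \<cdot> inv (r\<^sub>\<odot> \<I>)"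
  let ?D = "?i \<cdot> \<Delta>\<^sub>I"
  let ?a = "a\<^sub>\<odot> X \<I> \<I> \<bullet>\<^sub>m \<one> (Y \<odot> \<I>)"
  have dI: "\<delta> \<I> \<I> \<I> \<I> \<cdot> (\<one> \<I> \<bullet>\<^sub>m ?d) = (?i \<odot>\<^sub>m \<one> \<I>) \<cdot> inv (r\<^sub>\<odot> (\<I> \<bullet> \<I>))"
  proof -
    have "\<delta> \<I> \<I> \<I> \<I> \<cdot> (\<one> \<I> \<bullet>\<^sub>m (\<one> \<I> \<odot>\<^sub>m coact_rev_l)) = (?i \<odot>\<^sub>m \<one> \<I>) \<cdot> (inv (r\<^sub>\<odot> (\<I> \<bullet> \<I>)) \<cdot>
       (r\<^sub>\<odot> (\<I> \<bullet> \<I>) \<cdot> ((r\<^sub>\<odot> \<I> \<bullet>\<^sub>m \<one> \<I>) \<odot>\<^sub>m \<one> \<I>) \<cdot> \<delta> \<I> \<I> \<I> \<I> \<cdot> (\<one> \<I> \<bullet>\<^sub>m (\<one> \<I> \<odot>\<^sub>m ((\<phi>0\<^sub>\<odot> \<bullet>\<^sub>m \<one> \<I>) \<cdot> \<Delta>\<^sub>I)))))"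
      by (simp add: coact_rev_l_def comp_assoc circ.merges bul.merges)
    also have "\<dots> = (?i \<odot>\<^sub>m \<one> \<I>) \<cdot> (inv (r\<^sub>\<odot> (\<I> \<bullet> \<I>)) \<cdot> (\<one> \<I> \<bullet>\<^sub>m r\<^sub>\<odot> \<I>))"
      unfolding R7 ..
    finally have "\<delta> \<I> \<I> \<I> \<I> \<cdot> (\<one> \<I> \<bullet>\<^sub>m (\<one> \<I> \<odot>\<^sub>m coact_rev_l)) \<cdot> (\<one> \<I> \<bullet>\<^sub>m inv (r\<^sub>\<odot> \<I>)) = \<dots> \<cdot> (\<one> \<I> \<bullet>\<^sub>m inv (r\<^sub>\<odot> \<I>))"
      by simp
    then show ?thesis by (simp add: comp_assoc bul.merges)
  qed
  have aux: "(\<one> (Y \<odot> \<I>) \<odot>\<^sub>m coact_rev_l) \<cdot> (inv (r\<^sub>\<odot> (Y \<odot> \<I>)) \<cdot> inv (r\<^sub>\<odot> Y)) = (inv (r\<^sub>\<odot> Y) \<odot>\<^sub>m coact_rev_l) \<cdot> inv (r\<^sub>\<odot> Y)"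
  proof -
    have "(\<one> (Y \<odot> \<I>) \<odot>\<^sub>m coact_rev_l) \<cdot> ((inv (r\<^sub>\<odot> Y) \<odot>\<^sub>m \<one> \<I>) \<cdot> inv (r\<^sub>\<odot> Y)) = (inv (r\<^sub>\<odot> Y) \<odot>\<^sub>m coact_rev_l) \<cdot> inv (r\<^sub>\<odot> Y)"
      by (simp add: circ.merges)
    then show ?thesis by (simp add: circ.nats)
  qed
  have "?L \<cdot> ?E = (?a \<odot>\<^sub>m \<one> \<I>) \<cdot> (\<delta> (X \<odot> \<I>) (Y \<odot> \<I>) \<I> \<I>
      \<cdot> ((\<one> (X \<odot> \<I>) \<bullet>\<^sub>m (inv (a\<^sub>\<odot> Y \<I> (\<I>\<^sup>- \<bullet> \<I>)) \<cdot> (\<one> Y \<odot>\<^sub>m ?d))) \<cdot> (inv (r\<^sub>\<odot> X) \<bullet>\<^sub>m inv (r\<^sub>\<odot> Y))))"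
    using nat_zeta'[of "\<one> X" X "\<one> Y" Y "\<one> \<I>" \<I> "(\<one> \<I> \<odot>\<^sub>m coact_rev_l) \<cdot> inv (r\<^sub>\<odot> \<I>)" "\<I> \<odot> (\<I>\<^sup>- \<bullet> \<I>)" "(\<one> (X \<bullet> Y) \<odot>\<^sub>m \<Delta>\<^sub>I) \<cdot> inv (r\<^sub>\<odot> (X \<bullet> Y))"]
    by (simp add: comp_assoc zeta_runit_inv bul.merges)
  also have "inv (a\<^sub>\<odot> Y \<I> (\<I>\<^sup>- \<bullet> \<I>)) \<cdot> (\<one> Y \<odot>\<^sub>m ?d) = (\<one> (Y \<odot> \<I>) \<odot>\<^sub>m coact_rev_l) \<cdot> inv (r\<^sub>\<odot> (Y \<odot> \<I>))"
    by (simp add: circ.split_l circ.nats circ.runit_tensor_inv)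
  also have "(?a \<odot>\<^sub>m \<one> \<I>) \<cdot> (\<delta> (X \<odot> \<I>) (Y \<odot> \<I>) \<I> \<I>
      \<cdot> ((\<one> (X \<odot> \<I>) \<bullet>\<^sub>m ((\<one> (Y \<odot> \<I>) \<odot>\<^sub>m coact_rev_l) \<cdot> inv (r\<^sub>\<odot> (Y \<odot> \<I>)))) \<cdot> (inv (r\<^sub>\<odot> X) \<bullet>\<^sub>m inv (r\<^sub>\<odot> Y))))
    = (?a \<odot>\<^sub>m \<one> \<I>) \<cdot> (\<delta> (X \<odot> \<I>) (Y \<odot> \<I>) \<I> \<I>
      \<cdot> ((inv (r\<^sub>\<odot> X) \<bullet>\<^sub>m (inv (r\<^sub>\<odot> Y) \<odot>\<^sub>m \<one> (\<I>\<^sup>- \<bullet> \<I>))) \<cdot> (\<one> X \<bullet>\<^sub>m ((\<one> Y \<odot>\<^sub>m coact_rev_l) \<cdot> inv (r\<^sub>\<odot> Y)))))"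
    by (simp add: comp_assoc bul.merges circ.merges aux)
  \<comment> \<open>The associator and \<open>inv r\<close> contract to
    \<open>1 \<odot> inv l\<close>; the equality of \<open>l\<close> and \<open>r\<close> at the
    unit gives this the form that occurs on the other side.\<close>
  also have "\<dots> = (((\<one> X \<odot>\<^sub>m inv (r\<^sub>\<odot> \<I>)) \<bullet>\<^sub>m inv (r\<^sub>\<odot> Y)) \<odot>\<^sub>m \<one> \<I>) \<cdot> ?F"
    using delta_nat'[of "inv (r\<^sub>\<odot> X)" "X \<odot> \<I>" "inv (r\<^sub>\<odot> Y)" "Y \<odot> \<I>" "\<one> \<I>" \<I> "\<one> \<I>" \<I> "\<one> X \<bullet>\<^sub>m ((\<one> Y \<odot>\<^sub>m coact_rev_l) \<cdot> inv (r\<^sub>\<odot> Y))"]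
    by (simp add: comp_assoc circ.merges bul.merges circ.triangle_inv circ.lunit_runit_unit)
  finally have L: "?L \<cdot> ?E = \<dots>" .
  have "?R \<cdot> ?E = (\<zeta> X Y (\<I> \<odot> \<I>) \<I> \<odot>\<^sub>m \<one> \<I>) \<cdot> (inv (a\<^sub>\<odot> (X \<bullet> Y) ((\<I> \<odot> \<I>) \<bullet> \<I>) \<I>)
      \<cdot> ((\<one> (X \<bullet> Y) \<odot>\<^sub>m ((?i \<odot>\<^sub>m \<one> \<I>) \<cdot> inv (r\<^sub>\<odot> (\<I> \<bullet> \<I>)) \<cdot> \<Delta>\<^sub>I)) \<cdot> inv (r\<^sub>\<odot> (X \<bullet> Y))))"
    by (simp add: comp_assoc circ.merges flip: dI)
  also have "(?i \<odot>\<^sub>m \<one> \<I>) \<cdot> inv (r\<^sub>\<odot> (\<I> \<bullet> \<I>)) \<cdot> \<Delta>\<^sub>I = (?D \<odot>\<^sub>m \<one> \<I>) \<cdot> inv (r\<^sub>\<odot> \<I>)"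
    by (simp add: circ.nats comp_assoc)
  also have "inv (a\<^sub>\<odot> (X \<bullet> Y) ((\<I> \<odot> \<I>) \<bullet> \<I>) \<I>) \<cdot> ((\<one> (X \<bullet> Y) \<odot>\<^sub>m \<dots>) \<cdot> inv (r\<^sub>\<odot> (X \<bullet> Y)))
      = ((\<one> (X \<bullet> Y) \<odot>\<^sub>m ?D) \<odot>\<^sub>m \<one> \<I>) \<cdot> (inv (r\<^sub>\<odot> ((X \<bullet> Y) \<odot> \<I>)) \<cdot> inv (r\<^sub>\<odot> (X \<bullet> Y)))"
    using circ.nat_ai'[of "\<one> (X \<bullet> Y)" "X \<bullet> Y" "?i \<cdot> \<Delta>\<^sub>I" "(\<I> \<odot> \<I>) \<bullet> \<I>" "\<one> \<I>" \<I> "(\<one> (X \<bullet> Y) \<odot>\<^sub>m inv (r\<^sub>\<odot> \<I>)) \<cdot> inv (r\<^sub>\<odot> (X \<bullet> Y))"]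
    by (simp add: comp_assoc circ.split_l comp_reduce[OF circ.runit_tensor_inv])
  also have "(\<zeta> X Y (\<I> \<odot> \<I>) \<I> \<odot>\<^sub>m \<one> \<I>) \<cdot> \<dots>
      = inv (r\<^sub>\<odot> ((X \<odot> (\<I> \<odot> \<I>)) \<bullet> (Y \<odot> \<I>))) \<cdot> (\<zeta> X Y (\<I> \<odot> \<I>) \<I> \<cdot>
        ((\<one> (X \<bullet> Y) \<odot>\<^sub>m ?i) \<cdot> ((\<one> (X \<bullet> Y) \<odot>\<^sub>m \<Delta>\<^sub>I) \<cdot> inv (r\<^sub>\<odot> (X \<bullet> Y)))))"
    by (simp add: comp_assoc circ.nats circ.split_l)
  also have "\<dots> = inv (r\<^sub>\<odot> ((X \<odot> (\<I> \<odot> \<I>)) \<bullet> (Y \<odot> \<I>))) \<cdot> (((\<one> X \<odot>\<^sub>m inv (r\<^sub>\<odot> \<I>)) \<cdot> inv (r\<^sub>\<odot> X)) \<bullet>\<^sub>m inv (r\<^sub>\<odot> Y))"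
    using nat_zeta'[of "\<one> X" X "\<one> Y" Y "inv (r\<^sub>\<odot> \<I>)" "\<I> \<odot> \<I>" "\<one> \<I>" \<I> "(\<one> (X \<bullet> Y) \<odot>\<^sub>m \<Delta>\<^sub>I) \<cdot> inv (r\<^sub>\<odot> (X \<bullet> Y))"]
    by (simp add: comp_assoc zeta_runit_inv bul.merges)
  finally have R: "?R \<cdot> ?E = \<dots>" .
  have "\<delta> X Y \<I> \<I> \<cdot> (\<one> X \<bullet>\<^sub>m (\<one> Y \<odot>\<^sub>m coact_rev_l)) = (((\<one> X \<odot>\<^sub>m r\<^sub>\<odot> \<I>) \<bullet>\<^sub>m r\<^sub>\<odot> Y) \<odot>\<^sub>m \<one> \<I>) \<cdot> (?L \<cdot> ?E) \<cdot> (\<one> X \<bullet>\<^sub>m r\<^sub>\<odot> Y)"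
    unfolding L by (simp add: comp_assoc bul.merges circ.merges)
  also have "\<dots> = ((inv (r\<^sub>\<odot> X) \<bullet>\<^sub>m \<one> Y) \<odot>\<^sub>m \<one> \<I>) \<cdot> (inv (r\<^sub>\<odot> (X \<bullet> Y)) \<cdot> (\<one> X \<bullet>\<^sub>m r\<^sub>\<odot> Y))"
    unfolding R3 R by (simp add: comp_assoc circ.nats bul.merges circ.merges comp_reduce[OF circ.merge])
  finally show ?thesis .
qed

text \<open>
  \<open>varphi\<close> with the final \<open>J\<close> replaced by an arbitrary object \<open>U\<close>: in terms of arrows,
  \<open>(x, (z, u)) \<mapsto> (x z\<^sup>-\<^sup>1, u)\<close>.
\<close>

definition varphi_ext :: "'o \<Rightarrow> 'o \<Rightarrow> 'o \<Rightarrow> 'm" where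
  "varphi_ext X Z U = \<delta> X \<I> Z U \<cdot> (\<one> X \<bullet>\<^sub>m inv (l\<^sub>\<odot> (Z\<^sup>- \<bullet> U)))"

lemma varphi_ext_simps [simp]: "Dom C (varphi_ext X Z U) = X \<bullet> (Z\<^sup>- \<bullet> U)" "Cod C (varphi_ext X Z U) = ((X \<odot> Z) \<bullet> \<I>) \<odot> U"
  by (simp_all add: varphi_ext_def)

lemma varphi_eq_varphi_ext: "varphi C X Z = varphi_ext X Z \<J> \<cdot> (\<one> X \<bullet>\<^sub>m inv (r\<^sub>\<bullet> Z\<^sup>-))"
  by (simp add: varphi_def varphi_ext_def comp_assoc bul.merges circ.nats)

lemma varphi_simps [simp]: "Dom C (varphi C X Y) = X \<bullet> Y\<^sup>-" "Cod C (varphi C X Y) = ((X \<odot> Y) \<bullet> \<I>) \<odot> \<J>"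
  by (simp_all add: varphi_eq_varphi_ext)

lemma psi_simps [simp]: "Dom C (psi C X Y) = X\<^sup>- \<bullet> Y" "Cod C (psi C X Y) = \<J> \<odot> (\<I> \<bullet> (X \<odot> Y))"
  by (simp_all add: psi_def)

lemma varphi_ext_natural: "Cod C x = X \<Longrightarrow> Cod C z = Z \<Longrightarrow> Cod C u = U \<Longrightarrow>
    varphi_ext X Z U \<cdot> (x \<bullet>\<^sub>m (z\<^sup>-\<^sub>m \<bullet>\<^sub>m u)) = (((x \<odot>\<^sub>m z) \<bullet>\<^sub>m \<one> \<I>) \<odot>\<^sub>m u) \<cdot> varphi_ext (Dom C x) (Dom C z) (Dom C u)"
proof -
  assume a: "Cod C x = X" "Cod C z = Z" "Cod C u = U"
  have "varphi_ext X Z U \<cdot> (x \<bullet>\<^sub>m (z\<^sup>-\<^sub>m \<bullet>\<^sub>m u)) = \<delta> X \<I> Z U \<cdot> ((x \<bullet>\<^sub>m (\<one> \<I> \<odot>\<^sub>m (z\<^sup>-\<^sub>m \<bullet>\<^sub>m u))) \<cdot> (\<one> (Dom C x) \<bullet>\<^sub>m inv (l\<^sub>\<odot> ((Dom C z)\<^sup>- \<bullet> Dom C u))))"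
    using a by (simp add: varphi_ext_def comp_assoc bul.merges circ.nats)
  then show ?thesis
    using a by (simp add: comp_reduce[OF delta_nat] varphi_ext_def comp_assoc)
qed

text \<open>
  For an \<open>I\<close>-comodule \<open>Q\<close>, whose elements are loops, this composes a loop with an arrow that starts at its base
  point.
\<close>

definition gamma_loop :: "'m \<Rightarrow> 'o \<Rightarrow> 'm" where
  "gamma_loop c U = (\<one> (Dom C c) \<odot>\<^sub>m (l\<^sub>\<bullet> U \<cdot> (\<one> \<J> \<bullet>\<^sub>m l\<^sub>\<odot> U))) \<cdot> (\<gamma> (Dom C c) \<I> \<J> U \<cdot> ((((\<one> (Dom C c) \<bullet>\<^sub>m \<phi>0\<^sub>\<odot>) \<cdot> c) \<odot>\<^sub>m \<one> \<J>) \<bullet>\<^sub>m \<one> U))"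

lemma gamma_loop_simps [simp]: "Cod C c = Dom C c \<bullet> \<I> \<Longrightarrow> Dom C (gamma_loop c U) = (Dom C c \<odot> \<J>) \<bullet> U"
   "Cod C c = Dom C c \<bullet> \<I> \<Longrightarrow> Cod C (gamma_loop c U) = Dom C c \<odot> U"
  by (simp_all add: gamma_loop_def)

text \<open>(R5) with units for \<open>Y\<close> and \<open>Z\<close> and with \<open>J\<close> for
  \<open>U\<close>: carrying \<open>u\<close> along agrees with dividing while \<open>u\<close> is
  forgotten in \<open>J\<close> and restoring it by \<open>gamma_loop\<close>. Thus antipode
  identities, stated with \<open>J\<close>, can be used next to an arbitrary factor
  \<open>U\<close>.\<close>

lemma varphi_ext_gamma_loop:
  "varphi_ext X Z U \<cdot> a\<^sub>\<bullet> X Z\<^sup>- U = gamma_loop (inv (a\<^sub>\<bullet> (X \<odot> Z) \<I> \<I>) \<cdot> (\<one> (X \<odot> Z) \<bullet>\<^sub>m \<Delta>\<^sub>I)) U \<cdot> (varphi C X Z \<bullet>\<^sub>m \<one> U)"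
proof -
  \<comment> \<open>The two sides of (R5). \<open>?E\<close> supplies the unit, its reversal and the
    \<open>J\<close> that they expect, and \<open>?P\<close> removes what is left of them.\<close>
  let ?L = "\<delta> X \<I> Z (\<J> \<bullet> (\<I> \<odot> U)) \<cdot> (\<one> X \<bullet>\<^sub>m (\<one> \<I> \<odot>\<^sub>m a\<^sub>\<bullet> Z\<^sup>- \<J> (\<I> \<odot> U)))
           \<cdot> (\<one> X \<bullet>\<^sub>m \<gamma> \<I> \<I> (Z\<^sup>- \<bullet> \<J>) U) \<cdot> a\<^sub>\<bullet> X ((\<I> \<bullet> \<I>\<^sup>-) \<odot> (Z\<^sup>- \<bullet> \<J>)) U"
  let ?R = "\<gamma> ((X \<odot> Z) \<bullet> \<I>) \<I> \<J> U \<cdot> ((inv (a\<^sub>\<bullet> (X \<odot> Z) \<I> \<I>\<^sup>-) \<odot>\<^sub>m \<one> \<J>) \<bullet>\<^sub>m \<one> U)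
           \<cdot> (\<delta> X (\<I> \<bullet> \<I>\<^sup>-) Z \<J> \<bullet>\<^sub>m \<one> U)"
  let ?e = "inv (l\<^sub>\<odot> (Z\<^sup>- \<bullet> \<J>)) \<cdot> inv (r\<^sub>\<bullet> Z\<^sup>-)"
  let ?E = "(\<one> X \<bullet>\<^sub>m ((coact_rev_r \<odot>\<^sub>m \<one> (Z\<^sup>- \<bullet> \<J>)) \<cdot> ?e)) \<bullet>\<^sub>m \<one> U"
  let ?P = "\<one> ((X \<odot> Z) \<bullet> \<I>) \<odot>\<^sub>m (l\<^sub>\<bullet> U \<cdot> (\<one> \<J> \<bullet>\<^sub>m l\<^sub>\<odot> U))"
  let ?d = "coact_rev_r \<odot>\<^sub>m \<one> (Z\<^sup>- \<bullet> \<J>)"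
  have "?L \<cdot> ?E = \<delta> X \<I> Z (\<J> \<bullet> (\<I> \<odot> U)) \<cdot> ((\<one> X \<bullet>\<^sub>m ((\<one> \<I> \<odot>\<^sub>m a\<^sub>\<bullet> Z\<^sup>- \<J> (\<I> \<odot> U)) \<cdot>
      (\<gamma> \<I> \<I> (Z\<^sup>- \<bullet> \<J>) U \<cdot> (?d \<bullet>\<^sub>m \<one> U) \<cdot> (?e \<bullet>\<^sub>m \<one> U)))) \<cdot> a\<^sub>\<bullet> X Z\<^sup>- U)"
    using bul.nat_a[of "\<one> X" X "?d \<cdot> ?e" "(\<I> \<bullet> \<I>\<^sup>-) \<odot> (Z\<^sup>- \<bullet> \<J>)" "\<one> U" U]
    by (simp add: comp_assoc bul.merges)
  \<comment> \<open>\<open>gamma_unit\<close> eliminates \<open>\<gamma>\<close> from this side; the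
    remaining \<open>\<delta>\<close> is the one in \<open>varphi_ext\<close>.\<close>
  also have "(\<one> \<I> \<odot>\<^sub>m a\<^sub>\<bullet> Z\<^sup>- \<J> (\<I> \<odot> U)) \<cdot> (\<gamma> \<I> \<I> (Z\<^sup>- \<bullet> \<J>) U \<cdot> (?d \<bullet>\<^sub>m \<one> U) \<cdot> (?e \<bullet>\<^sub>m \<one> U))
     = inv (l\<^sub>\<odot> (Z\<^sup>- \<bullet> (\<J> \<bullet> (\<I> \<odot> U)))) \<cdot> (a\<^sub>\<bullet> Z\<^sup>- \<J> (\<I> \<odot> U) \<cdot> ((\<one> (Z\<^sup>- \<bullet> \<J>) \<bullet>\<^sub>m inv (l\<^sub>\<odot> U)) \<cdot> (inv (r\<^sub>\<bullet> Z\<^sup>-) \<bullet>\<^sub>m \<one> U)))"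
    unfolding gamma_unit by (simp add: comp_assoc bul.merges circ.nats)
  also have "a\<^sub>\<bullet> Z\<^sup>- \<J> (\<I> \<odot> U) \<cdot> ((\<one> (Z\<^sup>- \<bullet> \<J>) \<bullet>\<^sub>m inv (l\<^sub>\<odot> U)) \<cdot> (inv (r\<^sub>\<bullet> Z\<^sup>-) \<bullet>\<^sub>m \<one> U))
     = \<one> Z\<^sup>- \<bullet>\<^sub>m ((\<one> \<J> \<bullet>\<^sub>m inv (l\<^sub>\<odot> U)) \<cdot> inv (l\<^sub>\<bullet> U))"
    using bul.nat_a'[of "\<one> Z\<^sup>-" "Z\<^sup>-" "\<one> \<J>" \<J> "inv (l\<^sub>\<odot> U)" "\<I> \<odot> U" "inv (r\<^sub>\<bullet> Z\<^sup>-) \<bullet>\<^sub>m \<one> U"]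
    by (simp add: bul.triangle_inv bul.merges)
  finally have "?P \<cdot> (?L \<cdot> ?E) = ?P \<cdot> (\<delta> X \<I> Z (\<J> \<bullet> (\<I> \<odot> U)) \<cdot> ((\<one> X \<bullet>\<^sub>m (\<one> \<I> \<odot>\<^sub>m (\<one> Z\<^sup>- \<bullet>\<^sub>m ((\<one> \<J> \<bullet>\<^sub>m inv (l\<^sub>\<odot> U)) \<cdot> inv (l\<^sub>\<bullet> U)))))
      \<cdot> ((\<one> X \<bullet>\<^sub>m inv (l\<^sub>\<odot> (Z\<^sup>- \<bullet> U))) \<cdot> a\<^sub>\<bullet> X Z\<^sup>- U)))"
    by (simp add: circ.nats bul.merges)
  also have "\<dots> = varphi_ext X Z U \<cdot> a\<^sub>\<bullet> X Z\<^sup>- U"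
    using comp_reduce[OF delta_nat[of "\<one> X" X "\<one> \<I>" \<I> "\<one> Z" Z "(\<one> \<J> \<bullet>\<^sub>m inv (l\<^sub>\<odot> U)) \<cdot> inv (l\<^sub>\<bullet> U)" "\<J> \<bullet> (\<I> \<odot> U)"], of "(\<one> X \<bullet>\<^sub>m inv (l\<^sub>\<odot> (Z\<^sup>- \<bullet> U))) \<cdot> a\<^sub>\<bullet> X Z\<^sup>- U"]
    by (simp add: comp_assoc varphi_ext_def circ.merges bul.merges)
  finally have L: "?P \<cdot> (?L \<cdot> ?E) = varphi_ext X Z U \<cdot> a\<^sub>\<bullet> X Z\<^sup>- U" .
  have "?R \<cdot> ?E = \<gamma> ((X \<odot> Z) \<bullet> \<I>) \<I> \<J> U \<cdot> (((inv (a\<^sub>\<bullet> (X \<odot> Z) \<I> \<I>\<^sup>-) \<odot>\<^sub>m \<one> \<J>) \<cdot> (\<delta> X (\<I> \<bullet> \<I>\<^sup>-) Z \<J>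
     \<cdot> ((\<one> X \<bullet>\<^sub>m ?d) \<cdot> (\<one> X \<bullet>\<^sub>m ?e)))) \<bullet>\<^sub>m \<one> U)"
    by (simp add: comp_assoc bul.merges)
  also have "\<delta> X (\<I> \<bullet> \<I>\<^sup>-) Z \<J> \<cdot> ((\<one> X \<bullet>\<^sub>m ?d) \<cdot> (\<one> X \<bullet>\<^sub>m ?e))
      = ((\<one> (X \<odot> Z) \<bullet>\<^sub>m coact_rev_r) \<odot>\<^sub>m \<one> \<J>) \<cdot> varphi C X Z"
    using comp_reduce[OF delta_nat[of "\<one> X" X "coact_rev_r" "\<I> \<bullet> \<I>\<^sup>-" "\<one> Z" Z "\<one> \<J>" \<J>], of "\<one> X \<bullet>\<^sub>m ?e"]
    by (simp add: varphi_eq_varphi_ext varphi_ext_def comp_assoc bul.merges)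
  also have "(inv (a\<^sub>\<bullet> (X \<odot> Z) \<I> \<I>\<^sup>-) \<odot>\<^sub>m \<one> \<J>) \<cdot> \<dots> = (((\<one> ((X \<odot> Z) \<bullet> \<I>) \<bullet>\<^sub>m \<phi>0\<^sub>\<odot>) \<cdot> inv (a\<^sub>\<bullet> (X \<odot> Z) \<I> \<I>) \<cdot> (\<one> (X \<odot> Z) \<bullet>\<^sub>m \<Delta>\<^sub>I)) \<odot>\<^sub>m \<one> \<J>) \<cdot> varphi C X Z"
    using bul.nat_ai'[of "\<one> (X \<odot> Z)" "X \<odot> Z" "\<one> \<I>" \<I> "\<phi>0\<^sub>\<odot>" "\<I>\<^sup>-" "\<one> (X \<odot> Z) \<bullet>\<^sub>m \<Delta>\<^sub>I"]
    by (simp add: coact_rev_r_def circ.merges bul.split_l comp_assoc)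
  finally have R: "?P \<cdot> (?R \<cdot> ?E) = gamma_loop (inv (a\<^sub>\<bullet> (X \<odot> Z) \<I> \<I>) \<cdot> (\<one> (X \<odot> Z) \<bullet>\<^sub>m \<Delta>\<^sub>I)) U \<cdot> (varphi C X Z \<bullet>\<^sub>m \<one> U)"
    by (simp add: gamma_loop_def comp_assoc bul.merges)
  show ?thesis using L R R5[of X \<I> Z \<J> \<I> U] by simp
qed

end

context duoidal_category_with_reversion
begin

text \<open>The right unit law of the lax structure, solved for \<open>\<phi>\<^sub>\<odot>\<close>.
  Its source carries the reversed tensor product, whose right unit constraint is \<open>l\<close>;
  hence the reversal of \<open>l\<close> faces \<open>r\<close>.\<close>

lemma phi_circ_unit: "\<phi>\<^sub>\<odot> Y \<I> \<cdot> ((\<one> Y\<^sup>- \<odot>\<^sub>m \<phi>0\<^sub>\<odot>) \<cdot> inv (r\<^sub>\<odot> Y\<^sup>-)) = (inv (l\<^sub>\<odot> Y))\<^sup>-\<^sub>m"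
proof -
  have inv: "(inv (l\<^sub>\<odot> Y))\<^sup>-\<^sub>m \<cdot> (l\<^sub>\<odot> Y)\<^sup>-\<^sub>m = \<one> (\<I> \<odot> Y)\<^sup>-"
    by (simp flip: rev_circ.functor_comp)
  have "\<phi>\<^sub>\<odot> Y \<I> \<cdot> ((\<one> Y\<^sup>- \<odot>\<^sub>m \<phi>0\<^sub>\<odot>) \<cdot> inv (r\<^sub>\<odot> Y\<^sup>-))
     = (inv (l\<^sub>\<odot> Y))\<^sup>-\<^sub>m \<cdot> ((l\<^sub>\<odot> Y)\<^sup>-\<^sub>m \<cdot> \<phi>\<^sub>\<odot> Y \<I> \<cdot> (\<one> Y\<^sup>- \<odot>\<^sub>m \<phi>0\<^sub>\<odot>)) \<cdot> inv (r\<^sub>\<odot> Y\<^sup>-)"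
    by (simp add: comp_assoc comp_reduce[OF inv])
  also have "(l\<^sub>\<odot> Y)\<^sup>-\<^sub>m \<cdot> \<phi>\<^sub>\<odot> Y \<I> \<cdot> (\<one> Y\<^sup>- \<odot>\<^sub>m \<phi>0\<^sub>\<odot>) = r\<^sub>\<odot> Y\<^sup>-"
    using rev_circ.lax_runit[of Y] by (simp add: rev_tensor_def)
  finally show ?thesis by (simp add: comp_assoc)
qed

text \<open>The mirror image: it composes an arrow with a loop at its end point, followed by a further arrow.\<close>

definition delta_loop :: "'o \<Rightarrow> 'o \<Rightarrow> 'm" where
  "delta_loop X V = ((r\<^sub>\<odot> X \<cdot> r\<^sub>\<bullet> (X \<odot> \<I>)) \<odot>\<^sub>m \<one> V) \<cdot> (\<delta> X \<J> \<I> V \<cdot> (\<one> X \<bullet>\<^sub>m (\<one> \<J> \<odot>\<^sub>m (\<phi>0\<^sub>\<odot> \<bullet>\<^sub>m \<one> V))))"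

lemma delta_loop_simps [simp]: "Dom C (delta_loop X V) = X \<bullet> (\<J> \<odot> (\<I> \<bullet> V))" "Cod C (delta_loop X V) = X \<odot> V"
  by (simp_all add: delta_loop_def)

lemma delta_loop_natural: "Cod C v = V \<Longrightarrow> delta_loop X V \<cdot> (\<one> X \<bullet>\<^sub>m (\<one> \<J> \<odot>\<^sub>m (\<one> \<I> \<bullet>\<^sub>m v))) = (\<one> X \<odot>\<^sub>m v) \<cdot> delta_loop X (Dom C v)"
  using delta_nat'[of "\<one> X" X "\<one> \<J>" \<J> "\<one> \<I>" \<I> v V "\<one> X \<bullet>\<^sub>m (\<one> \<J> \<odot>\<^sub>m (\<phi>0\<^sub>\<odot> \<bullet>\<^sub>m \<one> (Dom C v)))"]
  by (simp add: delta_loop_def comp_assoc bul.merges circ.merges)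

text \<open>Following an arrow by an identity loop changes nothing; formally this is
  \<open>delta_unit\<close> with \<open>J\<close> for \<open>Y\<close>.\<close>

lemma delta_loop_unit: "r\<^sub>\<odot> X \<cdot> (delta_loop X \<I> \<cdot> (\<one> X \<bullet>\<^sub>m ((\<one> \<J> \<odot>\<^sub>m \<Delta>\<^sub>I) \<cdot> inv (r\<^sub>\<odot> \<J>)))) = r\<^sub>\<bullet> X"
proof -
  have "delta_loop X \<I> \<cdot> (\<one> X \<bullet>\<^sub>m ((\<one> \<J> \<odot>\<^sub>m \<Delta>\<^sub>I) \<cdot> inv (r\<^sub>\<odot> \<J>)))
    = ((r\<^sub>\<odot> X \<cdot> r\<^sub>\<bullet> (X \<odot> \<I>)) \<odot>\<^sub>m \<one> \<I>) \<cdot> (\<delta> X \<J> \<I> \<I> \<cdot> (\<one> X \<bullet>\<^sub>m (\<one> \<J> \<odot>\<^sub>m coact_rev_l)) \<cdot> (\<one> X \<bullet>\<^sub>m inv (r\<^sub>\<odot> \<J>)))"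
    by (simp add: delta_loop_def coact_rev_l_def comp_assoc bul.merges circ.merges)
  also have "\<dots> = ((r\<^sub>\<odot> X \<cdot> r\<^sub>\<bullet> (X \<odot> \<I>)) \<odot>\<^sub>m \<one> \<I>) \<cdot> (((inv (r\<^sub>\<odot> X) \<bullet>\<^sub>m \<one> \<J>) \<odot>\<^sub>m \<one> \<I>) \<cdot> inv (r\<^sub>\<odot> (X \<bullet> \<J>)))"
    unfolding delta_unit by (simp add: comp_assoc bul.merges)
  also have "\<dots> = inv (r\<^sub>\<odot> X) \<cdot> r\<^sub>\<bullet> X"
    by (simp add: circ.merges bul.nats comp_assoc) (simp add: circ.nats)
  finally show ?thesis by simp
qed

text \<open>(R9) with the unit for \<open>Z\<close>: once \<open>x y^-1\<close> is no longer
  recorded as a loop, \<open>(x y^-1) u = x (y^-1 u)\<close>. This rebracketing brings in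
  \<open>psi\<close>, and with it the left antipode identity.\<close>

lemma varphi_ext_psi:
  "((r\<^sub>\<bullet> (X \<odot> Y) \<cdot> (\<one> (X \<odot> Y) \<bullet>\<^sub>m \<epsilon>\<^sub>I)) \<odot>\<^sub>m \<one> U) \<cdot> varphi_ext X Y U
     = inv (a\<^sub>\<odot> X Y U) \<cdot> (delta_loop X (Y \<odot> U) \<cdot> (\<one> X \<bullet>\<^sub>m psi C Y U))"
proof -
  let ?L = "\<delta> X (\<J> \<odot> \<J>) \<I> (Y \<odot> U) \<cdot> (\<one> X \<bullet>\<^sub>m inv (a\<^sub>\<odot> \<J> \<J> (\<I>\<^sup>- \<bullet> (Y \<odot> U))))
           \<cdot> (\<one> X \<bullet>\<^sub>m (\<one> \<J> \<odot>\<^sub>m \<gamma> \<J> Y \<I>\<^sup>- U))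
           \<cdot> (\<one> X \<bullet>\<^sub>m (\<one> \<J> \<odot>\<^sub>m ((inv (l\<^sub>\<bullet> Y\<^sup>-) \<odot>\<^sub>m \<one> \<I>\<^sup>-) \<bullet>\<^sub>m \<one> U)))"
  let ?R = "(\<zeta> X \<J> \<I> \<J> \<odot>\<^sub>m \<one> (Y \<odot> U)) \<cdot> ((inv (r\<^sub>\<bullet> X) \<odot>\<^sub>m inv (r\<^sub>\<bullet> \<I>)) \<odot>\<^sub>m \<one> (Y \<odot> U))
           \<cdot> a\<^sub>\<odot> (X \<odot> \<I>) Y U \<cdot> (inv (a\<^sub>\<odot> X \<I> Y) \<odot>\<^sub>m \<one> U) \<cdot> (r\<^sub>\<bullet> (X \<odot> (\<I> \<odot> Y)) \<odot>\<^sub>m \<one> U)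
           \<cdot> \<delta> X \<J> (\<I> \<odot> Y) U \<cdot> (\<one> X \<bullet>\<^sub>m (\<one> \<J> \<odot>\<^sub>m (\<phi>\<^sub>\<odot> Y \<I> \<bullet>\<^sub>m \<one> U)))"
  let ?q = "(\<one> Y\<^sup>- \<odot>\<^sub>m \<phi>0\<^sub>\<odot>) \<cdot> inv (r\<^sub>\<odot> Y\<^sup>-)"
  \<comment> \<open>Creates one \<open>J\<close> through the unit of the monoid \<open>J\<close>, to
    match the \<open>J \<odot> J\<close> of (R9). The multiplication in \<open>?P\<close> absorbs it
    by \<open>mJ_epsI\<close>.\<close>
  let ?t = "(\<epsilon>\<^sub>I \<odot>\<^sub>m \<one> (Y\<^sup>- \<bullet> U)) \<cdot> inv (l\<^sub>\<odot> (Y\<^sup>- \<bullet> U))"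
  let ?E = "\<one> X \<bullet>\<^sub>m ((\<one> \<J> \<odot>\<^sub>m (?q \<bullet>\<^sub>m \<one> U)) \<cdot> ?t)"
  let ?P = "(r\<^sub>\<odot> X \<cdot> (r\<^sub>\<bullet> (X \<odot> \<I>) \<cdot> (\<one> (X \<odot> \<I>) \<bullet>\<^sub>m m\<^sub>J))) \<odot>\<^sub>m \<one> (Y \<odot> U)"
  let ?B = "\<I>\<^sup>- \<bullet> (Y \<odot> U)"
  let ?\<Psi> = "(\<one> \<J> \<odot>\<^sub>m (\<phi>0\<^sub>\<odot> \<bullet>\<^sub>m \<one> (Y \<odot> U))) \<cdot> psi C Y U"
  let ?e = "r\<^sub>\<bullet> (X \<odot> Y) \<cdot> (\<one> (X \<odot> Y) \<bullet>\<^sub>m \<epsilon>\<^sub>I)"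
  let ?w = "(?e \<odot>\<^sub>m \<one> U) \<cdot> varphi_ext X Y U"
  let ?h = "(\<epsilon>\<^sub>I \<odot>\<^sub>m \<one> (\<J> \<odot> ?B)) \<cdot> (inv (l\<^sub>\<odot> (\<J> \<odot> ?B)) \<cdot> ?\<Psi>)"
  let ?b = "inv (a\<^sub>\<odot> \<J> \<J> ?B) \<cdot> ?h"
  have g: "\<gamma> \<J> Y \<I>\<^sup>- U \<cdot> (((inv (l\<^sub>\<bullet> Y\<^sup>-) \<odot>\<^sub>m \<one> \<I>\<^sup>-) \<cdot> ?q) \<bullet>\<^sub>m \<one> U) = ?\<Psi>"
    using gamma_nat'[of "\<one> \<J>" \<J> "\<one> Y" Y "\<phi>0\<^sub>\<odot>" "\<I>\<^sup>-" "\<one> U" U "((inv (l\<^sub>\<bullet> Y\<^sup>-) \<odot>\<^sub>m \<one> \<I>) \<cdot> inv (r\<^sub>\<odot> Y\<^sup>-)) \<bullet>\<^sub>m \<one> U"]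
    by (simp add: psi_def comp_assoc bul.merges circ.merges)
  have "?L \<cdot> ?E = \<delta> X (\<J> \<odot> \<J>) \<I> (Y \<odot> U) \<cdot> (\<one> X \<bullet>\<^sub>m (inv (a\<^sub>\<odot> \<J> \<J> ?B) \<cdot> ((\<one> \<J> \<odot>\<^sub>m ?\<Psi>) \<cdot> ?t)))"
    unfolding g[symmetric] by (simp add: comp_assoc bul.merges circ.merges)
  also have "(\<one> \<J> \<odot>\<^sub>m ?\<Psi>) \<cdot> ?t = (\<epsilon>\<^sub>I \<odot>\<^sub>m \<one> (\<J> \<odot> ?B)) \<cdot> (inv (l\<^sub>\<odot> (\<J> \<odot> ?B)) \<cdot> ?\<Psi>)"
  proof -
    have "(\<one> \<J> \<odot>\<^sub>m ?\<Psi>) \<cdot> ?t = (\<epsilon>\<^sub>I \<odot>\<^sub>m \<one> (\<J> \<odot> ?B)) \<cdot> ((\<one> \<I> \<odot>\<^sub>m ?\<Psi>) \<cdot> inv (l\<^sub>\<odot> (Y\<^sup>- \<bullet> U)))"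
      by (simp add: circ.merges)
    then show ?thesis by (simp add: circ.nats)
  qed
  finally have "?P \<cdot> (?L \<cdot> ?E) = ((r\<^sub>\<odot> X \<cdot> r\<^sub>\<bullet> (X \<odot> \<I>)) \<odot>\<^sub>m \<one> (Y \<odot> U)) \<cdot> (((\<one> (X \<odot> \<I>) \<bullet>\<^sub>m m\<^sub>J) \<odot>\<^sub>m \<one> (Y \<odot> U)) \<cdot> (\<delta> X (\<J> \<odot> \<J>) \<I> (Y \<odot> U)
     \<cdot> (\<one> X \<bullet>\<^sub>m ?b)))"
    by (simp add: comp_assoc circ.merges)
  also have "((\<one> (X \<odot> \<I>) \<bullet>\<^sub>m m\<^sub>J) \<odot>\<^sub>m \<one> (Y \<odot> U)) \<cdot> (\<delta> X (\<J> \<odot> \<J>) \<I> (Y \<odot> U)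
     \<cdot> (\<one> X \<bullet>\<^sub>m ?b))
     = \<delta> X \<J> \<I> (Y \<odot> U) \<cdot> (\<one> X \<bullet>\<^sub>m ((m\<^sub>J \<odot>\<^sub>m \<one> ?B) \<cdot> ?b))"
    using delta_nat'[of "\<one> X" X "m\<^sub>J" \<J> "\<one> \<I>" \<I> "\<one> (Y \<odot> U)" "Y \<odot> U" "\<one> X \<bullet>\<^sub>m ?b"]
    by (simp add: bul.merges)
  also have "(m\<^sub>J \<odot>\<^sub>m \<one> ?B) \<cdot> ?b = ?\<Psi>"
    using circ.nat_ai'[of "\<epsilon>\<^sub>I" \<J> "\<one> \<J>" \<J> "\<one> ?B" ?B "inv (l\<^sub>\<odot> (\<J> \<odot> ?B)) \<cdot> ?\<Psi>"]
    by (simp add: circ.merges mJ_epsI comp_reduce[OF circ.lunit_tensor'])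
  finally have L: "?P \<cdot> (?L \<cdot> ?E) = delta_loop X (Y \<odot> U) \<cdot> (\<one> X \<bullet>\<^sub>m psi C Y U)"
    by (simp add: delta_loop_def comp_assoc bul.merges)
  have d: "\<delta> X \<J> (\<I> \<odot> Y) U \<cdot> ((\<one> X \<bullet>\<^sub>m (\<one> \<J> \<odot>\<^sub>m (\<phi>\<^sub>\<odot> Y \<I> \<bullet>\<^sub>m \<one> U))) \<cdot> ?E)
      = (((\<one> X \<odot>\<^sub>m inv (l\<^sub>\<odot> Y)) \<bullet>\<^sub>m \<epsilon>\<^sub>I) \<odot>\<^sub>m \<one> U) \<cdot> varphi_ext X Y U"
  proof -
    have "(\<one> X \<bullet>\<^sub>m (\<one> \<J> \<odot>\<^sub>m (\<phi>\<^sub>\<odot> Y \<I> \<bullet>\<^sub>m \<one> U))) \<cdot> ?E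
       = \<one> X \<bullet>\<^sub>m ((\<one> \<J> \<odot>\<^sub>m ((\<phi>\<^sub>\<odot> Y \<I> \<cdot> ?q) \<bullet>\<^sub>m \<one> U)) \<cdot> ?t)"
      by (simp add: comp_assoc bul.merges circ.merges)
    also have "\<dots> = (\<one> X \<bullet>\<^sub>m (\<epsilon>\<^sub>I \<odot>\<^sub>m ((inv (l\<^sub>\<odot> Y))\<^sup>-\<^sub>m \<bullet>\<^sub>m \<one> U))) \<cdot> (\<one> X \<bullet>\<^sub>m inv (l\<^sub>\<odot> (Y\<^sup>- \<bullet> U)))"
      unfolding phi_circ_unit by (simp add: comp_assoc bul.merges circ.merges)
    finally show ?thesis by (simp add: delta_nat' varphi_ext_def comp_assoc)
  qed
  have "?P \<cdot> (?R \<cdot> ?E) = ?P \<cdot> ((\<zeta> X \<J> \<I> \<J> \<odot>\<^sub>m \<one> (Y \<odot> U)) \<cdot> (((inv (r\<^sub>\<bullet> X) \<odot>\<^sub>m inv (r\<^sub>\<bullet> \<I>)) \<odot>\<^sub>m \<one> (Y \<odot> U))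
           \<cdot> (a\<^sub>\<odot> (X \<odot> \<I>) Y U \<cdot> (((inv (a\<^sub>\<odot> X \<I> Y) \<cdot> (r\<^sub>\<bullet> (X \<odot> (\<I> \<odot> Y)) \<cdot> ((\<one> X \<odot>\<^sub>m inv (l\<^sub>\<odot> Y)) \<bullet>\<^sub>m \<epsilon>\<^sub>I))) \<odot>\<^sub>m \<one> U) \<cdot> varphi_ext X Y U))))"
    using d by (simp add: comp_assoc circ.merges)
  also have "inv (a\<^sub>\<odot> X \<I> Y) \<cdot> (r\<^sub>\<bullet> (X \<odot> (\<I> \<odot> Y)) \<cdot> ((\<one> X \<odot>\<^sub>m inv (l\<^sub>\<odot> Y)) \<bullet>\<^sub>m \<epsilon>\<^sub>I))
     = (inv (r\<^sub>\<odot> X) \<odot>\<^sub>m \<one> Y) \<cdot> ?e"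
  proof -
    have "inv (a\<^sub>\<odot> X \<I> Y) \<cdot> (r\<^sub>\<bullet> (X \<odot> (\<I> \<odot> Y)) \<cdot> (((\<one> X \<odot>\<^sub>m inv (l\<^sub>\<odot> Y)) \<bullet>\<^sub>m \<one> \<J>) \<cdot> (\<one> (X \<odot> Y) \<bullet>\<^sub>m \<epsilon>\<^sub>I)))
      = (inv (r\<^sub>\<odot> X) \<odot>\<^sub>m \<one> Y) \<cdot> ?e"
      by (simp add: bul.nats comp_reduce[OF circ.triangle_inv'])
    then show ?thesis by (simp add: bul.merges)
  qed
  also have "a\<^sub>\<odot> (X \<odot> \<I>) Y U \<cdot> ((\<dots> \<odot>\<^sub>m \<one> U) \<cdot> varphi_ext X Y U)
     = (inv (r\<^sub>\<odot> X) \<odot>\<^sub>m \<one> (Y \<odot> U)) \<cdot> (a\<^sub>\<odot> X Y U \<cdot> ?w)"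
    using circ.nat_a'[of "inv (r\<^sub>\<odot> X)" "X \<odot> \<I>" "\<one> Y" Y "\<one> U" U "(?e \<odot>\<^sub>m \<one> U) \<cdot> varphi_ext X Y U"]
    by (simp add: comp_assoc circ.split_r)
  also have "?P \<cdot> ((\<zeta> X \<J> \<I> \<J> \<odot>\<^sub>m \<one> (Y \<odot> U)) \<cdot> (((inv (r\<^sub>\<bullet> X) \<odot>\<^sub>m inv (r\<^sub>\<bullet> \<I>)) \<odot>\<^sub>m \<one> (Y \<odot> U)) \<cdot> \<dots>))
     = ((r\<^sub>\<odot> X \<cdot> ((r\<^sub>\<bullet> (X \<odot> \<I>) \<cdot> (\<one> (X \<odot> \<I>) \<bullet>\<^sub>m m\<^sub>J) \<cdot> \<zeta> X \<J> \<I> \<J>) \<cdot> ((inv (r\<^sub>\<bullet> X) \<odot>\<^sub>m inv (r\<^sub>\<bullet> \<I>)) \<cdot> inv (r\<^sub>\<odot> X))))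
        \<odot>\<^sub>m \<one> (Y \<odot> U)) \<cdot> (a\<^sub>\<odot> X Y U \<cdot> ?w)"
    by (simp add: comp_assoc circ.merges)
  \<comment> \<open>On this side \<open>m_J\<close> meets the two factors \<open>J\<close> made by
    inverse unit constraints, and the unit axiom of \<open>\<zeta>\<close> cancels all
    three.\<close>
  also have "\<dots> = a\<^sub>\<odot> X Y U \<cdot> ?w"
    unfolding zeta_bul_runit by (simp add: circ.merges)
  finally have R: "?P \<cdot> (?R \<cdot> ?E) = \<dots>" .
  have "delta_loop X (Y \<odot> U) \<cdot> (\<one> X \<bullet>\<^sub>m psi C Y U) = a\<^sub>\<odot> X Y U \<cdot> ?w"
    unfolding L[symmetric] R9 R ..
  then show ?thesis by simp
qed

text \<open>(R4) with units for \<open>Y\<close> and \<open>Z\<close>: the quotient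
  \<open>x z^-1\<close> meets only \<open>u\<close>, and \<open>v\<close> passes through. The loop,
  duplicated by \<open>\<Delta>\<^sub>I\<close> to fit (R4), is reduced to one copy again by the
  counit of the unit object.\<close>

lemma zeta_varphi_ext:
  "\<zeta> (X \<odot> Z) \<I> U V \<cdot> varphi_ext X Z (U \<bullet> V)
     = ((((r\<^sub>\<bullet> (X \<odot> Z) \<cdot> (\<one> (X \<odot> Z) \<bullet>\<^sub>m \<epsilon>\<^sub>I)) \<odot>\<^sub>m \<one> U) \<cdot> varphi_ext X Z U) \<bullet>\<^sub>m inv (l\<^sub>\<odot> V))
       \<cdot> (inv (a\<^sub>\<bullet> X (Z\<^sup>- \<bullet> U) V) \<cdot> (\<one> X \<bullet>\<^sub>m inv (a\<^sub>\<bullet> Z\<^sup>- U V)))"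
proof -
  let ?L = "(\<delta> X \<I> Z U \<bullet>\<^sub>m \<one> (\<I> \<odot> V)) \<cdot> inv (a\<^sub>\<bullet> X (\<I> \<odot> (Z\<^sup>- \<bullet> U)) (\<I> \<odot> V))
           \<cdot> (\<one> X \<bullet>\<^sub>m \<zeta> \<I> \<I> (Z\<^sup>- \<bullet> U) V) \<cdot> (\<one> X \<bullet>\<^sub>m (\<one> (\<I> \<bullet> \<I>) \<odot>\<^sub>m inv (a\<^sub>\<bullet> Z\<^sup>- U V)))"
  let ?R = "\<zeta> ((X \<odot> Z) \<bullet> \<I>) \<I> U V \<cdot> (inv (a\<^sub>\<bullet> (X \<odot> Z) \<I> \<I>) \<odot>\<^sub>m \<one> (U \<bullet> V)) \<cdot> \<delta> X (\<I> \<bullet> \<I>) Z (U \<bullet> V)"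
  let ?E = "\<one> X \<bullet>\<^sub>m ((\<Delta>\<^sub>I \<odot>\<^sub>m \<one> (Z\<^sup>- \<bullet> (U \<bullet> V))) \<cdot> inv (l\<^sub>\<odot> (Z\<^sup>- \<bullet> (U \<bullet> V))))"
  let ?e = "r\<^sub>\<bullet> (X \<odot> Z) \<cdot> (\<one> (X \<odot> Z) \<bullet>\<^sub>m \<epsilon>\<^sub>I)"
  let ?P = "(?e \<odot>\<^sub>m \<one> U) \<bullet>\<^sub>m \<one> (\<I> \<odot> V)"
  let ?c = "inv (a\<^sub>\<bullet> (X \<odot> Z) \<I> \<I>) \<cdot> (\<one> (X \<odot> Z) \<bullet>\<^sub>m \<Delta>\<^sub>I)"
  have "\<zeta> \<I> \<I> (Z\<^sup>- \<bullet> U) V \<cdot> ((\<one> (\<I> \<bullet> \<I>) \<odot>\<^sub>m inv (a\<^sub>\<bullet> Z\<^sup>- U V)) \<cdot> ((\<Delta>\<^sub>I \<odot>\<^sub>m \<one> (Z\<^sup>- \<bullet> (U \<bullet> V))) \<cdot> inv (l\<^sub>\<odot> (Z\<^sup>- \<bullet> (U \<bullet> V)))))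
     = \<zeta> \<I> \<I> (Z\<^sup>- \<bullet> U) V \<cdot> ((\<Delta>\<^sub>I \<odot>\<^sub>m \<one> (Z\<^sup>- \<bullet> U \<bullet> V)) \<cdot> ((\<one> \<I> \<odot>\<^sub>m inv (a\<^sub>\<bullet> Z\<^sup>- U V)) \<cdot> inv (l\<^sub>\<odot> (Z\<^sup>- \<bullet> (U \<bullet> V)))))"
    by (simp add: circ.merges)
  also have "\<dots> = (inv (l\<^sub>\<odot> (Z\<^sup>- \<bullet> U)) \<bullet>\<^sub>m inv (l\<^sub>\<odot> V)) \<cdot> inv (a\<^sub>\<bullet> Z\<^sup>- U V)"
    by (simp add: circ.nats comp_reduce3[OF zeta_lunit_inv])
  finally have "?L \<cdot> ?E = (\<delta> X \<I> Z U \<bullet>\<^sub>m \<one> (\<I> \<odot> V)) \<cdot> (inv (a\<^sub>\<bullet> X (\<I> \<odot> (Z\<^sup>- \<bullet> U)) (\<I> \<odot> V))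
           \<cdot> ((\<one> X \<bullet>\<^sub>m (inv (l\<^sub>\<odot> (Z\<^sup>- \<bullet> U)) \<bullet>\<^sub>m inv (l\<^sub>\<odot> V))) \<cdot> (\<one> X \<bullet>\<^sub>m inv (a\<^sub>\<bullet> Z\<^sup>- U V))))"
    by (simp add: comp_assoc bul.merges)
  also have "\<dots> = (varphi_ext X Z U \<bullet>\<^sub>m inv (l\<^sub>\<odot> V)) \<cdot> (inv (a\<^sub>\<bullet> X (Z\<^sup>- \<bullet> U) V) \<cdot> (\<one> X \<bullet>\<^sub>m inv (a\<^sub>\<bullet> Z\<^sup>- U V)))"
    by (simp add: bul.nat_ai' varphi_ext_def) (simp add: bul.merges)
  finally have L: "?L \<cdot> ?E = \<dots>" .
  have c: "(?e \<bullet>\<^sub>m \<one> \<I>) \<cdot> ?c = \<one> ((X \<odot> Z) \<bullet> \<I>)"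
  proof -
    have "(?e \<bullet>\<^sub>m \<one> \<I>) \<cdot> ?c
      = (r\<^sub>\<bullet> (X \<odot> Z) \<bullet>\<^sub>m \<one> \<I>) \<cdot> (((\<one> (X \<odot> Z) \<bullet>\<^sub>m \<epsilon>\<^sub>I) \<bullet>\<^sub>m \<one> \<I>) \<cdot> ?c)"
      by (simp add: bul.merges)
    also have "\<dots> = (r\<^sub>\<bullet> (X \<odot> Z) \<bullet>\<^sub>m \<one> \<I>) \<cdot> (inv (a\<^sub>\<bullet> (X \<odot> Z) \<J> \<I>) \<cdot> ((\<one> (X \<odot> Z) \<bullet>\<^sub>m (\<epsilon>\<^sub>I \<bullet>\<^sub>m \<one> \<I>)) \<cdot> (\<one> (X \<odot> Z) \<bullet>\<^sub>m \<Delta>\<^sub>I)))"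
      using bul.nat_ai'[of "\<one> (X \<odot> Z)" "X \<odot> Z" "\<epsilon>\<^sub>I" \<J> "\<one> \<I>" \<I> "\<one> (X \<odot> Z) \<bullet>\<^sub>m \<Delta>\<^sub>I"] by simp
    also have "\<dots> = \<one> ((X \<odot> Z) \<bullet> \<I>)"
      by (simp add: comp_reduce[OF bul.triangle'] bul.merges I_lcounit)
    finally show ?thesis .
  qed
  have "\<delta> X (\<I> \<bullet> \<I>) Z (U \<bullet> V) \<cdot> ?E = ((\<one> (X \<odot> Z) \<bullet>\<^sub>m \<Delta>\<^sub>I) \<odot>\<^sub>m \<one> (U \<bullet> V)) \<cdot> varphi_ext X Z (U \<bullet> V)"
    using delta_nat'[of "\<one> X" X "\<Delta>\<^sub>I" "\<I> \<bullet> \<I>" "\<one> Z" Z "\<one> (U \<bullet> V)" "U \<bullet> V" "\<one> X \<bullet>\<^sub>m inv (l\<^sub>\<odot> (Z\<^sup>- \<bullet> (U \<bullet> V)))"]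
    by (simp add: varphi_ext_def bul.merges)
  then have "?P \<cdot> (?R \<cdot> ?E) = ?P \<cdot> (\<zeta> ((X \<odot> Z) \<bullet> \<I>) \<I> U V \<cdot> ((?c \<odot>\<^sub>m \<one> (U \<bullet> V)) \<cdot> varphi_ext X Z (U \<bullet> V)))"
    by (simp add: comp_assoc circ.merges)
  also have "\<dots> = \<zeta> (X \<odot> Z) \<I> U V \<cdot> (((?e \<bullet>\<^sub>m \<one> \<I>) \<odot>\<^sub>m \<one> (U \<bullet> V)) \<cdot> ((?c \<odot>\<^sub>m \<one> (U \<bullet> V)) \<cdot> varphi_ext X Z (U \<bullet> V)))"
    using nat_zeta'[of ?e "X \<odot> Z" "\<one> \<I>" \<I> "\<one> U" U "\<one> V" V "(?c \<odot>\<^sub>m \<one> (U \<bullet> V)) \<cdot> varphi_ext X Z (U \<bullet> V)"]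
    by simp
  also have "\<dots> = \<zeta> (X \<odot> Z) \<I> U V \<cdot> varphi_ext X Z (U \<bullet> V)"
    by (simp add: circ.merges c)
  finally have R: "?P \<cdot> (?R \<cdot> ?E) = \<dots>" .
  show ?thesis
    unfolding R[symmetric] R4[symmetric] L by (simp add: bul.merges)
qed

text \<open>(R3) with units for \<open>Y\<close> and \<open>T\<close>, that is,
  \<open>(x z) u^-1 = x (z u^-1)\<close>: the factor \<open>x\<close> moves outside the
  division.\<close>

lemma delta_zeta:
  "\<delta> (X \<odot> Z) \<I> U V \<cdot> \<zeta> X \<I> Z (U\<^sup>- \<bullet> V)
     = ((inv (a\<^sub>\<odot> X Z U) \<bullet>\<^sub>m r\<^sub>\<odot> \<I>) \<odot>\<^sub>m \<one> V) \<cdot> ((\<zeta> X \<I> (Z \<odot> U) \<I> \<odot>\<^sub>m \<one> V)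
       \<cdot> (inv (a\<^sub>\<odot> (X \<bullet> \<I>) ((Z \<odot> U) \<bullet> \<I>) V) \<cdot> (\<one> (X \<bullet> \<I>) \<odot>\<^sub>m varphi_ext Z U V)))"
proof -
  let ?L = "((a\<^sub>\<odot> X Z U \<bullet>\<^sub>m \<one> (\<I> \<odot> \<I>)) \<odot>\<^sub>m \<one> V) \<cdot> \<delta> (X \<odot> Z) (\<I> \<odot> \<I>) U V
           \<cdot> (\<one> (X \<odot> Z) \<bullet>\<^sub>m inv (a\<^sub>\<odot> \<I> \<I> (U\<^sup>- \<bullet> V))) \<cdot> \<zeta> X \<I> Z (\<I> \<odot> (U\<^sup>- \<bullet> V))"
  let ?R = "(\<zeta> X \<I> (Z \<odot> U) \<I> \<odot>\<^sub>m \<one> V) \<cdot> inv (a\<^sub>\<odot> (X \<bullet> \<I>) ((Z \<odot> U) \<bullet> \<I>) V) \<cdot> (\<one> (X \<bullet> \<I>) \<odot>\<^sub>m \<delta> Z \<I> U V)"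
  let ?E = "\<one> (X \<bullet> \<I>) \<odot>\<^sub>m (\<one> Z \<bullet>\<^sub>m inv (l\<^sub>\<odot> (U\<^sup>- \<bullet> V)))"
  let ?P = "(inv (a\<^sub>\<odot> X Z U) \<bullet>\<^sub>m r\<^sub>\<odot> \<I>) \<odot>\<^sub>m \<one> V"
  have "?L \<cdot> ?E = ((a\<^sub>\<odot> X Z U \<bullet>\<^sub>m \<one> (\<I> \<odot> \<I>)) \<odot>\<^sub>m \<one> V) \<cdot> (\<delta> (X \<odot> Z) (\<I> \<odot> \<I>) U V
           \<cdot> ((\<one> (X \<odot> Z) \<bullet>\<^sub>m (inv (r\<^sub>\<odot> \<I>) \<odot>\<^sub>m \<one> (U\<^sup>- \<bullet> V))) \<cdot> \<zeta> X \<I> Z (U\<^sup>- \<bullet> V)))"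
    using nat_zeta[of "\<one> X" X "\<one> \<I>" \<I> "\<one> Z" Z "inv (l\<^sub>\<odot> (U\<^sup>- \<bullet> V))" "\<I> \<odot> (U\<^sup>- \<bullet> V)"]
    by (simp add: comp_assoc bul.merges circ.triangle_inv')
  also have "\<dots> = ((a\<^sub>\<odot> X Z U \<bullet>\<^sub>m inv (r\<^sub>\<odot> \<I>)) \<odot>\<^sub>m \<one> V) \<cdot> (\<delta> (X \<odot> Z) \<I> U V \<cdot> \<zeta> X \<I> Z (U\<^sup>- \<bullet> V))"
    using delta_nat'[of "\<one> (X \<odot> Z)" "X \<odot> Z" "inv (r\<^sub>\<odot> \<I>)" "\<I> \<odot> \<I>" "\<one> U" U "\<one> V" V "\<zeta> X \<I> Z (U\<^sup>- \<bullet> V)"]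
    by (simp add: circ.merges bul.merges)
  finally have "?P \<cdot> (?L \<cdot> ?E) = \<delta> (X \<odot> Z) \<I> U V \<cdot> \<zeta> X \<I> Z (U\<^sup>- \<bullet> V)"
    by (simp add: circ.merges bul.merges)
  then show ?thesis
    unfolding R3 by (simp add: comp_assoc circ.merges varphi_ext_def)
qed

end

section \<open>The Galois map of a module over a Hopf monoid\<close>

context duoidal_category
begin

lemma bimonoid_simps [simp]:
  assumes "is_bimonoid C H"
  shows "Dom C (mult H) = obj H \<odot> obj H" "Cod C (mult H) = obj H"
    "Dom C (unit H) = \<I>" "Cod C (unit H) = obj H"
    "Dom C (comult H) = obj H" "Cod C (comult H) = obj H \<bullet> obj H"
    "Dom C (counit H) = obj H" "Cod C (counit H) = \<J>"
  using assms by (simp_all add: is_bimonoid_def monoid_in_def comonoid_in_def hom_def)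

text \<open>Composites are bracketed to the right, the normal form produced by
  \<open>comp_assoc\<close>, so that the laws can be applied inside longer composites.\<close>

lemma bimonoid_laws:
  assumes "is_bimonoid C H"
  shows mult_assoc: "mult H \<cdot> (mult H \<odot>\<^sub>m \<one> (obj H)) = mult H \<cdot> ((\<one> (obj H) \<odot>\<^sub>m mult H) \<cdot> a\<^sub>\<odot> (obj H) (obj H) (obj H))"
    and mult_lunit: "mult H \<cdot> (unit H \<odot>\<^sub>m \<one> (obj H)) = l\<^sub>\<odot> (obj H)"
    and mult_runit: "mult H \<cdot> (\<one> (obj H) \<odot>\<^sub>m unit H) = r\<^sub>\<odot> (obj H)"
    and coassoc: "a\<^sub>\<bullet> (obj H) (obj H) (obj H) \<cdot> ((comult H \<bullet>\<^sub>m \<one> (obj H)) \<cdot> comult H) = (\<one> (obj H) \<bullet>\<^sub>m comult H) \<cdot> comult H"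
    and lcounit: "l\<^sub>\<bullet> (obj H) \<cdot> ((counit H \<bullet>\<^sub>m \<one> (obj H)) \<cdot> comult H) = \<one> (obj H)"
    and rcounit: "r\<^sub>\<bullet> (obj H) \<cdot> ((\<one> (obj H) \<bullet>\<^sub>m counit H) \<cdot> comult H) = \<one> (obj H)"
    and comult_mult: "comult H \<cdot> mult H = (mult H \<bullet>\<^sub>m mult H) \<cdot> (\<zeta> (obj H) (obj H) (obj H) (obj H) \<cdot> (comult H \<odot>\<^sub>m comult H))"
    and counit_mult: "counit H \<cdot> mult H = m\<^sub>J \<cdot> (counit H \<odot>\<^sub>m counit H)"
    and comult_unit: "comult H \<cdot> unit H = (unit H \<bullet>\<^sub>m unit H) \<cdot> \<Delta>\<^sub>I"
    and counit_unit: "counit H \<cdot> unit H = \<epsilon>\<^sub>I"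
proof -
  note [simp] = bimonoid_simps[OF assms]
  note d = assms[unfolded is_bimonoid_def monoid_in_def comonoid_in_def]
  have "mult H \<cdot> (mult H \<odot>\<^sub>m \<one> (obj H)) = mult H \<cdot> (\<one> (obj H) \<odot>\<^sub>m mult H) \<cdot> a\<^sub>\<odot> (obj H) (obj H) (obj H)"
    using d by blast
  then show "mult H \<cdot> (mult H \<odot>\<^sub>m \<one> (obj H)) = mult H \<cdot> ((\<one> (obj H) \<odot>\<^sub>m mult H) \<cdot> a\<^sub>\<odot> (obj H) (obj H) (obj H))"
    by (simp add: comp_assoc)
  have "a\<^sub>\<bullet> (obj H) (obj H) (obj H) \<cdot> (comult H \<bullet>\<^sub>m \<one> (obj H)) \<cdot> comult H = (\<one> (obj H) \<bullet>\<^sub>m comult H) \<cdot> comult H"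
    using d by blast
  then show "a\<^sub>\<bullet> (obj H) (obj H) (obj H) \<cdot> ((comult H \<bullet>\<^sub>m \<one> (obj H)) \<cdot> comult H) = (\<one> (obj H) \<bullet>\<^sub>m comult H) \<cdot> comult H"
    by (simp add: comp_assoc)
  have "l\<^sub>\<bullet> (obj H) \<cdot> (counit H \<bullet>\<^sub>m \<one> (obj H)) \<cdot> comult H = \<one> (obj H)" using d by blast
  then show "l\<^sub>\<bullet> (obj H) \<cdot> ((counit H \<bullet>\<^sub>m \<one> (obj H)) \<cdot> comult H) = \<one> (obj H)" by (simp add: comp_assoc)
  have "r\<^sub>\<bullet> (obj H) \<cdot> (\<one> (obj H) \<bullet>\<^sub>m counit H) \<cdot> comult H = \<one> (obj H)" using d by blast
  then show "r\<^sub>\<bullet> (obj H) \<cdot> ((\<one> (obj H) \<bullet>\<^sub>m counit H) \<cdot> comult H) = \<one> (obj H)" by (simp add: comp_assoc)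
  have "comult H \<cdot> mult H = (mult H \<bullet>\<^sub>m mult H) \<cdot> \<zeta> (obj H) (obj H) (obj H) (obj H) \<cdot> (comult H \<odot>\<^sub>m comult H)"
    using d by blast
  then show "comult H \<cdot> mult H = (mult H \<bullet>\<^sub>m mult H) \<cdot> (\<zeta> (obj H) (obj H) (obj H) (obj H) \<cdot> (comult H \<odot>\<^sub>m comult H))"
    by (simp add: comp_assoc)
qed (use assms in \<open>simp_all add: is_bimonoid_def monoid_in_def\<close>)

lemma coassoc':
  assumes "is_bimonoid C H"
  shows "inv (a\<^sub>\<bullet> (obj H) (obj H) (obj H)) \<cdot> ((\<one> (obj H) \<bullet>\<^sub>m comult H) \<cdot> comult H) = (comult H \<bullet>\<^sub>m \<one> (obj H)) \<cdot> comult H"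
  unfolding coassoc[OF assms, symmetric] using assms by simp

definition right_module :: "('o, 'm) bimonoid \<Rightarrow> 'o \<Rightarrow> 'm \<Rightarrow> bool" where
  "right_module H X \<rho> \<longleftrightarrow> \<rho> \<in> hom C (X \<odot> obj H) X \<and>
     \<rho> \<cdot> (\<rho> \<odot>\<^sub>m \<one> (obj H)) = \<rho> \<cdot> ((\<one> X \<odot>\<^sub>m mult H) \<cdot> a\<^sub>\<odot> X (obj H) (obj H)) \<and>
     \<rho> \<cdot> (\<one> X \<odot>\<^sub>m unit H) = r\<^sub>\<odot> X"

lemma right_moduleD:
  assumes "right_module H X \<rho>"
  shows "Dom C \<rho> = X \<odot> obj H" "Cod C \<rho> = X"
    "\<rho> \<cdot> (\<rho> \<odot>\<^sub>m \<one> (obj H)) = \<rho> \<cdot> ((\<one> X \<odot>\<^sub>m mult H) \<cdot> a\<^sub>\<odot> X (obj H) (obj H))"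
    "\<rho> \<cdot> (\<one> X \<odot>\<^sub>m unit H) = r\<^sub>\<odot> X"
  using assms by (simp_all add: right_module_def hom_def)

text \<open>The cofree right comodule over the unit object on \<open>X\<close>; an element of
  \<open>X \<bullet> I\<close> is read as a loop in \<open>X\<close>.\<close>

definition coact_I :: "'o \<Rightarrow> 'm" where
  "coact_I X = inv (a\<^sub>\<bullet> X \<I> \<I>) \<cdot> (\<one> X \<bullet>\<^sub>m \<Delta>\<^sub>I)"

lemma coact_I_simps [simp]: "Dom C (coact_I X) = X \<bullet> \<I>" "Cod C (coact_I X) = X \<bullet> \<I> \<bullet> \<I>"
  by (simp_all add: coact_I_def)

lemma coact_I_natural: "Cod C f = X \<Longrightarrow> coact_I X \<cdot> (f \<bullet>\<^sub>m \<one> \<I>) = (f \<bullet>\<^sub>m \<one> \<I> \<bullet>\<^sub>m \<one> \<I>) \<cdot> coact_I (Dom C f)"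
  using bul.nat_ai'[of f X "\<one> \<I>" \<I> "\<one> \<I>" \<I> "\<one> (Dom C f) \<bullet>\<^sub>m \<Delta>\<^sub>I"]
  by (simp add: coact_I_def comp_assoc bul.merges)

text \<open>The Galois map \<open>(x, h) \<mapsto> (x h\<^sub>1, h\<^sub>2)\<close>; its inverse is \<open>(x, h) \<mapsto> (x h\<^sub>1\<^sup>-\<^sup>1, h\<^sub>2)\<close>.\<close>

definition beta :: "('o, 'm) bimonoid \<Rightarrow> 'o \<Rightarrow> 'm \<Rightarrow> 'm" where
  "beta H X \<rho> = (\<rho> \<bullet>\<^sub>m l\<^sub>\<odot> (obj H)) \<cdot> (\<zeta> X \<I> (obj H) (obj H) \<cdot> (\<one> (X \<bullet> \<I>) \<odot>\<^sub>m comult H))"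

lemma beta_simps [simp]:
  "is_bimonoid C H \<Longrightarrow> right_module H X \<rho> \<Longrightarrow> Dom C (beta H X \<rho>) = (X \<bullet> \<I>) \<odot> obj H"
  "is_bimonoid C H \<Longrightarrow> right_module H X \<rho> \<Longrightarrow> Cod C (beta H X \<rho>) = X \<bullet> obj H"
  by (simp_all add: beta_def right_moduleD)

end

context duoidal_category_with_reversion
begin

text \<open>The coaction is how \<open>gamma_loop\<close> knows that its first argument is a loop,
  so naturality is claimed for colinear \<open>f\<close>. Colinearity moves \<open>f\<close> past
  the coaction, and naturality of \<open>\<gamma>\<close> does the rest.\<close>

lemma gamma_loop_natural:
  assumes "Cod C c = Dom C c \<bullet> \<I>" "Cod C d = Dom C d \<bullet> \<I>" "Dom C f = Dom C c" "Cod C f = Dom C d"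
    and "d \<cdot> f = (f \<bullet>\<^sub>m \<one> \<I>) \<cdot> c"
  shows "gamma_loop d U \<cdot> ((f \<odot>\<^sub>m \<one> \<J>) \<bullet>\<^sub>m \<one> U) = (f \<odot>\<^sub>m \<one> U) \<cdot> gamma_loop c U"
proof -
  have "gamma_loop d U \<cdot> ((f \<odot>\<^sub>m \<one> \<J>) \<bullet>\<^sub>m \<one> U) = (\<one> (Dom C d) \<odot>\<^sub>m (l\<^sub>\<bullet> U \<cdot> (\<one> \<J> \<bullet>\<^sub>m l\<^sub>\<odot> U))) \<cdot> (\<gamma> (Dom C d) \<I> \<J> U \<cdot>
     ((((\<one> (Dom C d) \<bullet>\<^sub>m \<phi>0\<^sub>\<odot>) \<cdot> (d \<cdot> f)) \<odot>\<^sub>m \<one> \<J>) \<bullet>\<^sub>m \<one> U))"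
    using assms(1-4) by (simp add: gamma_loop_def comp_assoc bul.merges circ.merges)
  also have "(\<one> (Dom C d) \<bullet>\<^sub>m \<phi>0\<^sub>\<odot>) \<cdot> (d \<cdot> f) = (f \<bullet>\<^sub>m \<one> \<I>\<^sup>-) \<cdot> ((\<one> (Dom C c) \<bullet>\<^sub>m \<phi>0\<^sub>\<odot>) \<cdot> c)"
    unfolding assms(5) using assms(1-4) by (simp add: bul.merges)
  also have "\<gamma> (Dom C d) \<I> \<J> U \<cdot> (((\<dots>) \<odot>\<^sub>m \<one> \<J>) \<bullet>\<^sub>m \<one> U) = (f \<odot>\<^sub>m (\<one> \<J> \<bullet>\<^sub>m (\<one> \<I> \<odot>\<^sub>m \<one> U))) \<cdot> (\<gamma> (Dom C c) \<I> \<J> U \<cdot> ((((\<one> (Dom C c) \<bullet>\<^sub>m \<phi>0\<^sub>\<odot>) \<cdot> c) \<odot>\<^sub>m \<one> \<J>) \<bullet>\<^sub>m \<one> U))"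
    using assms(1-4) gamma_nat'[of f "Dom C d" "\<one> \<I>" \<I> "\<one> \<J>" \<J> "\<one> U" U "(((\<one> (Dom C c) \<bullet>\<^sub>m \<phi>0\<^sub>\<odot>) \<cdot> c) \<odot>\<^sub>m \<one> \<J>) \<bullet>\<^sub>m \<one> U"]
    by (simp add: circ.split_r bul.split_r)
  finally show ?thesis
    using assms(1-4) by (simp add: gamma_loop_def circ.merges)
qed

text \<open>In the unit comodule every loop is an identity, and composing with it only involves unit
  constraints; this is \<open>gamma_unit\<close> with \<open>J\<close> in the middle.\<close>

lemma gamma_loop_I: "gamma_loop \<Delta>\<^sub>I U = inv (l\<^sub>\<odot> U) \<cdot> (l\<^sub>\<bullet> U \<cdot> (l\<^sub>\<odot> \<J> \<bullet>\<^sub>m \<one> U))"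
proof -
  have "gamma_loop \<Delta>\<^sub>I U = (\<one> \<I> \<odot>\<^sub>m (l\<^sub>\<bullet> U \<cdot> (\<one> \<J> \<bullet>\<^sub>m l\<^sub>\<odot> U))) \<cdot> (\<gamma> \<I> \<I> \<J> U \<cdot> ((coact_rev_r \<odot>\<^sub>m \<one> \<J>) \<bullet>\<^sub>m \<one> U))"
    by (simp add: gamma_loop_def coact_rev_r_def)
  also have "\<dots> = inv (l\<^sub>\<odot> U) \<cdot> (l\<^sub>\<bullet> U \<cdot> (l\<^sub>\<odot> \<J> \<bullet>\<^sub>m \<one> U))"
    unfolding gamma_unit by (simp add: circ.merges comp_assoc bul.merges circ.nats)
  finally show ?thesis .
qed

end

section \<open>Invertibility of the Galois map\<close>

locale hopf = duoidal_category_with_reversion C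
  for C :: "('o, 'm, 'z) reversible_duoidal_scheme" (structure) +
  fixes H :: "('o, 'm) bimonoid" and S :: 'm
  assumes bimonoid [simp]: "is_bimonoid C H"
    and antipode: "is_antipode C H S"
begin

lemma S_simps [simp]: "Dom C S = obj H" "Cod C S = (obj H)\<^sup>-"
  using antipode by (simp_all add: is_antipode_def hom_def)

lemma antipode_right:
  "((mult H \<bullet>\<^sub>m \<one> \<I>) \<odot>\<^sub>m \<one> \<J>) \<cdot> (varphi C (obj H) (obj H) \<cdot> ((\<one> (obj H) \<bullet>\<^sub>m S) \<cdot> comult H))
     = (((unit H \<bullet>\<^sub>m \<one> \<I>) \<cdot> \<Delta>\<^sub>I) \<odot>\<^sub>m \<one> \<J>) \<cdot> (inv (l\<^sub>\<odot> \<J>) \<cdot> counit H)"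
  using antipode by (simp add: is_antipode_def comp_assoc circ.split_r)

lemma antipode_left:
  "(\<one> \<J> \<odot>\<^sub>m (\<one> \<I> \<bullet>\<^sub>m mult H)) \<cdot> (psi C (obj H) (obj H) \<cdot> ((S \<bullet>\<^sub>m \<one> (obj H)) \<cdot> comult H))
     = (\<one> \<J> \<odot>\<^sub>m (\<one> \<I> \<bullet>\<^sub>m unit H)) \<cdot> ((\<one> \<J> \<odot>\<^sub>m \<Delta>\<^sub>I) \<cdot> (inv (r\<^sub>\<odot> \<J>) \<cdot> counit H))"
  using antipode by (simp add: is_antipode_def comp_assoc)

text \<open>In terms of arrows, \<open>(x, (h, u)) \<mapsto> (x h^-1, u)\<close>;
  \<open>beta_inv\<close> takes a second copy of \<open>h\<close> for \<open>u\<close>. Leaving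
  \<open>U\<close> free also gives access to \<open>J\<close> and to the unit as last
  factor.\<close>

definition Omega :: "'o \<Rightarrow> 'm \<Rightarrow> 'o \<Rightarrow> 'm" where
  "Omega X \<rho> U = ((\<rho> \<bullet>\<^sub>m \<one> \<I>) \<odot>\<^sub>m \<one> U) \<cdot> (varphi_ext X (obj H) U \<cdot> (\<one> X \<bullet>\<^sub>m (S \<bullet>\<^sub>m \<one> U)))"

definition beta_inv :: "'o \<Rightarrow> 'm \<Rightarrow> 'm" where
  "beta_inv X \<rho> = Omega X \<rho> (obj H) \<cdot> (\<one> X \<bullet>\<^sub>m comult H)"

lemma Omega_simps [simp]:
  "right_module H X \<rho> \<Longrightarrow> Dom C (Omega X \<rho> U) = X \<bullet> (obj H \<bullet> U)"
  "right_module H X \<rho> \<Longrightarrow> Cod C (Omega X \<rho> U) = (X \<bullet> \<I>) \<odot> U"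
  "right_module H X \<rho> \<Longrightarrow> Dom C (beta_inv X \<rho>) = X \<bullet> obj H"
  "right_module H X \<rho> \<Longrightarrow> Cod C (beta_inv X \<rho>) = (X \<bullet> \<I>) \<odot> obj H"
  by (simp_all add: Omega_def beta_inv_def right_moduleD)

lemma Omega_natural:
  assumes "right_module H X \<rho>" "Cod C f = U"
  shows "Omega X \<rho> U \<cdot> (\<one> X \<bullet>\<^sub>m (\<one> (obj H) \<bullet>\<^sub>m f)) = (\<one> (X \<bullet> \<I>) \<odot>\<^sub>m f) \<cdot> Omega X \<rho> (Dom C f)"
proof -
  have "Omega X \<rho> U \<cdot> (\<one> X \<bullet>\<^sub>m (\<one> (obj H) \<bullet>\<^sub>m f)) = ((\<rho> \<bullet>\<^sub>m \<one> \<I>) \<odot>\<^sub>m \<one> U) \<cdot> (varphi_ext X (obj H) U \<cdot> (\<one> X \<bullet>\<^sub>m (\<one> (obj H)\<^sup>- \<bullet>\<^sub>m f)) \<cdot> (\<one> X \<bullet>\<^sub>m (S \<bullet>\<^sub>m \<one> (Dom C f))))"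
    using assms right_moduleD(1,2)[OF assms(1)] by (simp add: Omega_def comp_assoc bul.merges)
  also have "varphi_ext X (obj H) U \<cdot> (\<one> X \<bullet>\<^sub>m (\<one> (obj H)\<^sup>- \<bullet>\<^sub>m f)) = (\<one> ((X \<odot> obj H) \<bullet> \<I>) \<odot>\<^sub>m f) \<cdot> varphi_ext X (obj H) (Dom C f)"
    using varphi_ext_natural[of "\<one> X" X "\<one> (obj H)" "obj H" f U] assms(2) by simp
  finally show ?thesis
    using assms right_moduleD(1,2)[OF assms(1)] by (simp add: Omega_def comp_assoc circ.merges)
qed

lemma counit_contract:
  "((r\<^sub>\<bullet> X \<cdot> (\<one> X \<bullet>\<^sub>m counit H)) \<bullet>\<^sub>m \<one> (obj H)) \<cdot> (inv (a\<^sub>\<bullet> X (obj H) (obj H)) \<cdot> (\<one> X \<bullet>\<^sub>m comult H)) = \<one> (X \<bullet> obj H)"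
proof -
  have "((r\<^sub>\<bullet> X \<cdot> (\<one> X \<bullet>\<^sub>m counit H)) \<bullet>\<^sub>m \<one> (obj H)) \<cdot> (inv (a\<^sub>\<bullet> X (obj H) (obj H)) \<cdot> (\<one> X \<bullet>\<^sub>m comult H))
    = (r\<^sub>\<bullet> X \<bullet>\<^sub>m \<one> (obj H)) \<cdot> ((\<one> X \<bullet>\<^sub>m counit H \<bullet>\<^sub>m \<one> (obj H)) \<cdot> (inv (a\<^sub>\<bullet> X (obj H) (obj H)) \<cdot> (\<one> X \<bullet>\<^sub>m comult H)))"
    by (simp add: bul.merges)
  also have "\<dots> = (r\<^sub>\<bullet> X \<bullet>\<^sub>m \<one> (obj H)) \<cdot> (inv (a\<^sub>\<bullet> X \<J> (obj H)) \<cdot> ((\<one> X \<bullet>\<^sub>m (counit H \<bullet>\<^sub>m \<one> (obj H))) \<cdot> (\<one> X \<bullet>\<^sub>m comult H)))"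
    using bul.nat_ai'[of "\<one> X" X "counit H" \<J> "\<one> (obj H)" "obj H" "\<one> X \<bullet>\<^sub>m comult H"] by simp
  also have "\<dots> = \<one> (X \<bullet> obj H)"
    by (simp add: comp_reduce[OF bul.triangle'] bul.merges lcounit)
  finally show ?thesis .
qed

text \<open>The composite sends \<open>(x, h)\<close> to \<open>((x h1^-1) h2, h3)\<close>.
  Rebracketed as \<open>x (h1^-1 h2)\<close>, the first entry collapses by the left antipode
  identity, and a counit law finishes.\<close>

lemma beta_beta_inv:
  assumes mod: "right_module H X \<rho>"
  shows "beta H X \<rho> \<cdot> beta_inv X \<rho> = \<one> (X \<bullet> obj H)"
proof -
  note [simp] = right_moduleD(1,2)[OF mod]
  let ?H = "obj H" let ?\<Delta> = "comult H"
  let ?e = "r\<^sub>\<bullet> (X \<odot> ?H) \<cdot> (\<one> (X \<odot> ?H) \<bullet>\<^sub>m \<epsilon>\<^sub>I)"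
  let ?V = "(S \<bullet>\<^sub>m \<one> ?H) \<cdot> ?\<Delta>"
  let ?D = "(S \<bullet>\<^sub>m ?\<Delta>) \<cdot> ?\<Delta>"
  have "beta H X \<rho> \<cdot> beta_inv X \<rho> = (\<rho> \<bullet>\<^sub>m l\<^sub>\<odot> ?H) \<cdot> (\<zeta> X \<I> ?H ?H \<cdot> (((\<rho> \<bullet>\<^sub>m \<one> \<I>) \<odot>\<^sub>m \<one> (?H \<bullet> ?H)) \<cdot> ((\<one> ((X \<odot> ?H) \<bullet> \<I>) \<odot>\<^sub>m ?\<Delta>) \<cdot> varphi_ext X ?H ?H \<cdot> ((\<one> X \<bullet>\<^sub>m (S \<bullet>\<^sub>m \<one> ?H)) \<cdot> (\<one> X \<bullet>\<^sub>m ?\<Delta>)))))"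
    by (simp add: beta_def beta_inv_def Omega_def comp_assoc circ.merges)
  also have "(\<one> ((X \<odot> ?H) \<bullet> \<I>) \<odot>\<^sub>m ?\<Delta>) \<cdot> varphi_ext X ?H ?H = varphi_ext X ?H (?H \<bullet> ?H) \<cdot> (\<one> X \<bullet>\<^sub>m (\<one> ?H\<^sup>- \<bullet>\<^sub>m ?\<Delta>))"
    using varphi_ext_natural[of "\<one> X" X "\<one> ?H" ?H ?\<Delta>] by simp
  also have "\<zeta> X \<I> ?H ?H \<cdot> (((\<rho> \<bullet>\<^sub>m \<one> \<I>) \<odot>\<^sub>m \<one> (?H \<bullet> ?H)) \<cdot> (varphi_ext X ?H (?H \<bullet> ?H) \<cdot> (\<one> X \<bullet>\<^sub>m (\<one> ?H\<^sup>- \<bullet>\<^sub>m ?\<Delta>)) \<cdot> ((\<one> X \<bullet>\<^sub>m (S \<bullet>\<^sub>m \<one> ?H)) \<cdot> (\<one> X \<bullet>\<^sub>m ?\<Delta>))))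
     = ((\<rho> \<odot>\<^sub>m \<one> ?H) \<bullet>\<^sub>m \<one> (\<I> \<odot> ?H)) \<cdot> (\<zeta> (X \<odot> ?H) \<I> ?H ?H \<cdot> varphi_ext X ?H (?H \<bullet> ?H) \<cdot> (\<one> X \<bullet>\<^sub>m ?D))"
    using nat_zeta'[of \<rho> X "\<one> \<I>" \<I> "\<one> ?H" ?H "\<one> ?H" ?H "varphi_ext X ?H (?H \<bullet> ?H) \<cdot> (\<one> X \<bullet>\<^sub>m ?D)"]
    by (simp add: comp_assoc bul.merges)
  \<comment> \<open>\<open>zeta_varphi_ext\<close> frees \<open>h3\<close>, so that the rest happens
    in the left tensor factor.\<close>
  also have "\<dots> = ((\<rho> \<odot>\<^sub>m \<one> ?H) \<bullet>\<^sub>m \<one> (\<I> \<odot> ?H)) \<cdot> ((((?e \<odot>\<^sub>m \<one> ?H) \<cdot> varphi_ext X ?H ?H) \<bullet>\<^sub>m inv (l\<^sub>\<odot> ?H))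
       \<cdot> (inv (a\<^sub>\<bullet> X (?H\<^sup>- \<bullet> ?H) ?H) \<cdot> (\<one> X \<bullet>\<^sub>m (inv (a\<^sub>\<bullet> ?H\<^sup>- ?H ?H) \<cdot> ?D))))"
    unfolding zeta_varphi_ext by (simp add: comp_assoc bul.merges)
  also have "inv (a\<^sub>\<bullet> ?H\<^sup>- ?H ?H) \<cdot> ?D = (?V \<bullet>\<^sub>m \<one> ?H) \<cdot> ?\<Delta>"
  proof -
    have "inv (a\<^sub>\<bullet> ?H\<^sup>- ?H ?H) \<cdot> ?D = inv (a\<^sub>\<bullet> ?H\<^sup>- ?H ?H) \<cdot> ((S \<bullet>\<^sub>m (\<one> ?H \<bullet>\<^sub>m \<one> ?H)) \<cdot> ((\<one> ?H \<bullet>\<^sub>m ?\<Delta>) \<cdot> ?\<Delta>))"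
      by (simp add: bul.merges)
    also have "\<dots> = ((S \<bullet>\<^sub>m \<one> ?H) \<bullet>\<^sub>m \<one> ?H) \<cdot> (inv (a\<^sub>\<bullet> ?H ?H ?H) \<cdot> ((\<one> ?H \<bullet>\<^sub>m ?\<Delta>) \<cdot> ?\<Delta>))"
      using bul.nat_ai'[of S "?H\<^sup>-" "\<one> ?H" ?H "\<one> ?H" ?H "(\<one> ?H \<bullet>\<^sub>m ?\<Delta>) \<cdot> ?\<Delta>"] by simp
    finally show ?thesis by (simp add: coassoc' bul.merges)
  qed
  also have "inv (a\<^sub>\<bullet> X (?H\<^sup>- \<bullet> ?H) ?H) \<cdot> (\<one> X \<bullet>\<^sub>m \<dots>) = ((\<one> X \<bullet>\<^sub>m ?V) \<bullet>\<^sub>m \<one> ?H) \<cdot> (inv (a\<^sub>\<bullet> X ?H ?H) \<cdot> (\<one> X \<bullet>\<^sub>m ?\<Delta>))"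
    using bul.nat_ai'[of "\<one> X" X "(S \<bullet>\<^sub>m \<one> ?H) \<cdot> ?\<Delta>" "?H\<^sup>- \<bullet> ?H" "\<one> ?H" ?H "\<one> X \<bullet>\<^sub>m ?\<Delta>"] by (simp add: bul.split_l)
  finally have "beta H X \<rho> \<cdot> beta_inv X \<rho> =
      ((\<rho> \<cdot> (\<rho> \<odot>\<^sub>m \<one> ?H) \<cdot> ((?e \<odot>\<^sub>m \<one> ?H) \<cdot> varphi_ext X ?H ?H \<cdot> (\<one> X \<bullet>\<^sub>m ?V))) \<bullet>\<^sub>m \<one> ?H) \<cdot> (inv (a\<^sub>\<bullet> X ?H ?H) \<cdot> (\<one> X \<bullet>\<^sub>m ?\<Delta>))"
    by (simp add: bul.merges comp_assoc)
  \<comment> \<open>Associativity of the action and \<open>varphi_ext_psi\<close> together turn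
    \<open>(x h1^-1) h2\<close> into \<open>x (h1^-1 h2)\<close>.\<close>
  also have "\<rho> \<cdot> (\<rho> \<odot>\<^sub>m \<one> ?H) \<cdot> ((?e \<odot>\<^sub>m \<one> ?H) \<cdot> varphi_ext X ?H ?H \<cdot> (\<one> X \<bullet>\<^sub>m ?V))
     = \<rho> \<cdot> ((\<one> X \<odot>\<^sub>m mult H) \<cdot> delta_loop X (?H \<odot> ?H) \<cdot> (\<one> X \<bullet>\<^sub>m (psi C ?H ?H \<cdot> ?V)))"
    unfolding right_moduleD(3)[OF mod] varphi_ext_psi by (simp add: comp_assoc bul.merges)
  also have "(\<one> X \<odot>\<^sub>m mult H) \<cdot> delta_loop X (?H \<odot> ?H) = delta_loop X ?H \<cdot> (\<one> X \<bullet>\<^sub>m (\<one> \<J> \<odot>\<^sub>m (\<one> \<I> \<bullet>\<^sub>m mult H)))"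
    using delta_loop_natural[of "mult H"] by simp
  also have "\<rho> \<cdot> (\<dots> \<cdot> (\<one> X \<bullet>\<^sub>m (psi C ?H ?H \<cdot> ?V)))
     = \<rho> \<cdot> (delta_loop X ?H \<cdot> (\<one> X \<bullet>\<^sub>m ((\<one> \<J> \<odot>\<^sub>m (\<one> \<I> \<bullet>\<^sub>m mult H)) \<cdot> (psi C ?H ?H \<cdot> ?V))))"
    by (simp add: comp_assoc bul.merges)
  also have "\<dots> = \<rho> \<cdot> (delta_loop X ?H \<cdot> (\<one> X \<bullet>\<^sub>m (\<one> \<J> \<odot>\<^sub>m (\<one> \<I> \<bullet>\<^sub>m unit H))) \<cdot> (\<one> X \<bullet>\<^sub>m ((\<one> \<J> \<odot>\<^sub>m \<Delta>\<^sub>I) \<cdot> inv (r\<^sub>\<odot> \<J>)) \<cdot> (\<one> X \<bullet>\<^sub>m counit H)))"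
    unfolding antipode_left by (simp add: comp_assoc bul.merges)
  also have "delta_loop X ?H \<cdot> (\<one> X \<bullet>\<^sub>m (\<one> \<J> \<odot>\<^sub>m (\<one> \<I> \<bullet>\<^sub>m unit H))) = (\<one> X \<odot>\<^sub>m unit H) \<cdot> delta_loop X \<I>"
    using delta_loop_natural[of "unit H"] by simp
  also have "\<rho> \<cdot> (\<dots> \<cdot> (\<one> X \<bullet>\<^sub>m ((\<one> \<J> \<odot>\<^sub>m \<Delta>\<^sub>I) \<cdot> inv (r\<^sub>\<odot> \<J>)) \<cdot> (\<one> X \<bullet>\<^sub>m counit H)))
     = (\<rho> \<cdot> (\<one> X \<odot>\<^sub>m unit H)) \<cdot> (delta_loop X \<I> \<cdot> (\<one> X \<bullet>\<^sub>m ((\<one> \<J> \<odot>\<^sub>m \<Delta>\<^sub>I) \<cdot> inv (r\<^sub>\<odot> \<J>)))) \<cdot> (\<one> X \<bullet>\<^sub>m counit H)"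
    by (simp add: comp_assoc)
  also have "\<dots> = r\<^sub>\<bullet> X \<cdot> (\<one> X \<bullet>\<^sub>m counit H)"
    unfolding right_moduleD(4)[OF mod] delta_loop_unit ..
  finally show ?thesis by (simp add: counit_contract)
qed

text \<open>The right antipode identity \<open>h1 h2^-1 = 1\<close> with a third copy
  \<open>h3\<close> carried along: \<open>varphi_ext_gamma_loop\<close> reduces to the case where
  that copy is forgotten in \<open>J\<close>, and \<open>gamma_loop_I\<close> recovers it.\<close>

lemma varphi_ext_comult:
  "((mult H \<bullet>\<^sub>m \<one> \<I>) \<odot>\<^sub>m \<one> (obj H)) \<cdot> (varphi_ext (obj H) (obj H) (obj H) \<cdot> ((\<one> (obj H) \<bullet>\<^sub>m ((S \<bullet>\<^sub>m \<one> (obj H)) \<cdot> comult H)) \<cdot> comult H))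
     = (((unit H \<bullet>\<^sub>m \<one> \<I>) \<cdot> \<Delta>\<^sub>I) \<odot>\<^sub>m \<one> (obj H)) \<cdot> inv (l\<^sub>\<odot> (obj H))"
proof -
  let ?H = "obj H" let ?\<Delta> = "comult H"
  let ?u = "(unit H \<bullet>\<^sub>m \<one> \<I>) \<cdot> \<Delta>\<^sub>I"
  let ?S = "(\<one> ?H \<bullet>\<^sub>m S) \<cdot> ?\<Delta>"
  let ?m = "mult H \<bullet>\<^sub>m \<one> \<I>"
  let ?V = "(S \<bullet>\<^sub>m \<one> ?H) \<cdot> ?\<Delta>"
  let ?e = "inv (l\<^sub>\<odot> \<J>) \<cdot> counit H"
  have "(\<one> ?H \<bullet>\<^sub>m ?V) \<cdot> ?\<Delta> = (\<one> ?H \<bullet>\<^sub>m (S \<bullet>\<^sub>m \<one> ?H)) \<cdot> (a\<^sub>\<bullet> ?H ?H ?H \<cdot> ((?\<Delta> \<bullet>\<^sub>m \<one> ?H) \<cdot> ?\<Delta>))"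
    unfolding coassoc[OF bimonoid] by (simp add: bul.merges)
  also have "\<dots> = a\<^sub>\<bullet> ?H ?H\<^sup>- ?H \<cdot> ((?S \<bullet>\<^sub>m \<one> ?H) \<cdot> ?\<Delta>)"
    using bul.nat_a'[of "\<one> ?H" ?H S "?H\<^sup>-" "\<one> ?H" ?H "(?\<Delta> \<bullet>\<^sub>m \<one> ?H) \<cdot> ?\<Delta>"] by (simp add: bul.merges)
  finally have "(?m \<odot>\<^sub>m \<one> ?H) \<cdot> (varphi_ext ?H ?H ?H \<cdot> ((\<one> ?H \<bullet>\<^sub>m ?V) \<cdot> ?\<Delta>))
    = (?m \<odot>\<^sub>m \<one> ?H) \<cdot> (varphi_ext ?H ?H ?H \<cdot> a\<^sub>\<bullet> ?H ?H\<^sup>- ?H \<cdot> ((?S \<bullet>\<^sub>m \<one> ?H) \<cdot> ?\<Delta>))"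
    by (simp add: comp_assoc)
  also have "\<dots> = (?m \<odot>\<^sub>m \<one> ?H) \<cdot> gamma_loop (coact_I (?H \<odot> ?H)) ?H \<cdot> (((varphi C ?H ?H \<cdot> ?S) \<bullet>\<^sub>m \<one> ?H) \<cdot> ?\<Delta>)"
    unfolding varphi_ext_gamma_loop by (simp add: comp_assoc bul.merges coact_I_def)
  also have "(?m \<odot>\<^sub>m \<one> ?H) \<cdot> gamma_loop (coact_I (?H \<odot> ?H)) ?H = gamma_loop (coact_I ?H) ?H \<cdot> ((?m \<odot>\<^sub>m \<one> \<J>) \<bullet>\<^sub>m \<one> ?H)"
    by (rule gamma_loop_natural[symmetric]) (simp_all add: coact_I_natural)
  also have "\<dots> \<cdot> (((varphi C ?H ?H \<cdot> ?S) \<bullet>\<^sub>m \<one> ?H) \<cdot> ?\<Delta>)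
     = gamma_loop (coact_I ?H) ?H \<cdot> ((((?m \<odot>\<^sub>m \<one> \<J>) \<cdot> (varphi C ?H ?H \<cdot> ?S)) \<bullet>\<^sub>m \<one> ?H) \<cdot> ?\<Delta>)"
    by (simp add: comp_assoc bul.merges)
  also have "\<dots> = gamma_loop (coact_I ?H) ?H \<cdot> ((?u \<odot>\<^sub>m \<one> \<J>) \<bullet>\<^sub>m \<one> ?H) \<cdot> ((?e \<bullet>\<^sub>m \<one> ?H) \<cdot> ?\<Delta>)"
    unfolding antipode_right by (simp add: comp_assoc bul.merges)
  \<comment> \<open>The unit of \<open>H\<close>, with its base point, is colinear by
    coassociativity of the unit object; so \<open>gamma_loop\<close> may be evaluated on the unit
    comodule.\<close>
  also have "gamma_loop (coact_I ?H) ?H \<cdot> ((?u \<odot>\<^sub>m \<one> \<J>) \<bullet>\<^sub>m \<one> ?H) = (?u \<odot>\<^sub>m \<one> ?H) \<cdot> gamma_loop \<Delta>\<^sub>I ?H"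
  proof (rule gamma_loop_natural)
    have "coact_I ?H \<cdot> ?u = (unit H \<bullet>\<^sub>m \<one> \<I> \<bullet>\<^sub>m \<one> \<I>) \<cdot> (inv (a\<^sub>\<bullet> \<I> \<I> \<I>) \<cdot> ((\<one> \<I> \<bullet>\<^sub>m \<Delta>\<^sub>I) \<cdot> \<Delta>\<^sub>I))"
      by (simp add: comp_reduce[OF coact_I_natural] comp_assoc) (simp add: coact_I_def comp_assoc)
    also have "\<dots> = (?u \<bullet>\<^sub>m \<one> \<I>) \<cdot> \<Delta>\<^sub>I"
      unfolding I_coassoc[symmetric] by (simp add: bul.merges)
    finally show "coact_I ?H \<cdot> ?u = (?u \<bullet>\<^sub>m \<one> \<I>) \<cdot> \<Delta>\<^sub>I" .
  qed simp_all
  also have "(?u \<odot>\<^sub>m \<one> ?H) \<cdot> gamma_loop \<Delta>\<^sub>I ?H \<cdot> ((?e \<bullet>\<^sub>m \<one> ?H) \<cdot> ?\<Delta>)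
     = (?u \<odot>\<^sub>m \<one> ?H) \<cdot> inv (l\<^sub>\<odot> ?H)"
    unfolding gamma_loop_I by (simp add: comp_assoc bul.merges lcounit)
  finally show ?thesis .
qed

text \<open>The composite sends \<open>(x, h)\<close> to \<open>((x h1) h2^-1, h3)\<close>; after
  rebracketing as \<open>x (h1 h2^-1)\<close>, \<open>varphi_ext_comult\<close> applies.\<close>

lemma beta_inv_beta:
  assumes mod: "right_module H X \<rho>"
  shows "beta_inv X \<rho> \<cdot> beta H X \<rho> = \<one> ((X \<bullet> \<I>) \<odot> obj H)"
proof -
  note [simp] = right_moduleD(1,2)[OF mod]
  let ?H = "obj H" let ?\<Delta> = "comult H"
  let ?V = "(S \<bullet>\<^sub>m \<one> ?H) \<cdot> ?\<Delta>"
  let ?z = "\<zeta> X \<I> ?H ?H \<cdot> (\<one> (X \<bullet> \<I>) \<odot>\<^sub>m ?\<Delta>)"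
  let ?D = "(\<one> ?H \<bullet>\<^sub>m ?V) \<cdot> ?\<Delta>"
  let ?w = "varphi_ext ?H ?H ?H \<cdot> ?D"
  have "beta_inv X \<rho> \<cdot> beta H X \<rho> = ((\<rho> \<bullet>\<^sub>m \<one> \<I>) \<odot>\<^sub>m \<one> ?H) \<cdot> (\<delta> X \<I> ?H ?H \<cdot> ((\<rho> \<bullet>\<^sub>m (inv (l\<^sub>\<odot> (?H\<^sup>- \<bullet> ?H)) \<cdot> (?V \<cdot> l\<^sub>\<odot> ?H))) \<cdot> ?z))"
    by (simp add: beta_def beta_inv_def Omega_def varphi_ext_def comp_assoc bul.merges)
  also have "inv (l\<^sub>\<odot> (?H\<^sup>- \<bullet> ?H)) \<cdot> (?V \<cdot> l\<^sub>\<odot> ?H) = \<one> \<I> \<odot>\<^sub>m ?V"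
  proof -
    have "?V \<cdot> l\<^sub>\<odot> ?H = l\<^sub>\<odot> (?H\<^sup>- \<bullet> ?H) \<cdot> (\<one> \<I> \<odot>\<^sub>m ?V)" by (simp add: circ.nat_l)
    then show ?thesis by simp
  qed
  also have "\<delta> X \<I> ?H ?H \<cdot> ((\<rho> \<bullet>\<^sub>m (\<one> \<I> \<odot>\<^sub>m ?V)) \<cdot> ?z)
     = (((\<rho> \<odot>\<^sub>m \<one> ?H) \<bullet>\<^sub>m \<one> \<I>) \<odot>\<^sub>m \<one> ?H) \<cdot> (\<delta> (X \<odot> ?H) \<I> ?H ?H \<cdot> ((\<one> (X \<odot> ?H) \<bullet>\<^sub>m (\<one> \<I> \<odot>\<^sub>m ?V)) \<cdot> ?z))"
    using delta_nat'[of \<rho> X "\<one> \<I>" \<I> "\<one> ?H" ?H "\<one> ?H" ?H "(\<one> (X \<odot> ?H) \<bullet>\<^sub>m (\<one> \<I> \<odot>\<^sub>m ?V)) \<cdot> ?z"]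
    by (simp add: bul.merges)
  also have "(\<one> (X \<odot> ?H) \<bullet>\<^sub>m (\<one> \<I> \<odot>\<^sub>m ?V)) \<cdot> ?z
     = \<zeta> X \<I> ?H (?H\<^sup>- \<bullet> ?H) \<cdot> (\<one> (X \<bullet> \<I>) \<odot>\<^sub>m ?D)"
    using nat_zeta'[of "\<one> X" X "\<one> \<I>" \<I> "\<one> ?H" ?H ?V "?H\<^sup>- \<bullet> ?H" "\<one> (X \<bullet> \<I>) \<odot>\<^sub>m ?\<Delta>"]
    by (simp add: circ.merges)
  finally have "beta_inv X \<rho> \<cdot> beta H X \<rho> = (((\<rho> \<cdot> (\<rho> \<odot>\<^sub>m \<one> ?H)) \<bullet>\<^sub>m \<one> \<I>) \<odot>\<^sub>m \<one> ?H) \<cdot> (\<delta> (X \<odot> ?H) \<I> ?H ?H \<cdot> \<zeta> X \<I> ?H (?H\<^sup>- \<bullet> ?H) \<cdot> (\<one> (X \<bullet> \<I>) \<odot>\<^sub>m ?D))"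
    by (simp add: comp_assoc circ.merges bul.merges)
  \<comment> \<open>\<open>delta_zeta\<close> moves \<open>x\<close> out of the division, and the
    module law replaces the two actions by one multiplication in \<open>H\<close>.\<close>
  also have "\<dots> = ((((\<rho> \<cdot> (\<one> X \<odot>\<^sub>m mult H)) \<bullet>\<^sub>m r\<^sub>\<odot> \<I>) \<cdot> \<zeta> X \<I> (?H \<odot> ?H) \<I>) \<odot>\<^sub>m \<one> ?H)
       \<cdot> (inv (a\<^sub>\<odot> (X \<bullet> \<I>) ((?H \<odot> ?H) \<bullet> \<I>) ?H) \<cdot> (\<one> (X \<bullet> \<I>) \<odot>\<^sub>m ?w))"
    unfolding delta_zeta right_moduleD(3)[OF mod] by (simp add: comp_assoc circ.merges bul.merges)
  also have "((\<rho> \<cdot> (\<one> X \<odot>\<^sub>m mult H)) \<bullet>\<^sub>m r\<^sub>\<odot> \<I>) \<cdot> \<zeta> X \<I> (?H \<odot> ?H) \<I> = (\<rho> \<bullet>\<^sub>m r\<^sub>\<odot> \<I>) \<cdot> (\<zeta> X \<I> ?H \<I> \<cdot> (\<one> (X \<bullet> \<I>) \<odot>\<^sub>m (mult H \<bullet>\<^sub>m \<one> \<I>)))"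
    using nat_zeta[of "\<one> X" X "\<one> \<I>" \<I> "mult H" ?H "\<one> \<I>" \<I>] by (simp add: bul.merges)
  also have "(\<dots> \<odot>\<^sub>m \<one> ?H) \<cdot> (inv (a\<^sub>\<odot> (X \<bullet> \<I>) ((?H \<odot> ?H) \<bullet> \<I>) ?H) \<cdot> (\<one> (X \<bullet> \<I>) \<odot>\<^sub>m ?w))
     = (((\<rho> \<bullet>\<^sub>m r\<^sub>\<odot> \<I>) \<cdot> \<zeta> X \<I> ?H \<I>) \<odot>\<^sub>m \<one> ?H) \<cdot> (inv (a\<^sub>\<odot> (X \<bullet> \<I>) (?H \<bullet> \<I>) ?H) \<cdot> (\<one> (X \<bullet> \<I>) \<odot>\<^sub>m (((mult H \<bullet>\<^sub>m \<one> \<I>) \<odot>\<^sub>m \<one> ?H) \<cdot> ?w)))"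
    using circ.nat_ai'[of "\<one> (X \<bullet> \<I>)" "X \<bullet> \<I>" "mult H \<bullet>\<^sub>m \<one> \<I>" "?H \<bullet> \<I>" "\<one> ?H" ?H "\<one> (X \<bullet> \<I>) \<odot>\<^sub>m ?w"]
    by (simp add: circ.split_r comp_assoc circ.merge[of "\<one> (X \<bullet> \<I>)" "\<one> (X \<bullet> \<I>)"])
  also have "\<dots> = (((\<rho> \<bullet>\<^sub>m r\<^sub>\<odot> \<I>) \<cdot> \<zeta> X \<I> ?H \<I>) \<odot>\<^sub>m \<one> ?H) \<cdot> (inv (a\<^sub>\<odot> (X \<bullet> \<I>) (?H \<bullet> \<I>) ?H) \<cdot> ((\<one> (X \<bullet> \<I>) \<odot>\<^sub>m (((unit H \<bullet>\<^sub>m \<one> \<I>) \<cdot> \<Delta>\<^sub>I) \<odot>\<^sub>m \<one> ?H)) \<cdot> (\<one> (X \<bullet> \<I>) \<odot>\<^sub>m inv (l\<^sub>\<odot> ?H))))"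
    unfolding varphi_ext_comult by (simp add: circ.merges)
  \<comment> \<open>With \<open>h1 h2^-1\<close> replaced by the unit, the associator contracts with
    the inverse unit constraint of \<open>H\<close>; what is left concerns only the first
    factor.\<close>
  also have "\<dots> = (((\<rho> \<bullet>\<^sub>m r\<^sub>\<odot> \<I>) \<cdot> (\<zeta> X \<I> ?H \<I> \<cdot> ((\<one> (X \<bullet> \<I>) \<odot>\<^sub>m (unit H \<bullet>\<^sub>m \<one> \<I>)) \<cdot> ((\<one> (X \<bullet> \<I>) \<odot>\<^sub>m \<Delta>\<^sub>I) \<cdot> inv (r\<^sub>\<odot> (X \<bullet> \<I>)))))) \<odot>\<^sub>m \<one> ?H)"
    using circ.nat_ai'[of "\<one> (X \<bullet> \<I>)" "X \<bullet> \<I>" "(unit H \<bullet>\<^sub>m \<one> \<I>) \<cdot> \<Delta>\<^sub>I" "?H \<bullet> \<I>" "\<one> ?H" ?H "\<one> (X \<bullet> \<I>) \<odot>\<^sub>m inv (l\<^sub>\<odot> ?H)"]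
    by (simp add: circ.triangle_inv' circ.split_r comp_assoc) (simp add: circ.merges)
  also have "\<zeta> X \<I> ?H \<I> \<cdot> ((\<one> (X \<bullet> \<I>) \<odot>\<^sub>m (unit H \<bullet>\<^sub>m \<one> \<I>)) \<cdot> ((\<one> (X \<bullet> \<I>) \<odot>\<^sub>m \<Delta>\<^sub>I) \<cdot> inv (r\<^sub>\<odot> (X \<bullet> \<I>)))) = ((\<one> X \<odot>\<^sub>m unit H) \<cdot> inv (r\<^sub>\<odot> X)) \<bullet>\<^sub>m inv (r\<^sub>\<odot> \<I>)"
    using nat_zeta'[of "\<one> X" X "\<one> \<I>" \<I> "unit H" ?H "\<one> \<I>" \<I> "(\<one> (X \<bullet> \<I>) \<odot>\<^sub>m \<Delta>\<^sub>I) \<cdot> inv (r\<^sub>\<odot> (X \<bullet> \<I>))"]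
    by (simp add: zeta_runit_inv bul.merges)
  finally show ?thesis
    by (simp add: bul.merges comp_reduce[OF right_moduleD(4)[OF mod]])
qed

end

section \<open>Cofree comodules, diagonal modules and naturality of the Galois map\<close>

context monoidal_category
begin

text \<open>Here \<open>varphi_ext\<close> is a fourth object variable, unrelated to the morphism of
  that name, which lives in another locale.\<close>

lemma pentagon_inv:
  "inv (tassoc T (X \<otimes> Y) Z varphi_ext) \<cdot> inv (tassoc T X Y (Z \<otimes> varphi_ext))
     = (inv (tassoc T X Y Z) \<otimes>\<^sub>m \<one> varphi_ext) \<cdot> (inv (tassoc T X (Y \<otimes> Z) varphi_ext) \<cdot> (\<one> X \<otimes>\<^sub>m inv (tassoc T Y Z varphi_ext)))"
proof -
  let ?b = "(inv (tassoc T X Y Z) \<otimes>\<^sub>m \<one> varphi_ext) \<cdot> (inv (tassoc T X (Y \<otimes> Z) varphi_ext) \<cdot> (\<one> X \<otimes>\<^sub>m inv (tassoc T Y Z varphi_ext)))"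
  let ?c = "inv (tassoc T (X \<otimes> Y) Z varphi_ext) \<cdot> inv (tassoc T X Y (Z \<otimes> varphi_ext))"
  have "?c = ?c \<cdot> ((\<one> X \<otimes>\<^sub>m tassoc T Y Z varphi_ext) \<cdot> tassoc T X (Y \<otimes> Z) varphi_ext \<cdot> (tassoc T X Y Z \<otimes>\<^sub>m \<one> varphi_ext) \<cdot> ?b)"
    by (simp add: comp_assoc merges)
  also have "\<dots> = ?b"
    unfolding pentagon[symmetric] by (simp add: comp_assoc)
  finally show ?thesis .
qed

end

context duoidal_category
begin

lemma coact_I_coassoc: "coact_I (X \<bullet> \<I>) \<cdot> coact_I X = (coact_I X \<bullet>\<^sub>m \<one> \<I>) \<cdot> coact_I X"
proof -
  have "coact_I (X \<bullet> \<I>) \<cdot> coact_I X = inv (a\<^sub>\<bullet> (X \<bullet> \<I>) \<I> \<I>) \<cdot> ((\<one> X \<bullet>\<^sub>m \<one> \<I> \<bullet>\<^sub>m \<Delta>\<^sub>I) \<cdot> (inv (a\<^sub>\<bullet> X \<I> \<I>) \<cdot> (\<one> X \<bullet>\<^sub>m \<Delta>\<^sub>I)))"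
    by (simp add: coact_I_def comp_assoc)
  also have "\<dots> = (inv (a\<^sub>\<bullet> (X \<bullet> \<I>) \<I> \<I>) \<cdot> inv (a\<^sub>\<bullet> X \<I> (\<I> \<bullet> \<I>))) \<cdot> (\<one> X \<bullet>\<^sub>m ((\<one> \<I> \<bullet>\<^sub>m \<Delta>\<^sub>I) \<cdot> \<Delta>\<^sub>I))"
    using bul.nat_ai'[of "\<one> X" X "\<one> \<I>" \<I> "\<Delta>\<^sub>I" "\<I> \<bullet> \<I>" "\<one> X \<bullet>\<^sub>m \<Delta>\<^sub>I"]
    by (simp add: comp_assoc bul.merges)
  also have "\<dots> = (inv (a\<^sub>\<bullet> X \<I> \<I>) \<bullet>\<^sub>m \<one> \<I>) \<cdot> (inv (a\<^sub>\<bullet> X (\<I> \<bullet> \<I>) \<I>) \<cdot> (\<one> X \<bullet>\<^sub>m (inv (a\<^sub>\<bullet> \<I> \<I> \<I>) \<cdot> ((\<one> \<I> \<bullet>\<^sub>m \<Delta>\<^sub>I) \<cdot> \<Delta>\<^sub>I))))"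
    unfolding bul.pentagon_inv by (simp add: comp_assoc bul.merges)
  also have "\<dots> = (inv (a\<^sub>\<bullet> X \<I> \<I>) \<bullet>\<^sub>m \<one> \<I>) \<cdot> (inv (a\<^sub>\<bullet> X (\<I> \<bullet> \<I>) \<I>) \<cdot> ((\<one> X \<bullet>\<^sub>m (\<Delta>\<^sub>I \<bullet>\<^sub>m \<one> \<I>)) \<cdot> (\<one> X \<bullet>\<^sub>m \<Delta>\<^sub>I)))"
    unfolding I_coassoc[symmetric] by (simp add: bul.merges)
  also have "\<dots> = (coact_I X \<bullet>\<^sub>m \<one> \<I>) \<cdot> coact_I X"
    using bul.nat_ai'[of "\<one> X" X "\<Delta>\<^sub>I" "\<I> \<bullet> \<I>" "\<one> \<I>" \<I> "\<one> X \<bullet>\<^sub>m \<Delta>\<^sub>I"]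
    by (simp add: coact_I_def bul.split_r comp_assoc)
  finally show ?thesis .
qed

lemma coact_I_counit: "r\<^sub>\<bullet> (X \<bullet> \<I>) \<cdot> ((\<one> (X \<bullet> \<I>) \<bullet>\<^sub>m \<epsilon>\<^sub>I) \<cdot> coact_I X) = \<one> (X \<bullet> \<I>)"
proof -
  have "r\<^sub>\<bullet> (X \<bullet> \<I>) \<cdot> ((\<one> (X \<bullet> \<I>) \<bullet>\<^sub>m \<epsilon>\<^sub>I) \<cdot> coact_I X) = r\<^sub>\<bullet> (X \<bullet> \<I>) \<cdot> (inv (a\<^sub>\<bullet> X \<I> \<J>) \<cdot> ((\<one> X \<bullet>\<^sub>m (\<one> \<I> \<bullet>\<^sub>m \<epsilon>\<^sub>I)) \<cdot> (\<one> X \<bullet>\<^sub>m \<Delta>\<^sub>I)))"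
    using bul.nat_ai'[of "\<one> X" X "\<one> \<I>" \<I> "\<epsilon>\<^sub>I" \<J> "\<one> X \<bullet>\<^sub>m \<Delta>\<^sub>I"] by (simp add: coact_I_def)
  also have "\<dots> = \<one> (X \<bullet> \<I>)"
    by (simp add: comp_reduce[OF bul.runit_tensor'] bul.merges I_rcounit)
  finally show ?thesis .
qed

definition tensor_action :: "('o, 'm) bimonoid \<Rightarrow> 'o \<Rightarrow> 'o \<Rightarrow> 'm \<Rightarrow> 'm \<Rightarrow> 'm" where
  "tensor_action H X Y \<rho> \<tau> = (\<rho> \<bullet>\<^sub>m \<tau>) \<cdot> (\<zeta> X Y (obj H) (obj H) \<cdot> (\<one> (X \<bullet> Y) \<odot>\<^sub>m comult H))"

text \<open>Associativity of the diagonal action comes from multiplicativity of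
  \<open>\<Delta>\<close> together with associativity of \<open>\<zeta>\<close>; the unit law comes
  from the unit being group-like together with the unit axiom of \<open>\<zeta>\<close>.\<close>

lemma right_module_tensor:
  assumes H: "is_bimonoid C H" and X: "right_module H X \<rho>" and Y: "right_module H Y \<tau>"
  shows "right_module H (X \<bullet> Y) (tensor_action H X Y \<rho> \<tau>)"
proof -
  note [simp] = bimonoid_simps[OF H] right_moduleD(1,2)[OF X] right_moduleD(1,2)[OF Y]
  let ?H = "obj H" let ?T = "tensor_action H X Y \<rho> \<tau>" let ?\<Delta> = "comult H" let ?m = "mult H"
  let ?D = "(\<one> (X \<bullet> Y) \<odot>\<^sub>m ?\<Delta>) \<odot>\<^sub>m ?\<Delta>"
  let ?z = "\<zeta> X Y ?H ?H \<odot>\<^sub>m \<one> (?H \<bullet> ?H)"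
  have [simp]: "Dom C ?T = (X \<bullet> Y) \<odot> ?H" "Cod C ?T = X \<bullet> Y" by (simp_all add: tensor_action_def)
  have "?T \<cdot> (?T \<odot>\<^sub>m \<one> ?H) = (\<rho> \<bullet>\<^sub>m \<tau>) \<cdot> (\<zeta> X Y ?H ?H \<cdot> (((\<rho> \<bullet>\<^sub>m \<tau>) \<odot>\<^sub>m \<one> (?H \<bullet> ?H)) \<cdot> (?z \<cdot> ?D)))"
    by (simp add: tensor_action_def comp_assoc circ.merges)
  also have "\<dots> = ((\<rho> \<cdot> (\<rho> \<odot>\<^sub>m \<one> ?H)) \<bullet>\<^sub>m (\<tau> \<cdot> (\<tau> \<odot>\<^sub>m \<one> ?H))) \<cdot> (\<zeta> (X \<odot> ?H) (Y \<odot> ?H) ?H ?H \<cdot> (?z \<cdot> ?D))"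
    using nat_zeta'[of \<rho> X \<tau> Y "\<one> ?H" ?H "\<one> ?H" ?H "?z \<cdot> ?D"]
    by (simp add: bul.merges)
  also have "\<dots> = ((\<rho> \<cdot> (\<one> X \<odot>\<^sub>m ?m)) \<bullet>\<^sub>m (\<tau> \<cdot> (\<one> Y \<odot>\<^sub>m ?m))) \<cdot> (((a\<^sub>\<odot> X ?H ?H \<bullet>\<^sub>m a\<^sub>\<odot> Y ?H ?H) \<cdot> \<zeta> (X \<odot> ?H) (Y \<odot> ?H) ?H ?H \<cdot> ?z) \<cdot> ?D)"
    unfolding right_moduleD(3)[OF X] right_moduleD(3)[OF Y] by (simp add: comp_assoc bul.merges)
  also have "\<dots> = (\<rho> \<bullet>\<^sub>m \<tau>) \<cdot> (((\<one> X \<odot>\<^sub>m ?m) \<bullet>\<^sub>m (\<one> Y \<odot>\<^sub>m ?m)) \<cdot> (\<zeta> X Y (?H \<odot> ?H) (?H \<odot> ?H) \<cdot> ((\<one> (X \<bullet> Y) \<odot>\<^sub>m \<zeta> ?H ?H ?H ?H) \<cdot> (a\<^sub>\<odot> (X \<bullet> Y) (?H \<bullet> ?H) (?H \<bullet> ?H) \<cdot> ?D))))"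
    unfolding zeta_circ_assoc[symmetric] by (simp add: comp_assoc bul.merges)
  also have "\<dots> = (\<rho> \<bullet>\<^sub>m \<tau>) \<cdot> (\<zeta> X Y ?H ?H \<cdot> ((\<one> (X \<bullet> Y) \<odot>\<^sub>m (?m \<bullet>\<^sub>m ?m)) \<cdot> ((\<one> (X \<bullet> Y) \<odot>\<^sub>m \<zeta> ?H ?H ?H ?H) \<cdot> ((\<one> (X \<bullet> Y) \<odot>\<^sub>m (?\<Delta> \<odot>\<^sub>m ?\<Delta>)) \<cdot> a\<^sub>\<odot> (X \<bullet> Y) ?H ?H))))"
    using nat_zeta'[of "\<one> X" X "\<one> Y" Y ?m ?H ?m ?H "(\<one> (X \<bullet> Y) \<odot>\<^sub>m \<zeta> ?H ?H ?H ?H) \<cdot> ((\<one> (X \<bullet> Y) \<odot>\<^sub>m (?\<Delta> \<odot>\<^sub>m ?\<Delta>)) \<cdot> a\<^sub>\<odot> (X \<bullet> Y) ?H ?H)"]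
    by (simp add: circ.nat_a)
  also have "\<dots> = ?T \<cdot> ((\<one> (X \<bullet> Y) \<odot>\<^sub>m ?m) \<cdot> a\<^sub>\<odot> (X \<bullet> Y) ?H ?H)"
    by (simp add: tensor_action_def comp_assoc circ.merges comult_mult[OF H])
  finally have assoc: "?T \<cdot> (?T \<odot>\<^sub>m \<one> ?H) = \<dots>" .
  have "?T \<cdot> (\<one> (X \<bullet> Y) \<odot>\<^sub>m unit H) = (\<rho> \<bullet>\<^sub>m \<tau>) \<cdot> (\<zeta> X Y ?H ?H \<cdot> ((\<one> (X \<bullet> Y) \<odot>\<^sub>m (unit H \<bullet>\<^sub>m unit H)) \<cdot> (\<one> (X \<bullet> Y) \<odot>\<^sub>m \<Delta>\<^sub>I)))"
    by (simp add: tensor_action_def comp_assoc circ.merges comult_unit[OF H])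
  also have "\<dots> = (r\<^sub>\<odot> X \<bullet>\<^sub>m r\<^sub>\<odot> Y) \<cdot> \<zeta> X Y \<I> \<I> \<cdot> (\<one> (X \<bullet> Y) \<odot>\<^sub>m \<Delta>\<^sub>I)"
    using nat_zeta'[of "\<one> X" X "\<one> Y" Y "unit H" ?H "unit H" ?H "\<one> (X \<bullet> Y) \<odot>\<^sub>m \<Delta>\<^sub>I"]
    by (simp add: bul.merges comp_assoc right_moduleD(4)[OF X] right_moduleD(4)[OF Y])
  finally show ?thesis
    unfolding right_module_def zeta_circ_runit using assoc by (simp add: hom_def)
qed

lemma right_module_regular: "is_bimonoid C H \<Longrightarrow> right_module H (obj H) (mult H)"
  by (simp add: right_module_def hom_def mult_assoc mult_runit)

text \<open>Two bimonoids are allowed because there are two uses: an identity for \<open>g\<close>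
  compares modules over one Hopf monoid, a general \<open>g\<close> compares two split
  epimorphisms.\<close>

lemma beta_natural:
  assumes H: "is_bimonoid C H" "is_bimonoid C H'" and X: "right_module H X \<rho>" "right_module H' Y \<tau>"
    and f: "Dom C f = X" "Cod C f = Y" and g: "Dom C g = obj H" "Cod C g = obj H'"
    and comult: "comult H' \<cdot> g = (g \<bullet>\<^sub>m g) \<cdot> comult H" and act: "\<tau> \<cdot> (f \<odot>\<^sub>m g) = f \<cdot> \<rho>"
  shows "beta H' Y \<tau> \<cdot> ((f \<bullet>\<^sub>m \<one> \<I>) \<odot>\<^sub>m g) = (f \<bullet>\<^sub>m g) \<cdot> beta H X \<rho>"
proof -
  note [simp] = bimonoid_simps[OF H(1)] bimonoid_simps[OF H(2)] right_moduleD(1,2)[OF X(1)] right_moduleD(1,2)[OF X(2)] f g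
  have "beta H' Y \<tau> \<cdot> ((f \<bullet>\<^sub>m \<one> \<I>) \<odot>\<^sub>m g) = (\<tau> \<bullet>\<^sub>m l\<^sub>\<odot> (obj H')) \<cdot> (\<zeta> Y \<I> (obj H') (obj H') \<cdot> (((f \<bullet>\<^sub>m \<one> \<I>) \<odot>\<^sub>m (g \<bullet>\<^sub>m g)) \<cdot> (\<one> (X \<bullet> \<I>) \<odot>\<^sub>m comult H)))"
    by (simp add: beta_def comp_assoc circ.merges comult)
  also have "\<dots> = ((\<tau> \<cdot> (f \<odot>\<^sub>m g)) \<bullet>\<^sub>m (l\<^sub>\<odot> (obj H') \<cdot> (\<one> \<I> \<odot>\<^sub>m g))) \<cdot> (\<zeta> X \<I> (obj H) (obj H) \<cdot> (\<one> (X \<bullet> \<I>) \<odot>\<^sub>m comult H))"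
    using nat_zeta'[of f Y "\<one> \<I>" \<I> g "obj H'" g "obj H'" "\<one> (X \<bullet> \<I>) \<odot>\<^sub>m comult H"]
    by (simp add: bul.merges)
  also have "\<dots> = (f \<bullet>\<^sub>m g) \<cdot> beta H X \<rho>"
    unfolding act by (simp add: circ.nat_l beta_def bul.merges)
  finally show ?thesis .
qed

text \<open>The unit is group-like, so \<open>(x, 1)\<close> goes to \<open>(x, 1)\<close>. This
  later identifies \<open>x 1^-1\<close> with \<open>x\<close>.\<close>

lemma beta_unit:
  assumes H: "is_bimonoid C H" and X: "right_module H X \<rho>"
  shows "beta H X \<rho> \<cdot> (\<one> (X \<bullet> \<I>) \<odot>\<^sub>m unit H) = (\<one> X \<bullet>\<^sub>m unit H) \<cdot> r\<^sub>\<odot> (X \<bullet> \<I>)"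
proof -
  note [simp] = bimonoid_simps[OF H] right_moduleD(1,2)[OF X]
  have "beta H X \<rho> \<cdot> (\<one> (X \<bullet> \<I>) \<odot>\<^sub>m unit H) = (\<rho> \<bullet>\<^sub>m l\<^sub>\<odot> (obj H)) \<cdot> (\<zeta> X \<I> (obj H) (obj H) \<cdot> ((\<one> (X \<bullet> \<I>) \<odot>\<^sub>m (unit H \<bullet>\<^sub>m unit H)) \<cdot> (\<one> (X \<bullet> \<I>) \<odot>\<^sub>m \<Delta>\<^sub>I)))"
    by (simp add: beta_def comp_assoc circ.merges comult_unit[OF H])
  also have "\<dots> = (\<one> X \<bullet>\<^sub>m unit H) \<cdot> ((r\<^sub>\<odot> X \<bullet>\<^sub>m r\<^sub>\<odot> \<I>) \<cdot> \<zeta> X \<I> \<I> \<I> \<cdot> (\<one> (X \<bullet> \<I>) \<odot>\<^sub>m \<Delta>\<^sub>I))"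
    using nat_zeta'[of "\<one> X" X "\<one> \<I>" \<I> "unit H" "obj H" "unit H" "obj H" "\<one> (X \<bullet> \<I>) \<odot>\<^sub>m \<Delta>\<^sub>I"]
    by (simp add: bul.merges comp_assoc right_moduleD(4)[OF X] circ.nat_l circ.lunit_runit_unit)
  finally show ?thesis unfolding zeta_circ_runit .
qed

text \<open>The counit discards \<open>h2\<close> from \<open>(x h1, h2)\<close>. Applied to
  \<open>w\<close>, this recovers an element from its two components.\<close>

lemma beta_counit:
  assumes H: "is_bimonoid C H" and X: "right_module H X \<rho>"
  shows "r\<^sub>\<bullet> X \<cdot> ((\<one> X \<bullet>\<^sub>m counit H) \<cdot> beta H X \<rho>) = \<rho> \<cdot> ((r\<^sub>\<bullet> X \<cdot> (\<one> X \<bullet>\<^sub>m \<epsilon>\<^sub>I)) \<odot>\<^sub>m \<one> (obj H))"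
proof -
  note [simp] = bimonoid_simps[OF H] right_moduleD(1,2)[OF X]
  let ?H = "obj H"
  \<comment> \<open>Expressing the unit constraint of \<open>J\<close> through \<open>m_J\<close>
    prepares the axiom that relates \<open>m_J\<close> to \<open>\<zeta>\<close>.\<close>
  have "counit H \<cdot> l\<^sub>\<odot> ?H = l\<^sub>\<odot> \<J> \<cdot> (\<one> \<I> \<odot>\<^sub>m counit H)" by (simp add: circ.nat_l)
  also have "\<dots> = m\<^sub>J \<cdot> (\<epsilon>\<^sub>I \<odot>\<^sub>m counit H)" unfolding mJ_epsI[symmetric] by (simp add: comp_assoc circ.merges)
  finally have "(\<one> X \<bullet>\<^sub>m counit H) \<cdot> beta H X \<rho> = (\<rho> \<bullet>\<^sub>m m\<^sub>J) \<cdot> (((\<one> X \<odot>\<^sub>m \<one> ?H) \<bullet>\<^sub>m (\<epsilon>\<^sub>I \<odot>\<^sub>m counit H)) \<cdot> (\<zeta> X \<I> ?H ?H \<cdot> (\<one> (X \<bullet> \<I>) \<odot>\<^sub>m comult H)))"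
    by (simp add: beta_def bul.merges)
  also have "\<dots> = (\<rho> \<bullet>\<^sub>m \<one> \<J>) \<cdot> ((\<one> (X \<odot> ?H) \<bullet>\<^sub>m m\<^sub>J) \<cdot> (\<zeta> X \<J> ?H \<J> \<cdot> ((\<one> X \<bullet>\<^sub>m \<epsilon>\<^sub>I) \<odot>\<^sub>m ((\<one> ?H \<bullet>\<^sub>m counit H) \<cdot> comult H))))"
    using nat_zeta'[of "\<one> X" X "\<epsilon>\<^sub>I" \<J> "\<one> ?H" ?H "counit H" \<J> "\<one> (X \<bullet> \<I>) \<odot>\<^sub>m comult H"]
    by (simp add: bul.merges circ.merges)
  finally have "r\<^sub>\<bullet> X \<cdot> ((\<one> X \<bullet>\<^sub>m counit H) \<cdot> beta H X \<rho>)
    = \<rho> \<cdot> ((r\<^sub>\<bullet> (X \<odot> ?H) \<cdot> (\<one> (X \<odot> ?H) \<bullet>\<^sub>m m\<^sub>J) \<cdot> \<zeta> X \<J> ?H \<J>) \<cdot> ((\<one> X \<bullet>\<^sub>m \<epsilon>\<^sub>I) \<odot>\<^sub>m ((\<one> ?H \<bullet>\<^sub>m counit H) \<cdot> comult H)))"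
    by (simp add: bul.nats comp_assoc)
  then show ?thesis
    unfolding zeta_bul_runit by (simp add: circ.merges rcounit[OF H])
qed

text \<open>For the diagonal action, \<open>(x, 1) h1 = (x h1, h2)\<close>; the Galois map thus
  gives \<open>(x h1, h2, h3)\<close>, and the claim reduces to coassociativity and the left unit
  law of \<open>H\<close>.\<close>

lemma beta_coinvariants:
  assumes H: "is_bimonoid C H" and X: "right_module H X \<rho>"
  shows "beta H (X \<bullet> obj H) (tensor_action H X (obj H) \<rho> (mult H)) \<cdot> (((\<one> X \<bullet>\<^sub>m unit H \<bullet>\<^sub>m \<one> \<I>) \<cdot> coact_I X) \<odot>\<^sub>m \<one> (obj H))
     = inv (a\<^sub>\<bullet> X (obj H) (obj H)) \<cdot> ((\<one> X \<bullet>\<^sub>m comult H) \<cdot> beta H X \<rho>)"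
proof -
  note [simp] = bimonoid_simps[OF H] right_moduleD(1,2)[OF X]
  let ?H = "obj H" let ?\<Delta> = "comult H" let ?m = "mult H" let ?l = "l\<^sub>\<odot> ?H"
  let ?c = "(\<one> X \<bullet>\<^sub>m unit H \<bullet>\<^sub>m \<one> \<I>) \<cdot> coact_I X"
  let ?v = "(unit H \<bullet>\<^sub>m \<one> \<I>) \<cdot> \<Delta>\<^sub>I"
  let ?z = "\<zeta> ?H \<I> ?H ?H \<cdot> (?v \<odot>\<^sub>m ?\<Delta>)"
  let ?D = "(?\<Delta> \<bullet>\<^sub>m \<one> ?H) \<cdot> ?\<Delta>"
  have c: "a\<^sub>\<bullet> X ?H \<I> \<cdot> ?c = \<one> X \<bullet>\<^sub>m ?v"
    by (simp add: coact_I_def bul.nat_a' bul.merges)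
  have "beta H (X \<bullet> ?H) (tensor_action H X ?H \<rho> ?m) \<cdot> (?c \<odot>\<^sub>m \<one> ?H)
    = (\<rho> \<bullet>\<^sub>m ?m \<bullet>\<^sub>m ?l) \<cdot> ((\<zeta> X ?H ?H ?H \<bullet>\<^sub>m \<one> (\<I> \<odot> ?H)) \<cdot> ((\<one> (X \<bullet> ?H) \<odot>\<^sub>m ?\<Delta> \<bullet>\<^sub>m \<one> (\<I> \<odot> ?H)) \<cdot> (\<zeta> (X \<bullet> ?H) \<I> ?H ?H \<cdot> (?c \<odot>\<^sub>m ?\<Delta>))))"
    by (simp add: beta_def tensor_action_def comp_assoc circ.merges bul.merges)
  also have "(\<one> (X \<bullet> ?H) \<odot>\<^sub>m ?\<Delta> \<bullet>\<^sub>m \<one> (\<I> \<odot> ?H)) \<cdot> (\<zeta> (X \<bullet> ?H) \<I> ?H ?H \<cdot> (?c \<odot>\<^sub>m ?\<Delta>))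
     = \<zeta> (X \<bullet> ?H) \<I> (?H \<bullet> ?H) ?H \<cdot> (?c \<odot>\<^sub>m ?D)"
    using nat_zeta'[of "\<one> (X \<bullet> ?H)" "X \<bullet> ?H" "\<one> \<I>" \<I> ?\<Delta> "?H \<bullet> ?H" "\<one> ?H" ?H "?c \<odot>\<^sub>m ?\<Delta>"]
    by (simp add: circ.merges)
  \<comment> \<open>An associator and its inverse are inserted so that \<open>zeta_bul_assoc\<close>
    applies to the two nested \<open>\<zeta>\<close>.\<close>
  also have "(\<zeta> X ?H ?H ?H \<bullet>\<^sub>m \<one> (\<I> \<odot> ?H)) \<cdot> (\<zeta> (X \<bullet> ?H) \<I> (?H \<bullet> ?H) ?H \<cdot> (?c \<odot>\<^sub>m ?D))
     = inv (a\<^sub>\<bullet> (X \<odot> ?H) (?H \<odot> ?H) (\<I> \<odot> ?H)) \<cdot> ((a\<^sub>\<bullet> (X \<odot> ?H) (?H \<odot> ?H) (\<I> \<odot> ?H) \<cdot> (\<zeta> X ?H ?H ?H \<bullet>\<^sub>m \<one> (\<I> \<odot> ?H)) \<cdot> \<zeta> (X \<bullet> ?H) \<I> (?H \<bullet> ?H) ?H) \<cdot> (?c \<odot>\<^sub>m ?D))"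
    by (simp add: comp_assoc)
  also have "\<dots> = inv (a\<^sub>\<bullet> (X \<odot> ?H) (?H \<odot> ?H) (\<I> \<odot> ?H)) \<cdot> ((\<one> (X \<odot> ?H) \<bullet>\<^sub>m \<zeta> ?H \<I> ?H ?H) \<cdot> (\<zeta> X (?H \<bullet> \<I>) ?H (?H \<bullet> ?H)
      \<cdot> ((a\<^sub>\<bullet> X ?H \<I> \<cdot> ?c) \<odot>\<^sub>m (a\<^sub>\<bullet> ?H ?H ?H \<cdot> ?D))))"
    unfolding zeta_bul_assoc[symmetric] by (simp add: comp_assoc circ.merges)
  also have "\<zeta> X (?H \<bullet> \<I>) ?H (?H \<bullet> ?H) \<cdot> ((a\<^sub>\<bullet> X ?H \<I> \<cdot> ?c) \<odot>\<^sub>m (a\<^sub>\<bullet> ?H ?H ?H \<cdot> ?D))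
     = \<zeta> X (?H \<bullet> \<I>) ?H (?H \<bullet> ?H) \<cdot> (((\<one> X \<bullet>\<^sub>m ?v) \<odot>\<^sub>m (\<one> ?H \<bullet>\<^sub>m ?\<Delta>)) \<cdot> (\<one> (X \<bullet> \<I>) \<odot>\<^sub>m ?\<Delta>))"
    unfolding c coassoc[OF H] by (simp add: circ.merges)
  also have "\<dots> = (\<one> (X \<odot> ?H) \<bullet>\<^sub>m (?v \<odot>\<^sub>m ?\<Delta>)) \<cdot> (\<zeta> X \<I> ?H ?H \<cdot> (\<one> (X \<bullet> \<I>) \<odot>\<^sub>m ?\<Delta>))"
    using nat_zeta'[of "\<one> X" X "(unit H \<bullet>\<^sub>m \<one> \<I>) \<cdot> \<Delta>\<^sub>I" "?H \<bullet> \<I>" "\<one> ?H" ?H ?\<Delta> "?H \<bullet> ?H" "\<one> (X \<bullet> \<I>) \<odot>\<^sub>m ?\<Delta>"] by simp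
  also have "(\<rho> \<bullet>\<^sub>m ?m \<bullet>\<^sub>m ?l) \<cdot> (inv (a\<^sub>\<bullet> (X \<odot> ?H) (?H \<odot> ?H) (\<I> \<odot> ?H)) \<cdot> ((\<one> (X \<odot> ?H) \<bullet>\<^sub>m \<zeta> ?H \<I> ?H ?H) \<cdot> \<dots>))
     = inv (a\<^sub>\<bullet> X ?H ?H) \<cdot> ((\<rho> \<bullet>\<^sub>m ((?m \<bullet>\<^sub>m ?l) \<cdot> ?z)) \<cdot> (\<zeta> X \<I> ?H ?H \<cdot> (\<one> (X \<bullet> \<I>) \<odot>\<^sub>m ?\<Delta>)))"
    using bul.nat_ai'[of \<rho> X ?m ?H ?l ?H "(\<one> (X \<odot> ?H) \<bullet>\<^sub>m ?z) \<cdot> (\<zeta> X \<I> ?H ?H \<cdot> (\<one> (X \<bullet> \<I>) \<odot>\<^sub>m ?\<Delta>))"]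
    by (simp add: bul.merges)
  \<comment> \<open>The second entry is multiplied by \<open>1\<close> on the left: the unit law of
    \<open>H\<close> followed by the unit axiom of \<open>\<zeta>\<close>.\<close>
  also have "(?m \<bullet>\<^sub>m ?l) \<cdot> ?z = ?\<Delta> \<cdot> ?l"
  proof -
    have "(?m \<bullet>\<^sub>m ?l) \<cdot> ?z
      = (?m \<bullet>\<^sub>m ?l) \<cdot> (\<zeta> ?H \<I> ?H ?H \<cdot> (((unit H \<bullet>\<^sub>m \<one> \<I>) \<odot>\<^sub>m (\<one> ?H \<bullet>\<^sub>m \<one> ?H)) \<cdot> ((\<Delta>\<^sub>I \<odot>\<^sub>m \<one> (?H \<bullet> ?H)) \<cdot> (\<one> \<I> \<odot>\<^sub>m ?\<Delta>))))"
      by (simp add: circ.merges)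
    also have "\<dots> = ((l\<^sub>\<odot> ?H \<bullet>\<^sub>m l\<^sub>\<odot> ?H) \<cdot> \<zeta> \<I> \<I> ?H ?H \<cdot> (\<Delta>\<^sub>I \<odot>\<^sub>m \<one> (?H \<bullet> ?H))) \<cdot> (\<one> \<I> \<odot>\<^sub>m ?\<Delta>)"
      using nat_zeta'[of "unit H" ?H "\<one> \<I>" \<I> "\<one> ?H" ?H "\<one> ?H" ?H "(\<Delta>\<^sub>I \<odot>\<^sub>m \<one> (?H \<bullet> ?H)) \<cdot> (\<one> \<I> \<odot>\<^sub>m ?\<Delta>)"]
      by (simp add: bul.merges comp_assoc mult_lunit[OF H])
    also have "\<dots> = ?\<Delta> \<cdot> ?l" unfolding zeta_circ_lunit by (simp add: circ.nat_l)
    finally show ?thesis .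
  qed
  finally show ?thesis by (simp add: beta_def bul.merges)
qed

end

section \<open>Split epimorphisms of bimonoids\<close>

context duoidal_category
begin

lemma bimon_homD:
  assumes "f \<in> bimon_hom C A B"
  shows "is_bimonoid C A" "is_bimonoid C B" "Dom C f = obj A" "Cod C f = obj B"
    "f \<cdot> mult A = mult B \<cdot> (f \<odot>\<^sub>m f)" "f \<cdot> unit A = unit B"
    "comult B \<cdot> f = (f \<bullet>\<^sub>m f) \<cdot> comult A" "counit B \<cdot> f = counit A"
  using assms by (simp_all add: bimon_hom_def hom_def)

end

text \<open>The assumption \<open>monic_unit\<close> is the form in which monicity of
  \<open>u_H\<close> enters the algebra; preservation of intersections will provide it.\<close>

locale split_bimonoid = hopf C H S
  for C :: "('o, 'm, 'z) reversible_duoidal_scheme" (structure)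
    and H :: "('o, 'm) bimonoid" and S :: 'm +
  fixes A :: "('o, 'm) bimonoid" and \<pi> \<sigma> :: 'm
  assumes pi_hom: "\<pi> \<in> bimon_hom C A H" and sigma_hom: "\<sigma> \<in> bimon_hom C H A"
    and pi_sigma: "\<pi> \<cdot> \<sigma> = \<one> (obj H)"
    and monic_unit: "monic C (\<one> (obj A) \<bullet>\<^sub>m unit H)"
begin

lemmas [simp] = bimon_homD(1,3,4)[OF pi_hom] bimon_homD(3,4)[OF sigma_hom]

text \<open>
  In terms of elements, \<open>w\<close> is \<open>a \<mapsto> (a (\<sigma> (\<pi> a))\<^sup>-\<^sup>1, \<pi> a)\<close>, and \<open>e\<close> and \<open>e0\<close> are \<open>a \<mapsto> a (\<sigma> (\<pi> a))\<^sup>-\<^sup>1\<close>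
  for a loop \<open>a\<close>. On loops, \<open>coinv\<close> is the trivial coaction.
\<close>

definition "\<rho> = mult A \<cdot> (\<one> (obj A) \<odot>\<^sub>m \<sigma>)"
definition "\<chi> = (\<one> (obj A) \<bullet>\<^sub>m \<pi>) \<cdot> comult A"
definition "w = beta_inv (obj A) \<rho> \<cdot> \<chi>"
text \<open>The counit forgets the second component of \<open>w\<close>, leaving a \<open>J\<close>;
  for a loop, \<open>gamma_loop\<close> can trade this \<open>J\<close> for the unit object.\<close>

definition "V = gamma_loop (coact_I (obj A)) \<I> \<cdot> (((\<one> (obj A \<bullet> \<I>) \<odot>\<^sub>m counit H) \<cdot> w) \<bullet>\<^sub>m \<one> \<I>)"
definition "e = r\<^sub>\<odot> (obj A \<bullet> \<I>) \<cdot> V"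
definition "e0 = r\<^sub>\<bullet> (obj A) \<cdot> ((\<one> (obj A) \<bullet>\<^sub>m \<epsilon>\<^sub>I) \<cdot> e)"
definition "coinv = ((\<one> (obj A) \<bullet>\<^sub>m unit H) \<bullet>\<^sub>m \<one> \<I>) \<cdot> coact_I (obj A)"

lemma right_module: "right_module H (obj A) \<rho>"
proof -
  let ?A = "obj A" let ?H = "obj H"
  have "\<rho> \<cdot> (\<rho> \<odot>\<^sub>m \<one> ?H) = (mult A \<cdot> (mult A \<odot>\<^sub>m \<one> ?A)) \<cdot> (\<one> ?A \<odot>\<^sub>m \<sigma> \<odot>\<^sub>m \<sigma>)"
    by (simp add: \<rho>_def comp_assoc circ.merges)
  also have "\<dots> = mult A \<cdot> ((\<one> ?A \<odot>\<^sub>m mult A) \<cdot> ((\<one> ?A \<odot>\<^sub>m (\<sigma> \<odot>\<^sub>m \<sigma>)) \<cdot> a\<^sub>\<odot> ?A ?H ?H))"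
    by (simp add: mult_assoc comp_assoc circ.nat_a)
  also have "\<dots> = \<rho> \<cdot> ((\<one> ?A \<odot>\<^sub>m mult H) \<cdot> a\<^sub>\<odot> ?A ?H ?H)"
    by (simp add: \<rho>_def comp_assoc circ.merges bimon_homD(5)[OF sigma_hom])
  finally show ?thesis
    by (simp add: right_module_def hom_def) (simp add: \<rho>_def comp_assoc circ.merges bimon_homD(6)[OF sigma_hom] mult_runit)
qed

lemma simps [simp]:
  "Dom C \<rho> = obj A \<odot> obj H" "Cod C \<rho> = obj A"
  "Dom C \<chi> = obj A" "Cod C \<chi> = obj A \<bullet> obj H"
  "Dom C w = obj A" "Cod C w = (obj A \<bullet> \<I>) \<odot> obj H"
  "Dom C V = obj A \<bullet> \<I>" "Cod C V = (obj A \<bullet> \<I>) \<odot> \<I>"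
  "Dom C e = obj A \<bullet> \<I>" "Cod C e = obj A \<bullet> \<I>"
  "Dom C e0 = obj A \<bullet> \<I>" "Cod C e0 = obj A"
  "Dom C coinv = obj A \<bullet> \<I>" "Cod C coinv = obj A \<bullet> obj H \<bullet> \<I>"
  using right_module by (simp_all add: \<rho>_def \<chi>_def w_def V_def e_def e0_def coinv_def)

lemma beta_w: "beta H (obj A) \<rho> \<cdot> w = \<chi>"
  by (simp add: w_def comp_reduce[OF beta_beta_inv] right_module)

text \<open>Multiplicativity of \<open>\<Delta>\<close> and of \<open>\<pi>\<close>, with
  \<open>\<pi> \<sigma> = 1\<close> simplifying the entry in \<open>H\<close>. It makes the Galois
  maps of \<open>A\<close> and \<open>A \<bullet> H\<close> comparable along
  \<open>\<chi>\<close>.\<close>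

lemma chi_act: "tensor_action H (obj A) (obj H) \<rho> (mult H) \<cdot> (\<chi> \<odot>\<^sub>m \<one> (obj H)) = \<chi> \<cdot> \<rho>"
proof -
  let ?A = "obj A" let ?H = "obj H"
  have "\<chi> \<cdot> \<rho> = (\<one> ?A \<bullet>\<^sub>m \<pi>) \<cdot> ((comult A \<cdot> mult A) \<cdot> (\<one> ?A \<odot>\<^sub>m \<sigma>))"
    by (simp add: \<chi>_def \<rho>_def comp_assoc)
  also have "\<dots> = (mult A \<bullet>\<^sub>m (\<pi> \<cdot> mult A)) \<cdot> (\<zeta> ?A ?A ?A ?A \<cdot> (comult A \<odot>\<^sub>m (comult A \<cdot> \<sigma>)))"
    by (simp add: comult_mult comp_assoc bul.merges circ.merges)
  also have "\<dots> = (mult A \<bullet>\<^sub>m mult H) \<cdot> ((\<one> (?A \<odot> ?A) \<bullet>\<^sub>m (\<pi> \<odot>\<^sub>m \<pi>)) \<cdot> (\<zeta> ?A ?A ?A ?A \<cdot> ((\<one> (?A \<bullet> ?A) \<odot>\<^sub>m (\<sigma> \<bullet>\<^sub>m \<sigma>)) \<cdot> (comult A \<odot>\<^sub>m comult H))))"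
    unfolding bimon_homD(5)[OF pi_hom] bimon_homD(7)[OF sigma_hom] by (simp add: bul.merges circ.merges)
  also have "\<zeta> ?A ?A ?A ?A \<cdot> ((\<one> (?A \<bullet> ?A) \<odot>\<^sub>m (\<sigma> \<bullet>\<^sub>m \<sigma>)) \<cdot> (comult A \<odot>\<^sub>m comult H)) = ((\<one> ?A \<odot>\<^sub>m \<sigma>) \<bullet>\<^sub>m (\<one> ?A \<odot>\<^sub>m \<sigma>)) \<cdot> (\<zeta> ?A ?A ?H ?H \<cdot> (comult A \<odot>\<^sub>m comult H))"
    using nat_zeta'[of "\<one> ?A" ?A "\<one> ?A" ?A \<sigma> ?A \<sigma> ?A "comult A \<odot>\<^sub>m comult H"] by simp
  also have "(mult A \<bullet>\<^sub>m mult H) \<cdot> ((\<one> (?A \<odot> ?A) \<bullet>\<^sub>m (\<pi> \<odot>\<^sub>m \<pi>)) \<cdot> \<dots>) = (\<rho> \<bullet>\<^sub>m mult H) \<cdot> ((\<one> (?A \<odot> ?H) \<bullet>\<^sub>m (\<pi> \<odot>\<^sub>m \<one> ?H)) \<cdot> (\<zeta> ?A ?A ?H ?H \<cdot> (comult A \<odot>\<^sub>m comult H)))"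
    by (simp add: \<rho>_def bul.merges circ.merges pi_sigma)
  also have "(\<one> (?A \<odot> ?H) \<bullet>\<^sub>m (\<pi> \<odot>\<^sub>m \<one> ?H)) \<cdot> (\<zeta> ?A ?A ?H ?H \<cdot> (comult A \<odot>\<^sub>m comult H)) = \<zeta> ?A ?H ?H ?H \<cdot> (((\<one> ?A \<bullet>\<^sub>m \<pi>) \<odot>\<^sub>m \<one> (?H \<bullet> ?H)) \<cdot> (comult A \<odot>\<^sub>m comult H))"
    using nat_zeta'[of "\<one> ?A" ?A \<pi> ?H "\<one> ?H" ?H "\<one> ?H" ?H "comult A \<odot>\<^sub>m comult H"] by simp
  finally show ?thesis
    by (simp add: tensor_action_def \<chi>_def comp_assoc circ.merges)
qed

lemma chi_coassoc: "(\<chi> \<bullet>\<^sub>m \<one> (obj H)) \<cdot> \<chi> = inv (a\<^sub>\<bullet> (obj A) (obj H) (obj H)) \<cdot> ((\<one> (obj A) \<bullet>\<^sub>m comult H) \<cdot> \<chi>)"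
proof -
  let ?A = "obj A" let ?H = "obj H"
  have "(\<chi> \<bullet>\<^sub>m \<one> ?H) \<cdot> \<chi> = (\<one> ?A \<bullet>\<^sub>m \<pi> \<bullet>\<^sub>m \<pi>) \<cdot> ((comult A \<bullet>\<^sub>m \<one> ?A) \<cdot> comult A)"
    by (simp add: \<chi>_def comp_assoc bul.merges)
  also have "\<dots> = (\<one> ?A \<bullet>\<^sub>m \<pi> \<bullet>\<^sub>m \<pi>) \<cdot> (inv (a\<^sub>\<bullet> ?A ?A ?A) \<cdot> ((\<one> ?A \<bullet>\<^sub>m comult A) \<cdot> comult A))"
    by (simp add: coassoc')
  also have "\<dots> = inv (a\<^sub>\<bullet> ?A ?H ?H) \<cdot> ((\<one> ?A \<bullet>\<^sub>m (\<pi> \<bullet>\<^sub>m \<pi>)) \<cdot> ((\<one> ?A \<bullet>\<^sub>m comult A) \<cdot> comult A))"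
    using bul.nat_ai'[of "\<one> ?A" ?A \<pi> ?H \<pi> ?H "(\<one> ?A \<bullet>\<^sub>m comult A) \<cdot> comult A"] by simp
  also have "\<dots> = inv (a\<^sub>\<bullet> ?A ?H ?H) \<cdot> ((\<one> ?A \<bullet>\<^sub>m comult H) \<cdot> \<chi>)"
    by (simp add: \<chi>_def bul.merges bimon_homD(7)[OF pi_hom])
  finally show ?thesis .
qed

lemma chi_counit: "r\<^sub>\<bullet> (obj A) \<cdot> ((\<one> (obj A) \<bullet>\<^sub>m counit H) \<cdot> \<chi>) = \<one> (obj A)"
  by (simp add: \<chi>_def bul.merges bimon_homD(8)[OF pi_hom] rcounit)

text \<open>
  Both sides agree after the Galois map of the module \<open>A \<bullet> H\<close>, which is injective; this avoids the fact that the
  antipode reverses multiplication and comultiplication.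
\<close>

lemma w_coinvariant: "((\<chi> \<bullet>\<^sub>m \<one> \<I>) \<odot>\<^sub>m \<one> (obj H)) \<cdot> w = (coinv \<odot>\<^sub>m \<one> (obj H)) \<cdot> w"
proof -
  let ?A = "obj A" let ?H = "obj H" let ?T = "tensor_action H ?A ?H \<rho> (mult H)"
  let ?b = "beta H (?A \<bullet> ?H) ?T"
  have mod: "right_module H (?A \<bullet> ?H) ?T"
    by (intro right_module_tensor right_module right_module_regular) simp_all
  have n: "?b \<cdot> ((\<chi> \<bullet>\<^sub>m \<one> \<I>) \<odot>\<^sub>m \<one> ?H) = (\<chi> \<bullet>\<^sub>m \<one> ?H) \<cdot> beta H ?A \<rho>"
    by (rule beta_natural[OF bimonoid bimonoid right_module mod]) (simp_all add: chi_act)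
  \<comment> \<open>By naturality along \<open>\<chi>\<close> the left-hand side becomes the
    iterated coaction; coassociativity and \<open>beta_coinvariants\<close> give the same for the
    right-hand side.\<close>
  have "?b \<cdot> (((\<chi> \<bullet>\<^sub>m \<one> \<I>) \<odot>\<^sub>m \<one> ?H) \<cdot> w) = ((\<chi> \<bullet>\<^sub>m \<one> ?H) \<cdot> beta H ?A \<rho>) \<cdot> w"
    by (simp add: comp_reduce[OF n] mod)
  also have "\<dots> = (\<chi> \<bullet>\<^sub>m \<one> ?H) \<cdot> \<chi>" by (simp add: comp_assoc beta_w right_module)
  also have "\<dots> = (inv (a\<^sub>\<bullet> ?A ?H ?H) \<cdot> ((\<one> ?A \<bullet>\<^sub>m comult H) \<cdot> beta H ?A \<rho>)) \<cdot> w"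
    by (simp add: comp_assoc beta_w right_module chi_coassoc)
  also have "\<dots> = ?b \<cdot> ((coinv \<odot>\<^sub>m \<one> ?H) \<cdot> w)"
    unfolding beta_coinvariants[OF bimonoid right_module, symmetric] by (simp add: comp_assoc coinv_def mod)
  finally have "beta_inv (?A \<bullet> ?H) ?T \<cdot> (?b \<cdot> (((\<chi> \<bullet>\<^sub>m \<one> \<I>) \<odot>\<^sub>m \<one> ?H) \<cdot> w)) = beta_inv (?A \<bullet> ?H) ?T \<cdot> (?b \<cdot> ((coinv \<odot>\<^sub>m \<one> ?H) \<cdot> w))"
    by simp
  then show ?thesis by (simp add: comp_reduce[OF beta_inv_beta[OF mod]] mod)
qed

lemma coinv_colinear: "coact_I (obj A \<bullet> obj H) \<cdot> coinv = (coinv \<bullet>\<^sub>m \<one> \<I>) \<cdot> coact_I (obj A)"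
proof -
  have "coact_I (obj A \<bullet> obj H) \<cdot> coinv = (\<one> (obj A) \<bullet>\<^sub>m unit H \<bullet>\<^sub>m \<one> \<I> \<bullet>\<^sub>m \<one> \<I>) \<cdot> (coact_I (obj A \<bullet> \<I>) \<cdot> coact_I (obj A))"
    by (simp add: coinv_def comp_reduce[OF coact_I_natural] comp_assoc)
  then show ?thesis by (simp add: coact_I_coassoc coinv_def bul.merges)
qed

text \<open>Both \<open>\<chi> \<bullet> 1\<close> and \<open>coinv\<close> are colinear, hence
  commute with \<open>gamma_loop\<close>; their agreement on \<open>w\<close> therefore passes to
  \<open>V\<close> and to \<open>e\<close>.\<close>

lemma e_coinvariant: "(\<chi> \<bullet>\<^sub>m \<one> \<I>) \<cdot> e = coinv \<cdot> e"
proof -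
  let ?A = "obj A" let ?H = "obj H"
  let ?v = "(\<one> (?A \<bullet> \<I>) \<odot>\<^sub>m counit H) \<cdot> w"
  let ?c = "\<chi> \<bullet>\<^sub>m \<one> \<I>"
  have "(\<chi> \<bullet>\<^sub>m \<one> \<I> \<odot>\<^sub>m \<one> \<J>) \<cdot> ?v = (\<one> (?A \<bullet> ?H \<bullet> \<I>) \<odot>\<^sub>m counit H) \<cdot> ((?c \<odot>\<^sub>m \<one> ?H) \<cdot> w)"
    by (simp add: circ.merges)
  also have "\<dots> = (coinv \<odot>\<^sub>m \<one> \<J>) \<cdot> ?v"
    unfolding w_coinvariant by (simp add: circ.merges)
  finally have v: "(?c \<odot>\<^sub>m \<one> \<J>) \<cdot> ?v = (coinv \<odot>\<^sub>m \<one> \<J>) \<cdot> ?v" .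
  have n: "(?c \<odot>\<^sub>m \<one> \<I>) \<cdot> gamma_loop (coact_I ?A) \<I> = gamma_loop (coact_I (?A \<bullet> ?H)) \<I> \<cdot> ((?c \<odot>\<^sub>m \<one> \<J>) \<bullet>\<^sub>m \<one> \<I>)"
    by (rule gamma_loop_natural[symmetric]) (simp_all add: coact_I_natural)
  have "(?c \<odot>\<^sub>m \<one> \<I>) \<cdot> V = gamma_loop (coact_I (?A \<bullet> ?H)) \<I> \<cdot> (((?c \<odot>\<^sub>m \<one> \<J>) \<cdot> ?v) \<bullet>\<^sub>m \<one> \<I>)"
    by (simp add: V_def comp_reduce[OF n] comp_assoc bul.merges)
  also have "\<dots> = (gamma_loop (coact_I (?A \<bullet> ?H)) \<I> \<cdot> ((coinv \<odot>\<^sub>m \<one> \<J>) \<bullet>\<^sub>m \<one> \<I>)) \<cdot> (?v \<bullet>\<^sub>m \<one> \<I>)"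
    unfolding v by (simp add: comp_assoc bul.merges)
  also have "gamma_loop (coact_I (?A \<bullet> ?H)) \<I> \<cdot> ((coinv \<odot>\<^sub>m \<one> \<J>) \<bullet>\<^sub>m \<one> \<I>) = (coinv \<odot>\<^sub>m \<one> \<I>) \<cdot> gamma_loop (coact_I ?A) \<I>"
    by (rule gamma_loop_natural) (simp_all add: coinv_colinear)
  finally have "(?c \<odot>\<^sub>m \<one> \<I>) \<cdot> V = (coinv \<odot>\<^sub>m \<one> \<I>) \<cdot> V" by (simp add: V_def comp_assoc)
  then have "r\<^sub>\<odot> (?A \<bullet> ?H \<bullet> \<I>) \<cdot> ((?c \<odot>\<^sub>m \<one> \<I>) \<cdot> V) = r\<^sub>\<odot> (?A \<bullet> ?H \<bullet> \<I>) \<cdot> ((coinv \<odot>\<^sub>m \<one> \<I>) \<cdot> V)" by simp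
  then show ?thesis by (simp add: circ.nats e_def)
qed

text \<open>The counit of the unit object applied to \<open>e_coinvariant\<close>. It exhibits
  \<open>e0\<close> and \<open>e\<close> as a cone over \<open>\<chi>\<close> and
  \<open>1 \<bullet> u_H\<close>, through which \<open>e0\<close> will reach the kernel.\<close>

lemma chi_e0: "\<chi> \<cdot> e0 = (\<one> (obj A) \<bullet>\<^sub>m unit H) \<cdot> e"
proof -
  let ?A = "obj A" let ?H = "obj H"
  have "\<chi> \<cdot> e0 = r\<^sub>\<bullet> (?A \<bullet> ?H) \<cdot> ((\<chi> \<bullet>\<^sub>m \<one> \<J>) \<cdot> ((\<one> ?A \<bullet>\<^sub>m \<epsilon>\<^sub>I) \<cdot> e))"
    by (simp add: e0_def bul.nats)
  also have "\<dots> = r\<^sub>\<bullet> (?A \<bullet> ?H) \<cdot> ((\<one> (?A \<bullet> ?H) \<bullet>\<^sub>m \<epsilon>\<^sub>I) \<cdot> ((\<chi> \<bullet>\<^sub>m \<one> \<I>) \<cdot> e))"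
    by (simp add: bul.merges)
  also have "\<dots> = r\<^sub>\<bullet> (?A \<bullet> ?H) \<cdot> (((\<one> ?A \<bullet>\<^sub>m unit H) \<bullet>\<^sub>m \<one> \<J>) \<cdot> ((\<one> (?A \<bullet> \<I>) \<bullet>\<^sub>m \<epsilon>\<^sub>I) \<cdot> (coact_I ?A \<cdot> e)))"
    unfolding e_coinvariant by (simp add: coinv_def comp_assoc bul.merges)
  also have "\<dots> = (\<one> ?A \<bullet>\<^sub>m unit H) \<cdot> e"
    by (simp add: bul.nats comp_reduce3[OF coact_I_counit])
  finally show ?thesis .
qed

text \<open>Since \<open>\<rho> \<bullet> 1\<close> is colinear, the action may be applied before
  \<open>gamma_loop\<close>; this carries \<open>varphi_ext_gamma_loop\<close> over to
  \<open>Omega\<close>.\<close>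

lemma Omega_gamma_loop:
  "Omega (obj A) \<rho> U \<cdot> a\<^sub>\<bullet> (obj A) (obj H) U
     = gamma_loop (coact_I (obj A)) U \<cdot> ((((\<rho> \<bullet>\<^sub>m \<one> \<I>) \<odot>\<^sub>m \<one> \<J>) \<cdot> (varphi C (obj A) (obj H) \<cdot> (\<one> (obj A) \<bullet>\<^sub>m S))) \<bullet>\<^sub>m \<one> U)"
proof -
  let ?A = "obj A" let ?H = "obj H"
  have "Omega ?A \<rho> U \<cdot> a\<^sub>\<bullet> ?A ?H U = ((\<rho> \<bullet>\<^sub>m \<one> \<I>) \<odot>\<^sub>m \<one> U) \<cdot> ((varphi_ext ?A ?H U \<cdot> a\<^sub>\<bullet> ?A ?H\<^sup>- U) \<cdot> ((\<one> ?A \<bullet>\<^sub>m S) \<bullet>\<^sub>m \<one> U))"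
    using bul.nat_a[of "\<one> ?A" ?A S "?H\<^sup>-" "\<one> U" U] by (simp add: Omega_def comp_assoc)
  also have "\<dots> = (((\<rho> \<bullet>\<^sub>m \<one> \<I>) \<odot>\<^sub>m \<one> U) \<cdot> gamma_loop (coact_I (?A \<odot> ?H)) U) \<cdot> ((varphi C ?A ?H \<cdot> (\<one> ?A \<bullet>\<^sub>m S)) \<bullet>\<^sub>m \<one> U)"
    unfolding varphi_ext_gamma_loop by (simp add: comp_assoc bul.merges coact_I_def)
  also have "((\<rho> \<bullet>\<^sub>m \<one> \<I>) \<odot>\<^sub>m \<one> U) \<cdot> gamma_loop (coact_I (?A \<odot> ?H)) U = gamma_loop (coact_I ?A) U \<cdot> (((\<rho> \<bullet>\<^sub>m \<one> \<I>) \<odot>\<^sub>m \<one> \<J>) \<bullet>\<^sub>m \<one> U)"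
    by (rule gamma_loop_natural[symmetric]) (simp_all add: coact_I_natural)
  finally show ?thesis by (simp add: comp_assoc bul.merges)
qed

text \<open>The detour through \<open>J\<close> amounts to \<open>Omega\<close> at the unit: the
  counit removes the copy of \<open>\<pi> a\<close> that \<open>beta_inv\<close> keeps, and
  \<open>gamma_loop\<close> puts the base point in its place. In this form \<open>V\<close> visibly
  factors through \<open>\<chi> \<bullet> 1\<close>, as \<open>e_w\<close> requires.\<close>

lemma V_Omega: "V = Omega (obj A) \<rho> \<I> \<cdot> (a\<^sub>\<bullet> (obj A) (obj H) \<I> \<cdot> (\<chi> \<bullet>\<^sub>m \<one> \<I>))"
proof -
  let ?A = "obj A" let ?H = "obj H"
  let ?e = "\<one> (?A \<bullet> \<I>) \<odot>\<^sub>m counit H"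
  have "inv (r\<^sub>\<bullet> ?H) \<cdot> (r\<^sub>\<bullet> ?H \<cdot> ((\<one> ?H \<bullet>\<^sub>m counit H) \<cdot> comult H)) = inv (r\<^sub>\<bullet> ?H)" by (simp add: rcounit)
  then have c: "(\<one> ?H \<bullet>\<^sub>m counit H) \<cdot> comult H = inv (r\<^sub>\<bullet> ?H)" by simp
  have s: "(S \<bullet>\<^sub>m \<one> \<J>) \<cdot> inv (r\<^sub>\<bullet> ?H) = inv (r\<^sub>\<bullet> ?H\<^sup>-) \<cdot> S" using bul.nat_ri[of S ?H] by simp
  have "?e \<cdot> w = ?e \<cdot> Omega ?A \<rho> ?H \<cdot> ((\<one> ?A \<bullet>\<^sub>m comult H) \<cdot> \<chi>)"
    by (simp add: w_def beta_inv_def comp_assoc right_module)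
  also have "?e \<cdot> Omega ?A \<rho> ?H = Omega ?A \<rho> \<J> \<cdot> (\<one> ?A \<bullet>\<^sub>m (\<one> ?H \<bullet>\<^sub>m counit H))"
    using Omega_natural[OF right_module, of "counit H" \<J>] by simp
  also have "\<dots> \<cdot> ((\<one> ?A \<bullet>\<^sub>m comult H) \<cdot> \<chi>) = Omega ?A \<rho> \<J> \<cdot> ((\<one> ?A \<bullet>\<^sub>m inv (r\<^sub>\<bullet> ?H)) \<cdot> \<chi>)"
    by (simp add: comp_assoc bul.merges c right_module)
  also have "\<dots> = ((\<rho> \<bullet>\<^sub>m \<one> \<I>) \<odot>\<^sub>m \<one> \<J>) \<cdot> (varphi C ?A ?H \<cdot> ((\<one> ?A \<bullet>\<^sub>m S) \<cdot> \<chi>))"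
    by (simp add: Omega_def varphi_eq_varphi_ext comp_assoc bul.merges s)
  finally have "V = Omega ?A \<rho> \<I> \<cdot> a\<^sub>\<bullet> ?A ?H \<I> \<cdot> (\<chi> \<bullet>\<^sub>m \<one> \<I>)"
    unfolding V_def Omega_gamma_loop by (simp add: comp_assoc bul.merges)
  then show ?thesis by (simp add: comp_assoc right_module)
qed

text \<open>The identity \<open>a 1^-1 = a\<close> is obtained from injectivity instead of a law for
  the antipode: after the monomorphism \<open>1 \<bullet> u_H\<close>, it follows from
  \<open>beta_unit\<close> and \<open>beta_beta_inv\<close>.\<close>

lemma Omega_unit: "r\<^sub>\<odot> (obj A \<bullet> \<I>) \<cdot> (Omega (obj A) \<rho> \<I> \<cdot> (\<one> (obj A) \<bullet>\<^sub>m ((unit H \<bullet>\<^sub>m \<one> \<I>) \<cdot> \<Delta>\<^sub>I))) = \<one> (obj A \<bullet> \<I>)"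
proof -
  let ?A = "obj A" let ?H = "obj H"
  let ?x = "Omega ?A \<rho> \<I> \<cdot> (\<one> ?A \<bullet>\<^sub>m ((unit H \<bullet>\<^sub>m \<one> \<I>) \<cdot> \<Delta>\<^sub>I))"
  note [simp] = right_module
  have "(\<one> ?A \<bullet>\<^sub>m unit H) \<cdot> (r\<^sub>\<odot> (?A \<bullet> \<I>) \<cdot> ?x) = beta H ?A \<rho> \<cdot> (\<one> (?A \<bullet> \<I>) \<odot>\<^sub>m unit H) \<cdot> ?x"
    unfolding beta_unit[OF bimonoid right_module] by (simp add: comp_assoc)
  also have "\<dots> = beta H ?A \<rho> \<cdot> ((\<one> (?A \<bullet> \<I>) \<odot>\<^sub>m unit H) \<cdot> Omega ?A \<rho> \<I> \<cdot> (\<one> ?A \<bullet>\<^sub>m ((unit H \<bullet>\<^sub>m \<one> \<I>) \<cdot> \<Delta>\<^sub>I)))"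
    by (simp add: comp_assoc)
  also have "(\<one> (?A \<bullet> \<I>) \<odot>\<^sub>m unit H) \<cdot> Omega ?A \<rho> \<I> = Omega ?A \<rho> ?H \<cdot> (\<one> ?A \<bullet>\<^sub>m (\<one> ?H \<bullet>\<^sub>m unit H))"
    using Omega_natural[OF right_module, of "unit H" ?H] by simp
  also have "beta H ?A \<rho> \<cdot> (\<dots> \<cdot> (\<one> ?A \<bullet>\<^sub>m ((unit H \<bullet>\<^sub>m \<one> \<I>) \<cdot> \<Delta>\<^sub>I))) = beta H ?A \<rho> \<cdot> (beta_inv ?A \<rho> \<cdot> (\<one> ?A \<bullet>\<^sub>m unit H))"
    by (simp add: beta_inv_def comp_assoc bul.merges comult_unit)
  also have "\<dots> = (\<one> ?A \<bullet>\<^sub>m unit H) \<cdot> \<one> (?A \<bullet> \<I>)"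
    by (simp add: comp_reduce[OF beta_beta_inv])
  finally show ?thesis by (rule monicD[OF monic_unit, rotated 3]) simp_all
qed

text \<open>By \<open>V_Omega\<close>, \<open>e\<close> is \<open>?f\<close> after
  \<open>\<chi> \<bullet> 1\<close>. On the first component of \<open>w\<close> the latter may be
  replaced by \<open>coinv\<close>, of which \<open>?f\<close> is a left inverse.\<close>

lemma e_w: "(e \<odot>\<^sub>m \<one> (obj H)) \<cdot> w = w"
proof -
  let ?A = "obj A" let ?H = "obj H"
  let ?f = "r\<^sub>\<odot> (?A \<bullet> \<I>) \<cdot> (Omega ?A \<rho> \<I> \<cdot> a\<^sub>\<bullet> ?A ?H \<I>)"
  note [simp] = right_module
  have "a\<^sub>\<bullet> ?A ?H \<I> \<cdot> coinv = \<one> ?A \<bullet>\<^sub>m ((unit H \<bullet>\<^sub>m \<one> \<I>) \<cdot> \<Delta>\<^sub>I)"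
    by (simp add: coinv_def coact_I_def bul.nat_a' bul.merges)
  then have f: "?f \<cdot> coinv = \<one> (?A \<bullet> \<I>)" by (simp add: comp_assoc Omega_unit)
  have "(e \<odot>\<^sub>m \<one> ?H) \<cdot> w = (?f \<odot>\<^sub>m \<one> ?H) \<cdot> (((\<chi> \<bullet>\<^sub>m \<one> \<I>) \<odot>\<^sub>m \<one> ?H) \<cdot> w)"
    by (simp add: e_def V_Omega comp_assoc circ.merges)
  also have "\<dots> = ((?f \<cdot> coinv) \<odot>\<^sub>m \<one> ?H) \<cdot> w"
    unfolding w_coinvariant by (simp add: circ.merges)
  finally show ?thesis unfolding f by simp
qed

text \<open>After \<open>e\<close> is absorbed into \<open>w\<close>, the claim reads
  \<open>(a (\<sigma> (\<pi> a))^-1) \<sigma> (\<pi> a) = a\<close>, which is \<open>beta_w\<close>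
  with both sides hit by the counit of \<open>H\<close>. Once \<open>e0\<close> factors through the
  kernel, this is the right inverse of the product map.\<close>

lemma reconstruct: "mult A \<cdot> ((e0 \<odot>\<^sub>m \<sigma>) \<cdot> w) = \<one> (obj A)"
proof -
  let ?A = "obj A" let ?H = "obj H" let ?c = "r\<^sub>\<bullet> ?A \<cdot> (\<one> ?A \<bullet>\<^sub>m \<epsilon>\<^sub>I)"
  have "mult A \<cdot> ((e0 \<odot>\<^sub>m \<sigma>) \<cdot> w) = \<rho> \<cdot> ((?c \<odot>\<^sub>m \<one> ?H) \<cdot> ((e \<odot>\<^sub>m \<one> ?H) \<cdot> w))"
    by (simp add: \<rho>_def e0_def comp_assoc circ.merges)
  also have "\<dots> = (\<rho> \<cdot> (?c \<odot>\<^sub>m \<one> ?H)) \<cdot> w"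
    unfolding e_w by (simp add: comp_assoc)
  also have "\<dots> = \<one> ?A"
    unfolding beta_counit[OF bimonoid right_module, symmetric]
    by (simp add: comp_assoc right_module beta_w chi_counit)
  finally show ?thesis .
qed

end

section \<open>Kernels as intersections\<close>

context category
begin

lemma binary_intersectionD:
  assumes "binary_intersection C P p q f g"
  shows "Dom C p = P" "Cod C p = Dom C f" "Dom C q = P" "Cod C q = Dom C g" "Cod C g = Cod C f"
    "f \<cdot> p = g \<cdot> q" "monic C f" "monic C g"
  using assms by (simp_all add: binary_intersection_def pullback_in_def hom_def)

lemma binary_intersection_factor:
  assumes "binary_intersection C P p q f g"
    and "Cod C x = Dom C f" "Cod C y = Dom C g" "Dom C x = Dom C y" "f \<cdot> x = g \<cdot> y"
  obtains h where "Dom C h = Dom C x" "Cod C h = P" "p \<cdot> h = x" "q \<cdot> h = y"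
proof -
  have "x \<in> hom C (Dom C x) (Dom C f)" "y \<in> hom C (Dom C x) (Dom C g)"
    using assms(2-4) by (simp_all add: hom_def)
  then have "\<exists>h. h \<in> hom C (Dom C x) P \<and> p \<cdot> h = x \<and> q \<cdot> h = y"
    using assms(1,5) unfolding binary_intersection_def pullback_in_def by blast
  then show ?thesis using that by (auto simp: hom_def)
qed

lemma binary_intersection_monic:
  assumes "binary_intersection C P p q f g"
  shows "monic C p"
  unfolding monic_def
proof clarify
  note d = binary_intersectionD[OF assms]
  fix x y assume xy: "Cod C x = Dom C p" "Cod C y = Dom C p" "Dom C x = Dom C y" and eq: "p \<cdot> x = p \<cdot> y"
  have "g \<cdot> (q \<cdot> x) = f \<cdot> (p \<cdot> x)" using d(1-5) xy(1) by (simp add: comp_reduce[OF d(6)] comp_assoc)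
  also have "\<dots> = f \<cdot> (p \<cdot> y)" unfolding eq ..
  also have "\<dots> = g \<cdot> (q \<cdot> y)" using d(1-5) xy(2) by (simp add: comp_reduce[OF d(6)] comp_assoc)
  finally have "q \<cdot> x = q \<cdot> y"
    by (rule monicD[OF d(8), rotated 3]) (use d(1-5) xy in simp_all)
  moreover have "\<exists>!h. h \<in> hom C (Dom C x) P \<and> p \<cdot> h = p \<cdot> x \<and> q \<cdot> h = q \<cdot> x"
  proof -
    have "p \<cdot> x \<in> hom C (Dom C x) (Dom C f)" "q \<cdot> x \<in> hom C (Dom C x) (Dom C g)"
      using d(1-5) xy(1) by (simp_all add: hom_def)
    moreover have "f \<cdot> (p \<cdot> x) = g \<cdot> (q \<cdot> x)" using d(1-5) xy(1) by (simp add: comp_reduce[OF d(6)] comp_assoc)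
    ultimately show ?thesis
      using assms unfolding binary_intersection_def pullback_in_def by blast
  qed
  moreover have "x \<in> hom C (Dom C x) P" "y \<in> hom C (Dom C x) P" using xy d(1) by (simp_all add: hom_def)
  ultimately show "x = y" using eq by metis
qed

text \<open>A monomorphism intersected with itself has identity projections; the image square is
  again an intersection, and these consist of monomorphisms by definition.\<close>

lemma preserves_monic:
  assumes "preserves_binary_intersections C FO FM" "monic C f"
  shows "monic C (FM f)"
proof -
  have "binary_intersection C (Dom C f) (\<one> (Dom C f)) (\<one> (Dom C f)) f f"
    unfolding binary_intersection_def pullback_in_def
  proof (intro conjI allI ballI impI)
    fix Q x y assume xy: "x \<in> hom C Q (Dom C f)" "y \<in> hom C Q (Dom C f)" and eq: "f \<cdot> x = f \<cdot> y"
    have "x = y" by (rule monicD[OF assms(2) _ _ _ eq]) (use xy in \<open>simp_all add: hom_def\<close>)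
    show "\<exists>!h. h \<in> hom C Q (Dom C f) \<and> \<one> (Dom C f) \<cdot> h = x \<and> \<one> (Dom C f) \<cdot> h = y"
    proof (intro ex1I[of _ x] conjI)
      fix h assume "h \<in> hom C Q (Dom C f) \<and> \<one> (Dom C f) \<cdot> h = x \<and> \<one> (Dom C f) \<cdot> h = y"
      then show "h = x" using ident_comp'[of h "Dom C f"] unfolding hom_def by simp
    qed (use xy \<open>x = y\<close> in \<open>simp_all add: hom_def\<close>)
  qed (use assms(2) in \<open>simp_all add: hom_def\<close>)
  then show ?thesis using assms(1) unfolding preserves_binary_intersections_def binary_intersection_def by blast
qed

end

section \<open>Bimonoid structure tested along monomorphisms\<close>

context duoidal_category
begin

lemma bimon_homI:
  assumes "is_bimonoid C A" "is_bimonoid C B" "Dom C f = obj A" "Cod C f = obj B"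
    "f \<cdot> mult A = mult B \<cdot> (f \<odot>\<^sub>m f)" "f \<cdot> unit A = unit B"
    "comult B \<cdot> f = (f \<bullet>\<^sub>m f) \<cdot> comult A" "counit B \<cdot> f = counit A"
  shows "f \<in> bimon_hom C A B"
  using assms by (simp add: bimon_hom_def hom_def)

lemma bimon_hom_comp:
  assumes f: "f \<in> bimon_hom C A B" and g: "g \<in> bimon_hom C B D"
  shows "g \<cdot> f \<in> bimon_hom C A D"
proof -
  note [simp] = bimon_homD(1-4)[OF f] bimon_homD(2-4)[OF g]
  show ?thesis
    by (rule bimon_homI)
      (simp_all add: comp_assoc bimon_homD(5-8)[OF f] comp_reduce[OF bimon_homD(5)[OF g]] bimon_homD(6)[OF g]
        comp_reduce[OF bimon_homD(7)[OF g]] comp_reduce[OF bimon_homD(8)[OF g]] circ.merges bul.merges)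
qed

lemma bimon_hom_ident: "is_bimonoid C A \<Longrightarrow> \<one> (obj A) \<in> bimon_hom C A A"
  by (rule bimon_homI) simp_all

text \<open>Each equation is tested after composing with \<open>m\<close>; the one for
  comultiplications has its values in a tensor square and is tested with
  \<open>m \<bullet> m\<close>.\<close>

lemma bimon_hom_reflect:
  assumes m: "m \<in> bimon_hom C B D" "monic C m" "monic C (m \<bullet>\<^sub>m m)"
    and x: "Dom C x = obj A" "Cod C x = obj B" "m \<cdot> x \<in> bimon_hom C A D"
  shows "x \<in> bimon_hom C A B"
proof -
  note [simp] = bimon_homD(1-4)[OF m(1)] bimon_homD(1)[OF x(3)] x(1,2)
  have "m \<cdot> (x \<cdot> mult A) = m \<cdot> (mult B \<cdot> (x \<odot>\<^sub>m x))"
    using bimon_homD(5)[OF x(3)] by (simp add: comp_assoc comp_reduce[OF bimon_homD(5)[OF m(1)]] circ.merges)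
  then have 1: "x \<cdot> mult A = mult B \<cdot> (x \<odot>\<^sub>m x)" by (rule monicD[OF m(2), rotated 3]) simp_all
  have "m \<cdot> (x \<cdot> unit A) = m \<cdot> unit B"
    using bimon_homD(6)[OF x(3)] by (simp add: comp_assoc bimon_homD(6)[OF m(1)])
  then have 2: "x \<cdot> unit A = unit B" by (rule monicD[OF m(2), rotated 3]) simp_all
  have "(m \<bullet>\<^sub>m m) \<cdot> (comult B \<cdot> x) = (comult D \<cdot> m) \<cdot> x"
    unfolding bimon_homD(7)[OF m(1)] by (simp add: comp_assoc)
  also have "\<dots> = (m \<bullet>\<^sub>m m) \<cdot> ((x \<bullet>\<^sub>m x) \<cdot> comult A)"
    using bimon_homD(7)[OF x(3)] by (simp add: comp_assoc bul.merges)
  finally have 3: "comult B \<cdot> x = (x \<bullet>\<^sub>m x) \<cdot> comult A" by (rule monicD[OF m(3), rotated 3]) simp_all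
  have "counit B \<cdot> x = (counit D \<cdot> m) \<cdot> x" unfolding bimon_homD(8)[OF m(1)] ..
  also have "\<dots> = counit A" using bimon_homD(8)[OF x(3)] by (simp add: comp_assoc)
  finally have 4: "counit B \<cdot> x = counit A" .
  show ?thesis by (rule bimon_homI) (simp_all add: 1 2 3 4)
qed

lemma bimon_hom_inverse:
  assumes f: "f \<in> bimon_hom C A B" and g: "Dom C g = obj B" "Cod C g = obj A"
    and fg: "f \<cdot> g = \<one> (obj B)" "g \<cdot> f = \<one> (obj A)"
  shows "g \<in> bimon_hom C B A"
proof (rule bimon_hom_reflect[OF f])
  note [simp] = bimon_homD(1-4)[OF f] g
  show "monic C f" by (rule split_monic[of g]) (simp_all add: fg)
  show "monic C (f \<bullet>\<^sub>m f)" by (rule split_monic[of "g \<bullet>\<^sub>m g"]) (simp_all add: fg bul.merges)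
  show "f \<cdot> g \<in> bimon_hom C B B" unfolding fg by (rule bimon_hom_ident) simp
qed (use g in simp_all)

text \<open>The laws are tested in their targets, which contain only powers of \<open>N\<close>
  under \<open>\<bullet>\<close>. This is why monicity is asked of these powers of \<open>p\<close>,
  and it suits a setting where only \<open>\<bullet>\<close> is known to preserve
  monomorphisms.\<close>

lemma sub_bimonoid:
  assumes A: "is_bimonoid C A" and p: "Dom C p = obj N" "Cod C p = obj A"
    and monic: "monic C p" "monic C (p \<bullet>\<^sub>m p)" "monic C (p \<bullet>\<^sub>m (p \<bullet>\<^sub>m p))"
    and m: "Dom C (mult N) = obj N \<odot> obj N" "Cod C (mult N) = obj N" "p \<cdot> mult N = mult A \<cdot> (p \<odot>\<^sub>m p)"
    and u: "Dom C (unit N) = \<I>" "Cod C (unit N) = obj N" "p \<cdot> unit N = unit A"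
    and d: "Dom C (comult N) = obj N" "Cod C (comult N) = obj N \<bullet> obj N" "(p \<bullet>\<^sub>m p) \<cdot> comult N = comult A \<cdot> p"
    and e: "counit N = counit A \<cdot> p"
  shows "p \<in> bimon_hom C N A"
proof -
  note [simp] = bimonoid_simps[OF A] p m(1,2) u(1,2) d(1,2)
  let ?N = "obj N" let ?m = "mult N" let ?d = "comult N"
  have e': "Dom C (counit N) = ?N" "Cod C (counit N) = \<J>" by (simp_all add: e)
  have assoc: "?m \<cdot> (?m \<odot>\<^sub>m \<one> ?N) = ?m \<cdot> ((\<one> ?N \<odot>\<^sub>m ?m) \<cdot> a\<^sub>\<odot> ?N ?N ?N)"
  proof -
    have "p \<cdot> (?m \<cdot> (?m \<odot>\<^sub>m \<one> ?N)) = (mult A \<cdot> (mult A \<odot>\<^sub>m \<one> (obj A))) \<cdot> (p \<odot>\<^sub>m p \<odot>\<^sub>m p)"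
      by (simp add: comp_reduce[OF m(3)] comp_assoc circ.merges m(3))
    also have "\<dots> = p \<cdot> (?m \<cdot> ((\<one> ?N \<odot>\<^sub>m ?m) \<cdot> a\<^sub>\<odot> ?N ?N ?N))"
      unfolding mult_assoc[OF A] by (simp add: comp_reduce[OF m(3)] comp_assoc circ.nat_a circ.merges m(3))
    finally show ?thesis by (rule monicD[OF monic(1), rotated 3]) simp_all
  qed
  have lunit: "?m \<cdot> (unit N \<odot>\<^sub>m \<one> ?N) = l\<^sub>\<odot> ?N"
  proof -
    have "p \<cdot> (?m \<cdot> (unit N \<odot>\<^sub>m \<one> ?N)) = (mult A \<cdot> (unit A \<odot>\<^sub>m \<one> (obj A))) \<cdot> (\<one> \<I> \<odot>\<^sub>m p)"
      by (simp add: comp_reduce[OF m(3)] comp_assoc circ.merges u(3))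
    also have "\<dots> = p \<cdot> l\<^sub>\<odot> ?N" unfolding mult_lunit[OF A] by (simp add: circ.nat_l)
    finally show ?thesis by (rule monicD[OF monic(1), rotated 3]) simp_all
  qed
  have runit: "?m \<cdot> (\<one> ?N \<odot>\<^sub>m unit N) = r\<^sub>\<odot> ?N"
  proof -
    have "p \<cdot> (?m \<cdot> (\<one> ?N \<odot>\<^sub>m unit N)) = (mult A \<cdot> (\<one> (obj A) \<odot>\<^sub>m unit A)) \<cdot> (p \<odot>\<^sub>m \<one> \<I>)"
      by (simp add: comp_reduce[OF m(3)] comp_assoc circ.merges u(3))
    also have "\<dots> = p \<cdot> r\<^sub>\<odot> ?N" unfolding mult_runit[OF A] by (simp add: circ.nat_r)
    finally show ?thesis by (rule monicD[OF monic(1), rotated 3]) simp_all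
  qed
  have coassoc: "a\<^sub>\<bullet> ?N ?N ?N \<cdot> ((?d \<bullet>\<^sub>m \<one> ?N) \<cdot> ?d) = (\<one> ?N \<bullet>\<^sub>m ?d) \<cdot> ?d"
  proof -
    have "(p \<bullet>\<^sub>m (p \<bullet>\<^sub>m p)) \<cdot> (a\<^sub>\<bullet> ?N ?N ?N \<cdot> ((?d \<bullet>\<^sub>m \<one> ?N) \<cdot> ?d)) = a\<^sub>\<bullet> (obj A) (obj A) (obj A) \<cdot> ((p \<bullet>\<^sub>m p \<bullet>\<^sub>m p) \<cdot> ((?d \<bullet>\<^sub>m \<one> ?N) \<cdot> ?d))"
      by (simp add: bul.nat_a')
    also have "\<dots> = a\<^sub>\<bullet> (obj A) (obj A) (obj A) \<cdot> (((comult A \<cdot> p) \<bullet>\<^sub>m p) \<cdot> ?d)"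
      by (simp add: bul.merges d(3))
    also have "\<dots> = a\<^sub>\<bullet> (obj A) (obj A) (obj A) \<cdot> ((comult A \<bullet>\<^sub>m \<one> (obj A)) \<cdot> ((p \<bullet>\<^sub>m p) \<cdot> ?d))"
      by (simp add: bul.merges)
    also have "\<dots> = (a\<^sub>\<bullet> (obj A) (obj A) (obj A) \<cdot> ((comult A \<bullet>\<^sub>m \<one> (obj A)) \<cdot> comult A)) \<cdot> p"
      by (simp add: d(3) comp_assoc)
    also have "\<dots> = (\<one> (obj A) \<bullet>\<^sub>m comult A) \<cdot> ((p \<bullet>\<^sub>m p) \<cdot> ?d)"
      unfolding coassoc[OF A] d(3) by (simp add: comp_assoc)
    also have "\<dots> = (p \<bullet>\<^sub>m (comult A \<cdot> p)) \<cdot> ?d"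
      by (simp add: bul.merges)
    also have "\<dots> = (p \<bullet>\<^sub>m (p \<bullet>\<^sub>m p)) \<cdot> ((\<one> ?N \<bullet>\<^sub>m ?d) \<cdot> ?d)"
      by (simp add: bul.merges d(3))
    finally show ?thesis by (rule monicD[OF monic(3), rotated 3]) simp_all
  qed
  have lcounit: "l\<^sub>\<bullet> ?N \<cdot> ((counit N \<bullet>\<^sub>m \<one> ?N) \<cdot> ?d) = \<one> ?N"
  proof -
    have "p \<cdot> (l\<^sub>\<bullet> ?N \<cdot> ((counit N \<bullet>\<^sub>m \<one> ?N) \<cdot> ?d)) = l\<^sub>\<bullet> (obj A) \<cdot> ((\<one> \<J> \<bullet>\<^sub>m p) \<cdot> ((counit N \<bullet>\<^sub>m \<one> ?N) \<cdot> ?d))"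
      by (simp add: bul.nat_l' e')
    also have "\<dots> = l\<^sub>\<bullet> (obj A) \<cdot> ((counit A \<bullet>\<^sub>m \<one> (obj A)) \<cdot> ((p \<bullet>\<^sub>m p) \<cdot> ?d))"
      by (simp add: bul.merges e)
    also have "\<dots> = (l\<^sub>\<bullet> (obj A) \<cdot> ((counit A \<bullet>\<^sub>m \<one> (obj A)) \<cdot> comult A)) \<cdot> p"
      unfolding d(3) by (simp add: comp_assoc)
    also have "\<dots> = p \<cdot> \<one> ?N" unfolding lcounit[OF A] by simp
    finally show ?thesis by (rule monicD[OF monic(1), rotated 3]) (simp_all add: e')
  qed
  have rcounit: "r\<^sub>\<bullet> ?N \<cdot> ((\<one> ?N \<bullet>\<^sub>m counit N) \<cdot> ?d) = \<one> ?N"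
  proof -
    have "p \<cdot> (r\<^sub>\<bullet> ?N \<cdot> ((\<one> ?N \<bullet>\<^sub>m counit N) \<cdot> ?d)) = r\<^sub>\<bullet> (obj A) \<cdot> ((p \<bullet>\<^sub>m \<one> \<J>) \<cdot> ((\<one> ?N \<bullet>\<^sub>m counit N) \<cdot> ?d))"
      by (simp add: bul.nat_r' e')
    also have "\<dots> = r\<^sub>\<bullet> (obj A) \<cdot> ((\<one> (obj A) \<bullet>\<^sub>m counit A) \<cdot> ((p \<bullet>\<^sub>m p) \<cdot> ?d))"
      by (simp add: bul.merges e)
    also have "\<dots> = (r\<^sub>\<bullet> (obj A) \<cdot> ((\<one> (obj A) \<bullet>\<^sub>m counit A) \<cdot> comult A)) \<cdot> p"
      unfolding d(3) by (simp add: comp_assoc)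
    also have "\<dots> = p \<cdot> \<one> ?N" unfolding rcounit[OF A] by simp
    finally show ?thesis by (rule monicD[OF monic(1), rotated 3]) (simp_all add: e')
  qed
  have dm: "?d \<cdot> ?m = (?m \<bullet>\<^sub>m ?m) \<cdot> (\<zeta> ?N ?N ?N ?N \<cdot> (?d \<odot>\<^sub>m ?d))"
  proof -
    have "(p \<bullet>\<^sub>m p) \<cdot> (?d \<cdot> ?m) = comult A \<cdot> (p \<cdot> ?m)"
      by (simp add: comp_reduce[OF d(3)] comp_assoc)
    also have "\<dots> = (comult A \<cdot> mult A) \<cdot> (p \<odot>\<^sub>m p)" by (simp add: m(3) comp_assoc)
    also have "\<dots> = (mult A \<bullet>\<^sub>m mult A) \<cdot> (\<zeta> (obj A) (obj A) (obj A) (obj A) \<cdot> (((p \<bullet>\<^sub>m p) \<odot>\<^sub>m (p \<bullet>\<^sub>m p)) \<cdot> (?d \<odot>\<^sub>m ?d)))"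
      unfolding comult_mult[OF A] by (simp add: comp_assoc circ.merges d(3))
    also have "\<dots> = (p \<bullet>\<^sub>m p) \<cdot> ((?m \<bullet>\<^sub>m ?m) \<cdot> (\<zeta> ?N ?N ?N ?N \<cdot> (?d \<odot>\<^sub>m ?d)))"
      by (simp add: nat_zeta' bul.merges m(3))
    finally show ?thesis by (rule monicD[OF monic(2), rotated 3]) simp_all
  qed
  have em: "counit N \<cdot> ?m = m\<^sub>J \<cdot> (counit N \<odot>\<^sub>m counit N)"
  proof -
    have "counit N \<cdot> ?m = (counit A \<cdot> mult A) \<cdot> (p \<odot>\<^sub>m p)" by (simp add: e comp_assoc m(3))
    then show ?thesis unfolding counit_mult[OF A] by (simp add: e comp_assoc circ.merges)
  qed
  have du: "?d \<cdot> unit N = (unit N \<bullet>\<^sub>m unit N) \<cdot> \<Delta>\<^sub>I"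
  proof -
    have "(p \<bullet>\<^sub>m p) \<cdot> (?d \<cdot> unit N) = comult A \<cdot> (p \<cdot> unit N)" by (simp add: comp_reduce[OF d(3)] comp_assoc)
    also have "\<dots> = (p \<bullet>\<^sub>m p) \<cdot> ((unit N \<bullet>\<^sub>m unit N) \<cdot> \<Delta>\<^sub>I)" by (simp add: u(3) comult_unit[OF A] bul.merges)
    finally show ?thesis by (rule monicD[OF monic(2), rotated 3]) simp_all
  qed
  have eu: "counit N \<cdot> unit N = \<epsilon>\<^sub>I" by (simp add: e comp_assoc u(3) counit_unit[OF A])
  have "is_bimonoid C N"
    unfolding is_bimonoid_def monoid_in_def comonoid_in_def
    by (simp add: hom_def e' comp_assoc assoc lunit runit coassoc lcounit rcounit dm em du eu)
  then show ?thesis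
    by (intro bimon_homI) (simp_all add: A m(3) u(3) d(3) e)
qed

end

section \<open>The kernel computed inside \<open>C\<close>\<close>

locale split_kernel = split_bimonoid C H S A \<pi> \<sigma> + bullet_braided_duoidal_category C s
  for C :: "('o, 'm, 'z) reversible_duoidal_scheme" (structure)
    and H :: "('o, 'm) bimonoid" and S :: 'm and A :: "('o, 'm) bimonoid" and \<pi> \<sigma> :: 'm
    and s :: "'o \<Rightarrow> 'o \<Rightarrow> 'm" +
  fixes K :: "('o, 'm) bimonoid" and k :: 'm
  assumes intersections: "has_binary_intersections C"
    and preserves: "bullet_preserves_binary_intersections C"
    and cocomm: "cocommutative C s A"
    and monic_u: "monic C (unit H)"
    and kernel: "is_kernel C A H \<pi> K k"
begin

lemma preserves_l: "binary_intersection C P p q f g \<Longrightarrow>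
    binary_intersection C (X \<bullet> P) (\<one> X \<bullet>\<^sub>m p) (\<one> X \<bullet>\<^sub>m q) (\<one> X \<bullet>\<^sub>m f) (\<one> X \<bullet>\<^sub>m g)"
  using preserves unfolding bullet_preserves_binary_intersections_def preserves_binary_intersections_def by blast

lemma preserves_r: "binary_intersection C P p q f g \<Longrightarrow>
    binary_intersection C (P \<bullet> X) (p \<bullet>\<^sub>m \<one> X) (q \<bullet>\<^sub>m \<one> X) (f \<bullet>\<^sub>m \<one> X) (g \<bullet>\<^sub>m \<one> X)"
  using preserves unfolding bullet_preserves_binary_intersections_def preserves_binary_intersections_def by blast

text \<open>One-sided tensoring preserves intersections, hence monomorphisms, and
  \<open>f \<bullet> g\<close> is a composite of two one-sided tensors.\<close>

lemma monic_tensor: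
  assumes "monic C f" "monic C g"
  shows "monic C (f \<bullet>\<^sub>m g)"
proof -
  have p: "preserves_binary_intersections C (\<lambda>Y. X \<bullet> Y) (\<lambda>f. \<one> X \<bullet>\<^sub>m f)"
    "preserves_binary_intersections C (\<lambda>Y. Y \<bullet> X) (\<lambda>f. f \<bullet>\<^sub>m \<one> X)" for X
    using preserves unfolding bullet_preserves_binary_intersections_def by blast+
  have "monic C (\<one> (Cod C f) \<bullet>\<^sub>m g)" "monic C (f \<bullet>\<^sub>m \<one> (Dom C g))"
    by (rule preserves_monic[OF p(1) assms(2)], rule preserves_monic[OF p(2) assms(1)])
  then have "monic C ((\<one> (Cod C f) \<bullet>\<^sub>m g) \<cdot> (f \<bullet>\<^sub>m \<one> (Dom C g)))" by (rule monic_comp) simp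
  then show ?thesis by (simp add: bul.merges)
qed

lemma chi_mult: "\<chi> \<cdot> mult A = (mult A \<bullet>\<^sub>m mult H) \<cdot> (\<zeta> (obj A) (obj H) (obj A) (obj H) \<cdot> (\<chi> \<odot>\<^sub>m \<chi>))"
proof -
  let ?A = "obj A" let ?H = "obj H"
  have "\<chi> \<cdot> mult A = (\<one> ?A \<bullet>\<^sub>m \<pi>) \<cdot> (comult A \<cdot> mult A)"
    by (simp add: \<chi>_def comp_assoc)
  also have "\<dots> = (mult A \<bullet>\<^sub>m mult H) \<cdot> ((\<one> (?A \<odot> ?A) \<bullet>\<^sub>m (\<pi> \<odot>\<^sub>m \<pi>)) \<cdot> (\<zeta> ?A ?A ?A ?A \<cdot> (comult A \<odot>\<^sub>m comult A)))"
    by (simp add: comult_mult bul.merges bimon_homD(5)[OF pi_hom])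
  also have "\<dots> = (mult A \<bullet>\<^sub>m mult H) \<cdot> (\<zeta> ?A ?H ?A ?H \<cdot> (\<chi> \<odot>\<^sub>m \<chi>))"
    using nat_zeta'[of "\<one> ?A" ?A \<pi> ?H "\<one> ?A" ?A \<pi> ?H "comult A \<odot>\<^sub>m comult A"]
    by (simp add: \<chi>_def circ.merges)
  finally show ?thesis .
qed

text \<open>The only place where cocommutativity enters.\<close>

lemma chi_swap:
  "(\<chi> \<bullet>\<^sub>m \<one> (obj A)) \<cdot> comult A = inv (a\<^sub>\<bullet> (obj A) (obj H) (obj A)) \<cdot> ((\<one> (obj A) \<bullet>\<^sub>m s (obj A) (obj H))
     \<cdot> (a\<^sub>\<bullet> (obj A) (obj A) (obj H) \<cdot> ((comult A \<bullet>\<^sub>m \<one> (obj H)) \<cdot> \<chi>)))"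
proof -
  let ?A = "obj A" let ?H = "obj H" let ?d = "comult A"
  have sd: "s ?A ?A \<cdot> ?d = ?d" using cocomm by (simp add: cocommutative_def)
  have n: "s ?A ?H \<cdot> (\<one> ?A \<bullet>\<^sub>m \<pi>) = (\<pi> \<bullet>\<^sub>m \<one> ?A) \<cdot> s ?A ?A"
    using braid_natural[of "\<one> ?A" \<pi>] by simp
  have nat: "s ?A ?H \<cdot> ((\<one> ?A \<bullet>\<^sub>m \<pi>) \<cdot> ?d) = (\<pi> \<bullet>\<^sub>m \<one> ?A) \<cdot> ?d"
    by (simp add: comp_reduce[OF n] comp_assoc sd)
  have "a\<^sub>\<bullet> ?A ?A ?H \<cdot> ((?d \<bullet>\<^sub>m \<one> ?H) \<cdot> \<chi>) = a\<^sub>\<bullet> ?A ?A ?H \<cdot> ((\<one> ?A \<bullet>\<^sub>m \<one> ?A \<bullet>\<^sub>m \<pi>) \<cdot> ((?d \<bullet>\<^sub>m \<one> ?A) \<cdot> ?d))"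
    by (simp add: \<chi>_def bul.merges)
  also have "\<dots> = (\<one> ?A \<bullet>\<^sub>m (\<one> ?A \<bullet>\<^sub>m \<pi>)) \<cdot> (a\<^sub>\<bullet> ?A ?A ?A \<cdot> ((?d \<bullet>\<^sub>m \<one> ?A) \<cdot> ?d))"
    using bul.nat_a'[of "\<one> ?A" ?A "\<one> ?A" ?A \<pi> ?H "(?d \<bullet>\<^sub>m \<one> ?A) \<cdot> ?d"] by simp
  also have "\<dots> = (\<one> ?A \<bullet>\<^sub>m ((\<one> ?A \<bullet>\<^sub>m \<pi>) \<cdot> ?d)) \<cdot> ?d"
    by (simp add: coassoc bul.merges)
  finally have "inv (a\<^sub>\<bullet> ?A ?H ?A) \<cdot> ((\<one> ?A \<bullet>\<^sub>m s ?A ?H) \<cdot> (a\<^sub>\<bullet> ?A ?A ?H \<cdot> ((?d \<bullet>\<^sub>m \<one> ?H) \<cdot> \<chi>)))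
     = inv (a\<^sub>\<bullet> ?A ?H ?A) \<cdot> ((\<one> ?A \<bullet>\<^sub>m (\<pi> \<bullet>\<^sub>m \<one> ?A)) \<cdot> ((\<one> ?A \<bullet>\<^sub>m ?d) \<cdot> ?d))"
    by (simp add: bul.merges nat)
  also have "\<dots> = ((\<one> ?A \<bullet>\<^sub>m \<pi>) \<bullet>\<^sub>m \<one> ?A) \<cdot> (inv (a\<^sub>\<bullet> ?A ?A ?A) \<cdot> ((\<one> ?A \<bullet>\<^sub>m ?d) \<cdot> ?d))"
    using bul.nat_ai'[of "\<one> ?A" ?A \<pi> ?H "\<one> ?A" ?A "(\<one> ?A \<bullet>\<^sub>m ?d) \<cdot> ?d"] by simp
  also have "\<dots> = (\<chi> \<bullet>\<^sub>m \<one> ?A) \<cdot> ?d"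
    by (simp add: coassoc' \<chi>_def bul.merges)
  finally show ?thesis by simp
qed

lemma chi_coassoc_left: "(\<one> (obj A) \<bullet>\<^sub>m \<chi>) \<cdot> comult A = a\<^sub>\<bullet> (obj A) (obj A) (obj H) \<cdot> ((comult A \<bullet>\<^sub>m \<one> (obj H)) \<cdot> \<chi>)"
proof -
  let ?A = "obj A" let ?H = "obj H" let ?d = "comult A"
  have "(\<one> ?A \<bullet>\<^sub>m \<chi>) \<cdot> ?d = (\<one> ?A \<bullet>\<^sub>m (\<one> ?A \<bullet>\<^sub>m \<pi>)) \<cdot> (a\<^sub>\<bullet> ?A ?A ?A \<cdot> ((?d \<bullet>\<^sub>m \<one> ?A) \<cdot> ?d))"
    by (simp add: coassoc bul.merges \<chi>_def)
  also have "\<dots> = a\<^sub>\<bullet> ?A ?A ?H \<cdot> ((\<one> ?A \<bullet>\<^sub>m \<one> ?A \<bullet>\<^sub>m \<pi>) \<cdot> ((?d \<bullet>\<^sub>m \<one> ?A) \<cdot> ?d))"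
    using bul.nat_a'[of "\<one> ?A" ?A "\<one> ?A" ?A \<pi> ?H "(?d \<bullet>\<^sub>m \<one> ?A) \<cdot> ?d"] by simp
  finally show ?thesis by (simp add: \<chi>_def bul.merges)
qed

text \<open>The comultiplication is restricted one factor at a time, using that tensoring on either
  side preserves the intersection. Coassociativity yields triviality of \<open>\<chi>\<close> on the
  second copy; \<open>chi_swap\<close> is needed for the first.\<close>

lemma intersection_comult:
  assumes int: "binary_intersection C N p i \<chi> (\<one> (obj A) \<bullet>\<^sub>m unit H)"
  obtains z where "Dom C z = N" "Cod C z = N \<bullet> N" "(p \<bullet>\<^sub>m p) \<cdot> z = comult A \<cdot> p"
proof -
  let ?A = "obj A" let ?H = "obj H" let ?d = "comult A" let ?u = "\<one> ?A \<bullet>\<^sub>m unit H"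
  let ?x = "a\<^sub>\<bullet> ?A ?A \<I> \<cdot> ((?d \<bullet>\<^sub>m \<one> \<I>) \<cdot> i)"
  let ?x' = "(\<one> ?A \<bullet>\<^sub>m s ?A \<I>) \<cdot> ?x"
  note d = binary_intersectionD[OF int]
  have [simp]: "Dom C p = N" "Cod C p = ?A" "Dom C i = N" "Cod C i = ?A \<bullet> \<I>" using d(1-4) by simp_all
  note pi = d(6)
  have monic_p: "monic C p" by (rule binary_intersection_monic[OF int])
  obtain y where y: "Dom C y = N" "Cod C y = N \<bullet> ?A" "(p \<bullet>\<^sub>m \<one> ?A) \<cdot> y = ?d \<cdot> p"
  proof (rule binary_intersection_factor[OF preserves_r[OF int, of ?A], of "?d \<cdot> p"
        "inv (a\<^sub>\<bullet> ?A \<I> ?A) \<cdot> ?x'"])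
    have su: "s ?A ?H \<cdot> (\<one> ?A \<bullet>\<^sub>m unit H) = (unit H \<bullet>\<^sub>m \<one> ?A) \<cdot> s ?A \<I>"
      using braid_natural[of "\<one> ?A" "unit H"] by simp
    have "(\<chi> \<bullet>\<^sub>m \<one> ?A) \<cdot> (?d \<cdot> p) = ((\<chi> \<bullet>\<^sub>m \<one> ?A) \<cdot> ?d) \<cdot> p" by (simp add: comp_assoc)
    also have "\<dots> = inv (a\<^sub>\<bullet> ?A ?H ?A) \<cdot> ((\<one> ?A \<bullet>\<^sub>m s ?A ?H) \<cdot> (a\<^sub>\<bullet> ?A ?A ?H \<cdot> ((?d \<bullet>\<^sub>m \<one> ?H) \<cdot> (?u \<cdot> i))))"
      unfolding chi_swap by (simp add: comp_assoc pi)
    also have "\<dots> = inv (a\<^sub>\<bullet> ?A ?H ?A) \<cdot> ((\<one> ?A \<bullet>\<^sub>m s ?A ?H) \<cdot> (a\<^sub>\<bullet> ?A ?A ?H \<cdot> ((\<one> ?A \<bullet>\<^sub>m \<one> ?A \<bullet>\<^sub>m unit H) \<cdot> ((?d \<bullet>\<^sub>m \<one> \<I>) \<cdot> i))))"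
      by (simp add: bul.merges)
    also have "\<dots> = inv (a\<^sub>\<bullet> ?A ?H ?A) \<cdot> ((\<one> ?A \<bullet>\<^sub>m (unit H \<bullet>\<^sub>m \<one> ?A)) \<cdot> ?x')"
      using bul.nat_a'[of "\<one> ?A" ?A "\<one> ?A" ?A "unit H" ?H "(?d \<bullet>\<^sub>m \<one> \<I>) \<cdot> i"]
      by (simp add: bul.merges su)
    also have "\<dots> = (?u \<bullet>\<^sub>m \<one> ?A) \<cdot> (inv (a\<^sub>\<bullet> ?A \<I> ?A) \<cdot> ?x')"
      using bul.nat_ai'[of "\<one> ?A" ?A "unit H" ?H "\<one> ?A" ?A "(\<one> ?A \<bullet>\<^sub>m s ?A \<I>) \<cdot> ?x"] by simp
    finally show "(\<chi> \<bullet>\<^sub>m \<one> ?A) \<cdot> (?d \<cdot> p) = \<dots>" .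
  qed simp_all
  \<comment> \<open>A priori the \<open>A\<close>-part of \<open>i\<close> is arbitrary.
    Coassociativity of \<open>\<chi>\<close> shows that it lies in \<open>N\<close>, so that its
    comultiplication can be replaced by \<open>y\<close> when \<open>z\<close> is
    constructed.\<close>
  obtain n where n: "Dom C n = N" "Cod C n = N \<bullet> \<I>" "(p \<bullet>\<^sub>m \<one> \<I>) \<cdot> n = i"
  proof (rule binary_intersection_factor[OF preserves_r[OF int, of \<I>], of i "coact_I ?A \<cdot> i"])
    have "(\<one> (?A \<bullet> ?H) \<bullet>\<^sub>m unit H) \<cdot> ((\<chi> \<bullet>\<^sub>m \<one> \<I>) \<cdot> i) = (\<chi> \<bullet>\<^sub>m \<one> ?H) \<cdot> (?u \<cdot> i)"
      by (simp add: bul.merges)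
    also have "\<dots> = ((\<chi> \<bullet>\<^sub>m \<one> ?H) \<cdot> \<chi>) \<cdot> p" by (simp add: comp_assoc flip: pi)
    also have "\<dots> = inv (a\<^sub>\<bullet> ?A ?H ?H) \<cdot> ((\<one> ?A \<bullet>\<^sub>m comult H) \<cdot> (?u \<cdot> i))"
      unfolding chi_coassoc by (simp add: comp_assoc pi)
    also have "\<dots> = inv (a\<^sub>\<bullet> ?A ?H ?H) \<cdot> ((\<one> ?A \<bullet>\<^sub>m (unit H \<bullet>\<^sub>m unit H)) \<cdot> ((\<one> ?A \<bullet>\<^sub>m \<Delta>\<^sub>I) \<cdot> i))"
      by (simp add: bul.merges comult_unit)
    also have "\<dots> = (?u \<bullet>\<^sub>m unit H) \<cdot> (coact_I ?A \<cdot> i)"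
      using bul.nat_ai'[of "\<one> ?A" ?A "unit H" ?H "unit H" ?H "(\<one> ?A \<bullet>\<^sub>m \<Delta>\<^sub>I) \<cdot> i"]
      by (simp add: coact_I_def comp_assoc)
    also have "\<dots> = (\<one> (?A \<bullet> ?H) \<bullet>\<^sub>m unit H) \<cdot> ((?u \<bullet>\<^sub>m \<one> \<I>) \<cdot> (coact_I ?A \<cdot> i))"
      by (simp add: bul.merges)
    finally show "(\<chi> \<bullet>\<^sub>m \<one> \<I>) \<cdot> i = (?u \<bullet>\<^sub>m \<one> \<I>) \<cdot> (coact_I ?A \<cdot> i)"
    proof (rule monicD[rotated 4])
      show "monic C (\<one> (?A \<bullet> ?H) \<bullet>\<^sub>m unit H)"
        by (intro monic_tensor monic_u split_monic[of "\<one> (?A \<bullet> ?H)"]) simp_all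
    qed simp_all
  qed simp_all
  note [simp] = y(1,2) n(1,2)
  obtain z where z: "Dom C z = N" "Cod C z = N \<bullet> N" "(\<one> N \<bullet>\<^sub>m p) \<cdot> z = y"
  proof (rule binary_intersection_factor[OF preserves_l[OF int, of N], of y "a\<^sub>\<bullet> N ?A \<I> \<cdot> ((y \<bullet>\<^sub>m \<one> \<I>) \<cdot> n)"])
    \<comment> \<open>The cone condition is tested after the monomorphism
      \<open>p \<bullet> 1\<close>, where the first factor becomes \<open>A\<close> and
      \<open>chi_coassoc_left\<close> applies.\<close>
    have "(p \<bullet>\<^sub>m \<one> (?A \<bullet> ?H)) \<cdot> ((\<one> N \<bullet>\<^sub>m \<chi>) \<cdot> y) = (\<one> ?A \<bullet>\<^sub>m \<chi>) \<cdot> ((p \<bullet>\<^sub>m \<one> ?A) \<cdot> y)"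
      by (simp add: bul.merges)
    also have "\<dots> = ((\<one> ?A \<bullet>\<^sub>m \<chi>) \<cdot> ?d) \<cdot> p" unfolding y(3) by (simp add: comp_assoc)
    also have "\<dots> = a\<^sub>\<bullet> ?A ?A ?H \<cdot> ((?d \<bullet>\<^sub>m \<one> ?H) \<cdot> (?u \<cdot> i))"
      unfolding chi_coassoc_left by (simp add: comp_assoc pi)
    also have "\<dots> = a\<^sub>\<bullet> ?A ?A ?H \<cdot> ((\<one> ?A \<bullet>\<^sub>m \<one> ?A \<bullet>\<^sub>m unit H) \<cdot> ((?d \<bullet>\<^sub>m \<one> \<I>) \<cdot> i))"
      by (simp add: bul.merges)
    also have "\<dots> = (\<one> ?A \<bullet>\<^sub>m ?u) \<cdot> ?x"
      using bul.nat_a'[of "\<one> ?A" ?A "\<one> ?A" ?A "unit H" ?H "(?d \<bullet>\<^sub>m \<one> \<I>) \<cdot> i"] by simp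
    also have "(?d \<bullet>\<^sub>m \<one> \<I>) \<cdot> i = ((?d \<cdot> p) \<bullet>\<^sub>m \<one> \<I>) \<cdot> n"
      by (simp add: bul.merges flip: n(3))
    also have "\<dots> = (p \<bullet>\<^sub>m \<one> ?A \<bullet>\<^sub>m \<one> \<I>) \<cdot> ((y \<bullet>\<^sub>m \<one> \<I>) \<cdot> n)"
      unfolding y(3)[symmetric] by (simp add: bul.merges)
    also have "(\<one> ?A \<bullet>\<^sub>m ?u) \<cdot> (a\<^sub>\<bullet> ?A ?A \<I> \<cdot> ((p \<bullet>\<^sub>m \<one> ?A \<bullet>\<^sub>m \<one> \<I>) \<cdot> ((y \<bullet>\<^sub>m \<one> \<I>) \<cdot> n)))
      = (p \<bullet>\<^sub>m \<one> (?A \<bullet> ?H)) \<cdot> ((\<one> N \<bullet>\<^sub>m ?u) \<cdot> (a\<^sub>\<bullet> N ?A \<I> \<cdot> ((y \<bullet>\<^sub>m \<one> \<I>) \<cdot> n)))"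
      using bul.nat_a'[of p ?A "\<one> ?A" ?A "\<one> \<I>" \<I> "(y \<bullet>\<^sub>m \<one> \<I>) \<cdot> n"] by (simp add: bul.merges)
    finally show "(\<one> N \<bullet>\<^sub>m \<chi>) \<cdot> y = (\<one> N \<bullet>\<^sub>m ?u) \<cdot> (a\<^sub>\<bullet> N ?A \<I> \<cdot> ((y \<bullet>\<^sub>m \<one> \<I>) \<cdot> n))"
    proof (rule monicD[rotated 4])
      show "monic C (p \<bullet>\<^sub>m \<one> (?A \<bullet> ?H))"
        by (intro monic_tensor monic_p split_monic[of "\<one> (?A \<bullet> ?H)"]) simp_all
    qed simp_all
  qed simp_all
  have "(p \<bullet>\<^sub>m p) \<cdot> z = (p \<bullet>\<^sub>m \<one> ?A) \<cdot> ((\<one> N \<bullet>\<^sub>m p) \<cdot> z)" using z(1,2) by (simp add: bul.merges)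
  then show ?thesis using that z y(3) by simp
qed

text \<open>Multiplication and unit restrict because \<open>\<chi>\<close> is multiplicative and
  unital, comultiplication by \<open>intersection_comult\<close>; \<open>sub_bimonoid\<close> then
  transfers the laws.\<close>

lemma intersection_bimonoid:
  assumes int: "binary_intersection C N p i \<chi> (\<one> (obj A) \<bullet>\<^sub>m unit H)"
  obtains B where "obj B = N" "p \<in> bimon_hom C B A"
proof -
  let ?A = "obj A" let ?H = "obj H" let ?u = "\<one> ?A \<bullet>\<^sub>m unit H"
  note d = binary_intersectionD[OF int]
  have [simp]: "Dom C p = N" "Cod C p = ?A" "Dom C i = N" "Cod C i = ?A \<bullet> \<I>" using d(1-4) by simp_all
  note pi = d(6)
  have monic_p: "monic C p" by (rule binary_intersection_monic[OF int])
  obtain m where m: "Dom C m = N \<odot> N" "Cod C m = N" "p \<cdot> m = mult A \<cdot> (p \<odot>\<^sub>m p)"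
  proof (rule binary_intersection_factor[OF int, of "mult A \<cdot> (p \<odot>\<^sub>m p)" "(mult A \<bullet>\<^sub>m l\<^sub>\<odot> \<I>) \<cdot> (\<zeta> ?A \<I> ?A \<I> \<cdot> (i \<odot>\<^sub>m i))"])
    have "\<chi> \<cdot> (mult A \<cdot> (p \<odot>\<^sub>m p)) = (mult A \<bullet>\<^sub>m mult H) \<cdot> (\<zeta> ?A ?H ?A ?H \<cdot> ((?u \<odot>\<^sub>m ?u) \<cdot> (i \<odot>\<^sub>m i)))"
      by (simp add: comp_reduce[OF chi_mult] comp_assoc circ.merges pi)
    also have "\<dots> = (mult A \<bullet>\<^sub>m (mult H \<cdot> (unit H \<odot>\<^sub>m \<one> ?H) \<cdot> (\<one> \<I> \<odot>\<^sub>m unit H))) \<cdot> (\<zeta> ?A \<I> ?A \<I> \<cdot> (i \<odot>\<^sub>m i))"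
      using nat_zeta'[of "\<one> ?A" ?A "unit H" ?H "\<one> ?A" ?A "unit H" ?H "i \<odot>\<^sub>m i"]
      by (simp add: bul.merges circ.merges comp_assoc)
    also have "mult H \<cdot> (unit H \<odot>\<^sub>m \<one> ?H) \<cdot> (\<one> \<I> \<odot>\<^sub>m unit H) = unit H \<cdot> l\<^sub>\<odot> \<I>"
      by (simp add: mult_lunit circ.nat_l)
    finally show "\<chi> \<cdot> (mult A \<cdot> (p \<odot>\<^sub>m p)) = ?u \<cdot> ((mult A \<bullet>\<^sub>m l\<^sub>\<odot> \<I>) \<cdot> (\<zeta> ?A \<I> ?A \<I> \<cdot> (i \<odot>\<^sub>m i)))"
      by (simp add: bul.merges)
  qed simp_all
  obtain v where v: "Dom C v = \<I>" "Cod C v = N" "p \<cdot> v = unit A"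
  proof (rule binary_intersection_factor[OF int, of "unit A" "(unit A \<bullet>\<^sub>m \<one> \<I>) \<cdot> \<Delta>\<^sub>I"])
    show "\<chi> \<cdot> unit A = ?u \<cdot> ((unit A \<bullet>\<^sub>m \<one> \<I>) \<cdot> \<Delta>\<^sub>I)"
      by (simp add: \<chi>_def comp_assoc comult_unit bul.merges bimon_homD(6)[OF pi_hom])
  qed simp_all
  obtain z where z: "Dom C z = N" "Cod C z = N \<bullet> N" "(p \<bullet>\<^sub>m p) \<cdot> z = comult A \<cdot> p"
    by (rule intersection_comult[OF int])
  let ?B = "\<lparr>obj = N, mult = m, unit = v, comult = z, counit = counit A \<cdot> p\<rparr>"
  have "p \<in> bimon_hom C ?B A"
    by (rule sub_bimonoid) (simp_all add: m v z monic_p monic_tensor)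
  then show ?thesis using that[of ?B] by simp
qed

text \<open>The universal property of \<open>K\<close> lifts only bimonoid morphisms, and
  \<open>e0\<close> need not be one. It is lifted to the intersection first, which as a bimonoid
  with trivial \<open>\<pi>\<close> maps to \<open>K\<close>. Monicity of \<open>k\<close> in
  \<open>C\<close> also comes from this comparison.\<close>

lemma kernel_retraction:
  obtains t where "monic C k" "Dom C t = obj A \<bullet> \<I>" "Cod C t = obj K" "k \<cdot> t = e0"
proof -
  let ?A = "obj A" let ?H = "obj H" let ?u = "\<one> ?A \<bullet>\<^sub>m unit H"
  have "monic C \<chi>"
    by (rule split_monic[of "r\<^sub>\<bullet> ?A \<cdot> (\<one> ?A \<bullet>\<^sub>m counit H)"]) (simp_all add: comp_assoc chi_counit)
  then obtain N p i where int: "binary_intersection C N p i \<chi> ?u"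
    using intersections monic_unit unfolding has_binary_intersections_def by fastforce
  note d = binary_intersectionD[OF int]
  have [simp]: "Dom C p = N" "Cod C p = ?A" "Dom C i = N" "Cod C i = ?A \<bullet> \<I>" using d(1-4) by simp_all
  note pi = d(6)
  have monic_p: "monic C p" by (rule binary_intersection_monic[OF int])
  obtain B where B: "obj B = N" and p: "p \<in> bimon_hom C B A" by (rule intersection_bimonoid[OF int])
  obtain q where pb: "pullback_in (bimon_hom C) (Comp C) K A (I_bimonoid C) H k q \<pi> (unit H)"
    using kernel by (auto simp: is_kernel_def)
  have k: "k \<in> bimon_hom C K A" and q: "q \<in> bimon_hom C K (I_bimonoid C)" and u: "unit H \<in> bimon_hom C (I_bimonoid C) H"
    and sq: "\<pi> \<cdot> k = unit H \<cdot> q"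
    using pb unfolding pullback_in_def by blast+
  have [simp]: "obj (I_bimonoid C) = \<I>" by (simp add: I_bimonoid_def)
  note [simp] = bimon_homD(1,3,4)[OF k] bimon_homD(3,4)[OF q, simplified] B
  \<comment> \<open>Discarding the part of \<open>i\<close> in \<open>A\<close> leaves the morphism
    to the unit object through which \<open>\<pi> p\<close> factors.\<close>
  let ?q = "l\<^sub>\<bullet> \<I> \<cdot> ((counit A \<bullet>\<^sub>m \<one> \<I>) \<cdot> i)"
  have piu: "unit H \<cdot> ?q = \<pi> \<cdot> p"
  proof -
    have "unit H \<cdot> ?q = l\<^sub>\<bullet> ?H \<cdot> ((\<one> \<J> \<bullet>\<^sub>m unit H) \<cdot> ((counit A \<bullet>\<^sub>m \<one> \<I>) \<cdot> i))"
      by (simp add: bul.nat_l')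
    also have "\<dots> = l\<^sub>\<bullet> ?H \<cdot> ((counit A \<bullet>\<^sub>m \<one> ?H) \<cdot> (\<chi> \<cdot> p))"
      unfolding pi by (simp add: bul.merges)
    also have "\<dots> = l\<^sub>\<bullet> ?H \<cdot> ((\<one> \<J> \<bullet>\<^sub>m \<pi>) \<cdot> ((counit A \<bullet>\<^sub>m \<one> ?A) \<cdot> (comult A \<cdot> p)))"
      by (simp add: \<chi>_def comp_assoc bul.merges)
    also have "\<dots> = \<pi> \<cdot> p" by (simp add: bul.nat_l' comp_reduce3[OF lcounit])
    finally show ?thesis .
  qed
  have q_hom: "?q \<in> bimon_hom C B (I_bimonoid C)"
    by (rule bimon_hom_reflect[OF u monic_u]) (simp_all add: monic_tensor monic_u piu bimon_hom_comp[OF p pi_hom])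
  have ex1: "\<exists>!h. h \<in> bimon_hom C Q K \<and> k \<cdot> h = x \<and> q \<cdot> h = y"
    if "x \<in> bimon_hom C Q A" "y \<in> bimon_hom C Q (I_bimonoid C)" "\<pi> \<cdot> x = unit H \<cdot> y" for Q x y
    using pb that unfolding pullback_in_def by blast
  obtain t1 where t1: "t1 \<in> bimon_hom C B K" "k \<cdot> t1 = p" using ex1[OF p q_hom piu[symmetric]] by blast
  \<comment> \<open>Conversely \<open>k\<close> factors through the intersection: comultiplicativity
    of \<open>k\<close> and \<open>\<pi> k = u_H q\<close> provide the cone.\<close>
  obtain j where j: "Dom C j = obj K" "Cod C j = N" "p \<cdot> j = k"
  proof (rule binary_intersection_factor[OF int, of k "(k \<bullet>\<^sub>m q) \<cdot> comult K"])
    show "\<chi> \<cdot> k = ?u \<cdot> ((k \<bullet>\<^sub>m q) \<cdot> comult K)"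
      by (simp add: \<chi>_def comp_assoc bimon_homD(7)[OF k] bul.merges sq)
  qed simp_all
  note [simp] = j(1,2) bimon_homD(3,4)[OF t1(1), simplified]
  have j_hom: "j \<in> bimon_hom C K B"
    by (rule bimon_hom_reflect[OF p monic_p]) (simp_all add: monic_tensor monic_p j k)
  have ktj: "k \<cdot> (t1 \<cdot> j) = k" by (simp add: comp_reduce[OF t1(2)] j)
  moreover have "q \<cdot> (t1 \<cdot> j) = q"
  proof -
    have "unit H \<cdot> (q \<cdot> (t1 \<cdot> j)) = \<pi> \<cdot> (k \<cdot> (t1 \<cdot> j))" by (simp add: comp_reduce[OF sq] comp_assoc)
    also have "\<dots> = unit H \<cdot> q" by (simp add: ktj sq)
    finally show ?thesis by (rule monicD[OF monic_u, rotated 3]) simp_all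
  qed
  moreover have "t1 \<cdot> j \<in> bimon_hom C K K" by (rule bimon_hom_comp[OF j_hom t1(1)])
  moreover have "\<one> (obj K) \<in> bimon_hom C K K" "k \<cdot> \<one> (obj K) = k" "q \<cdot> \<one> (obj K) = q"
    by (simp_all add: bimon_hom_ident)
  \<comment> \<open>Uniqueness in the universal property of \<open>K\<close>. This makes
    \<open>j\<close> split monic, and hence \<open>k = p j\<close> monic in
    \<open>C\<close>.\<close>
  ultimately have tj: "t1 \<cdot> j = \<one> (obj K)" using ex1[OF k q sq] by blast
  have "monic C j" by (rule split_monic[of t1]) (simp_all add: tj)
  then have "monic C (p \<cdot> j)" using monic_p by (intro monic_comp) simp_all
  then have "monic C k" by (simp add: j)
  \<comment> \<open>The cone is the one from \<open>chi_e0\<close>; composing with \<open>t1\<close>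
    then moves the lift from \<open>N\<close> to \<open>K\<close>.\<close>
  obtain t0 where t0: "Dom C t0 = ?A \<bullet> \<I>" "Cod C t0 = N" "p \<cdot> t0 = e0"
    by (rule binary_intersection_factor[OF int, of e0 e]) (simp_all add: chi_e0)
  show ?thesis
    by (rule that[of "t1 \<cdot> t0"]) (simp_all add: \<open>monic C k\<close> t0 comp_reduce[OF t1(2)])
qed

end

section \<open>The split short five lemma\<close>

locale split_kernel_morphism = duoidal_category_with_reversion C +
  X: split_kernel C H S A \<pi> \<sigma> s K k + Y: split_kernel C H' S' A' \<pi>' \<sigma>' s K' k'
  for C :: "('o, 'm, 'z) reversible_duoidal_scheme" (structure)
    and H S A \<pi> \<sigma> s K k H' S' A' \<pi>' \<sigma>' K' k' +
  fixes \<phi> g :: 'm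
  assumes phi: "\<phi> \<in> bimon_hom C A A'" and g: "g \<in> bimon_hom C H H'"
    and pi_phi: "\<pi>' \<cdot> \<phi> = g \<cdot> \<pi>" and phi_sigma: "\<phi> \<cdot> \<sigma> = \<sigma>' \<cdot> g"
begin

lemmas [simp] = bimon_homD(3,4)[OF phi] bimon_homD(3,4)[OF g]

text \<open>Tested after the invertible Galois map of \<open>A'\<close>, where \<open>beta_w\<close>
  replaces the two occurrences of \<open>w\<close> by coactions. This avoids comparing the antipodes
  of \<open>H\<close> and \<open>H'\<close>.\<close>

lemma w_natural: "Y.w \<cdot> \<phi> = ((\<phi> \<bullet>\<^sub>m \<one> \<I>) \<odot>\<^sub>m g) \<cdot> X.w"
proof -
  have act: "Y.\<rho> \<cdot> (\<phi> \<odot>\<^sub>m g) = \<phi> \<cdot> X.\<rho>"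
  proof -
    have "Y.\<rho> \<cdot> (\<phi> \<odot>\<^sub>m g) = mult A' \<cdot> (\<phi> \<odot>\<^sub>m (\<sigma>' \<cdot> g))" by (simp add: Y.\<rho>_def comp_assoc circ.merges)
    also have "\<dots> = \<phi> \<cdot> X.\<rho>"
      by (simp add: X.\<rho>_def comp_reduce[OF bimon_homD(5)[OF phi]] comp_assoc circ.merges flip: phi_sigma)
    finally show ?thesis .
  qed
  have "beta H' (obj A') Y.\<rho> \<cdot> (Y.w \<cdot> \<phi>) = Y.\<chi> \<cdot> \<phi>"
    by (simp add: comp_reduce[OF Y.beta_w] Y.right_module)
  also have "\<dots> = (\<phi> \<bullet>\<^sub>m g) \<cdot> X.\<chi>"
    by (simp add: X.\<chi>_def Y.\<chi>_def comp_assoc bimon_homD(7)[OF phi] bul.merges pi_phi)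
  also have "\<dots> = ((\<phi> \<bullet>\<^sub>m g) \<cdot> beta H (obj A) X.\<rho>) \<cdot> X.w"
    by (simp add: X.beta_w X.right_module comp_assoc)
  also have "(\<phi> \<bullet>\<^sub>m g) \<cdot> beta H (obj A) X.\<rho> = beta H' (obj A') Y.\<rho> \<cdot> ((\<phi> \<bullet>\<^sub>m \<one> \<I>) \<odot>\<^sub>m g)"
    by (rule beta_natural[OF X.bimonoid Y.bimonoid X.right_module Y.right_module, symmetric])
      (simp_all add: act bimon_homD(7)[OF g])
  finally have "Y.beta_inv (obj A') Y.\<rho> \<cdot> (beta H' (obj A') Y.\<rho> \<cdot> (Y.w \<cdot> \<phi>))
     = Y.beta_inv (obj A') Y.\<rho> \<cdot> (beta H' (obj A') Y.\<rho> \<cdot> (((\<phi> \<bullet>\<^sub>m \<one> \<I>) \<odot>\<^sub>m g) \<cdot> X.w))"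
    by (simp add: comp_assoc Y.right_module)
  then show ?thesis
    by (simp add: comp_reduce[OF Y.beta_inv_beta] Y.right_module)
qed

text \<open>All ingredients are natural: \<open>w\<close> by \<open>w_natural\<close>, and
  \<open>gamma_loop\<close> because \<open>\<phi> \<bullet> 1\<close> is colinear.\<close>

lemma e0_natural: "Y.e0 \<cdot> (\<phi> \<bullet>\<^sub>m \<one> \<I>) = \<phi> \<cdot> X.e0"
proof -
  let ?f = "\<phi> \<bullet>\<^sub>m \<one> \<I>"
  have v: "((\<one> (obj A' \<bullet> \<I>) \<odot>\<^sub>m counit H') \<cdot> Y.w) \<cdot> \<phi> = (?f \<odot>\<^sub>m \<one> \<J>) \<cdot> ((\<one> (obj A \<bullet> \<I>) \<odot>\<^sub>m counit H) \<cdot> X.w)"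
    by (simp add: comp_assoc w_natural circ.merges bimon_homD(8)[OF g])
  have "Y.V \<cdot> ?f = gamma_loop (coact_I (obj A')) \<I> \<cdot> ((((\<one> (obj A' \<bullet> \<I>) \<odot>\<^sub>m counit H') \<cdot> Y.w) \<cdot> \<phi>) \<bullet>\<^sub>m \<one> \<I>)"
    by (simp add: Y.V_def comp_assoc bul.merges)
  also have "\<dots> = (gamma_loop (coact_I (obj A')) \<I> \<cdot> ((?f \<odot>\<^sub>m \<one> \<J>) \<bullet>\<^sub>m \<one> \<I>)) \<cdot> (((\<one> (obj A \<bullet> \<I>) \<odot>\<^sub>m counit H) \<cdot> X.w) \<bullet>\<^sub>m \<one> \<I>)"
    unfolding v by (simp add: comp_assoc bul.merges)
  also have "gamma_loop (coact_I (obj A')) \<I> \<cdot> ((?f \<odot>\<^sub>m \<one> \<J>) \<bullet>\<^sub>m \<one> \<I>) = (?f \<odot>\<^sub>m \<one> \<I>) \<cdot> gamma_loop (coact_I (obj A)) \<I>"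
    by (rule gamma_loop_natural) (simp_all add: coact_I_natural)
  finally have V: "Y.V \<cdot> ?f = (?f \<odot>\<^sub>m \<one> \<I>) \<cdot> X.V"
    by (simp add: X.V_def comp_assoc)
  have e: "Y.e \<cdot> ?f = ?f \<cdot> X.e"
    by (simp add: X.e_def Y.e_def comp_assoc V circ.nats)
  have "Y.e0 \<cdot> ?f = r\<^sub>\<bullet> (obj A') \<cdot> ((\<phi> \<bullet>\<^sub>m \<one> \<J>) \<cdot> ((\<one> (obj A) \<bullet>\<^sub>m \<epsilon>\<^sub>I) \<cdot> X.e))"
    by (simp add: Y.e0_def comp_assoc e bul.merges)
  then show ?thesis by (simp add: X.e0_def bul.nats)
qed

text \<open>On elements the inverse sends \<open>a'\<close> to \<open>k (f^-1 (a' (\<sigma>' (\<pi>'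
  a'))^-1)) \<sigma> (g^-1 (\<pi>' a'))\<close>. One composite is the identity by
  \<open>reconstruct\<close> for \<open>A'\<close>, the other by naturality and
  \<open>reconstruct\<close> for \<open>A\<close>.\<close>

lemma short_five:
  assumes f: "f \<in> bimon_hom C K K'" "\<phi> \<cdot> k = k' \<cdot> f" and isos: "bimon_iso C K K' f" "bimon_iso C H H' g"
  shows "bimon_iso C A A' \<phi>"
proof -
  obtain f' where f': "f' \<in> bimon_hom C K' K" "f' \<cdot> f = \<one> (obj K)" "f \<cdot> f' = \<one> (obj K')"
    using isos(1) unfolding bimon_iso_def iso_in_def by blast
  obtain g' where g': "g' \<in> bimon_hom C H' H" "g' \<cdot> g = \<one> (obj H)" "g \<cdot> g' = \<one> (obj H')"
    using isos(2) unfolding bimon_iso_def iso_in_def by blast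
  obtain t where t: "Dom C t = obj A \<bullet> \<I>" "Cod C t = obj K" "k \<cdot> t = X.e0"
    by (rule X.kernel_retraction)
  obtain t' where mk': "monic C k'" and t': "Dom C t' = obj A' \<bullet> \<I>" "Cod C t' = obj K'" "k' \<cdot> t' = Y.e0"
    by (rule Y.kernel_retraction)
  have k: "k \<in> bimon_hom C K A" "k' \<in> bimon_hom C K' A'"
    using X.kernel Y.kernel by (auto simp: is_kernel_def pullback_in_def)
  note [simp] = t(1,2) t'(1,2) bimon_homD(3,4)[OF f(1)] bimon_homD(3,4)[OF f'(1)] bimon_homD(3,4)[OF g'(1)]
    bimon_homD(3,4)[OF k(1)] bimon_homD(3,4)[OF k(2)]
  let ?P = "mult A \<cdot> (k \<odot>\<^sub>m \<sigma>)"
  let ?\<psi> = "?P \<cdot> ((f' \<odot>\<^sub>m g') \<cdot> ((t' \<odot>\<^sub>m \<one> (obj H')) \<cdot> Y.w))"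
  have "\<phi> \<cdot> ?\<psi> = (\<phi> \<cdot> mult A) \<cdot> ((k \<odot>\<^sub>m \<sigma>) \<cdot> ((f' \<odot>\<^sub>m g') \<cdot> ((t' \<odot>\<^sub>m \<one> (obj H')) \<cdot> Y.w)))"
    by (simp add: comp_assoc)
  also have "\<dots> = mult A' \<cdot> (((\<phi> \<cdot> k) \<odot>\<^sub>m (\<phi> \<cdot> \<sigma>)) \<cdot> ((f' \<odot>\<^sub>m g') \<cdot> ((t' \<odot>\<^sub>m \<one> (obj H')) \<cdot> Y.w)))"
    unfolding bimon_homD(5)[OF phi] by (simp add: comp_assoc circ.merges)
  also have "\<dots> = mult A' \<cdot> ((k' \<odot>\<^sub>m \<sigma>') \<cdot> (((f \<cdot> f') \<odot>\<^sub>m (g \<cdot> g')) \<cdot> ((t' \<odot>\<^sub>m \<one> (obj H')) \<cdot> Y.w)))"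
    unfolding f(2) phi_sigma by (simp add: comp_assoc circ.merges)
  also have "\<dots> = mult A' \<cdot> ((Y.e0 \<odot>\<^sub>m \<sigma>') \<cdot> Y.w)"
    unfolding f'(3) g'(3) by (simp add: circ.merges t'(3))
  also have "\<dots> = \<one> (obj A')" by (rule Y.reconstruct)
  finally have 1: "\<phi> \<cdot> ?\<psi> = \<one> (obj A')" .
  \<comment> \<open>The lifts of \<open>e0\<close> to the two kernels correspond under
    \<open>f\<close>: after the monomorphism \<open>k'\<close> this is naturality of
    \<open>e0\<close>.\<close>
  have tt: "t' \<cdot> (\<phi> \<bullet>\<^sub>m \<one> \<I>) = f \<cdot> t"
  proof (rule monicD[OF mk'])
    have "k' \<cdot> (t' \<cdot> (\<phi> \<bullet>\<^sub>m \<one> \<I>)) = \<phi> \<cdot> (k \<cdot> t)" by (simp add: comp_reduce[OF t'(3)] e0_natural t(3))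
    also have "\<dots> = (\<phi> \<cdot> k) \<cdot> t" by (simp add: comp_assoc)
    finally show "k' \<cdot> (t' \<cdot> (\<phi> \<bullet>\<^sub>m \<one> \<I>)) = k' \<cdot> (f \<cdot> t)" unfolding f(2) by (simp add: comp_assoc)
  qed simp_all
  have "?\<psi> \<cdot> \<phi> = ?P \<cdot> ((f' \<odot>\<^sub>m g') \<cdot> (((t' \<cdot> (\<phi> \<bullet>\<^sub>m \<one> \<I>)) \<odot>\<^sub>m g) \<cdot> X.w))"
    by (simp add: comp_assoc w_natural circ.merges)
  also have "\<dots> = ?P \<cdot> ((((f' \<cdot> f) \<cdot> t) \<odot>\<^sub>m (g' \<cdot> g)) \<cdot> X.w)"
    unfolding tt by (simp add: comp_assoc circ.merges)
  also have "\<dots> = mult A \<cdot> ((X.e0 \<odot>\<^sub>m \<sigma>) \<cdot> X.w)"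
    unfolding f'(2) g'(2) by (simp add: comp_assoc circ.merges t(3))
  also have "\<dots> = \<one> (obj A)" by (rule X.reconstruct)
  finally have 2: "?\<psi> \<cdot> \<phi> = \<one> (obj A)" .
  \<comment> \<open>The inverse was built in \<open>C\<close> only; as the inverse of a bimonoid
    morphism it is one itself.\<close>
  have "?\<psi> \<in> bimon_hom C A' A"
    by (rule bimon_hom_inverse[OF phi _ _ 1 2]) simp_all
  then show ?thesis
    unfolding bimon_iso_def iso_in_def using phi 1 2 by blast
qed

end

theorem lemma3p7:
  fixes C :: "('o, 'm) reversible_duoidal" (structure)
    and s :: "'o \<Rightarrow> 'o \<Rightarrow> 'm"
    and A H K A' H' K' :: "('o, 'm) bimonoid"
    and \<pi> \<sigma> \<pi>' \<sigma>' k k' f \<phi> g :: 'm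
  assumes "bullet_braided_duoidal_category C s"
    and "duoidal_category_with_reversion C"
    and "has_binary_intersections C"
    and "bullet_preserves_binary_intersections C"
    and "\<pi> \<in> bimon_hom C A H" and "\<sigma> \<in> bimon_hom C H A" and "\<pi> \<cdot> \<sigma> = \<one> (obj H)"
    and "\<pi>' \<in> bimon_hom C A' H'" and "\<sigma>' \<in> bimon_hom C H' A'" and "\<pi>' \<cdot> \<sigma>' = \<one> (obj H')"
    and "hopf_monoid C A" and "cocommutative C s A"
    and "hopf_monoid C A'" and "cocommutative C s A'"
    and "hopf_monoid C H" and "hopf_monoid C H'"
    and "monic C (unit H)" and "monic C (unit H')"
    and "is_kernel C A H \<pi> K k" and "is_kernel C A' H' \<pi>' K' k'"
    and "f \<in> bimon_hom C K K'" and "\<phi> \<in> bimon_hom C A A'" and "g \<in> bimon_hom C H H'"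
    and "\<phi> \<cdot> k = k' \<cdot> f" and "\<pi>' \<cdot> \<phi> = g \<cdot> \<pi>" and "\<phi> \<cdot> \<sigma> = \<sigma>' \<cdot> g"
    and "bimon_iso C K K' f" and "bimon_iso C H H' g"
  shows "bimon_iso C A A' \<phi>"
proof -
  interpret duoidal_category_with_reversion C by fact
  interpret bullet_braided_duoidal_category C s by fact
  obtain S where S: "is_antipode C H S" using assms(15) by (auto simp: hopf_monoid_def)
  obtain S' where S': "is_antipode C H' S'" using assms(16) by (auto simp: hopf_monoid_def)
  have "preserves_binary_intersections C (\<lambda>Y. X \<bullet> Y) (\<lambda>f. \<one> X \<bullet>\<^sub>m f)" for X
    using assms(4) unfolding bullet_preserves_binary_intersections_def by blast
  \<comment> \<open>Supplies the assumption \<open>monic_unit\<close> on both sides: tensoring keeps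
    \<open>u_H\<close> and \<open>u_H'\<close> monic.\<close>
  note monic = preserves_monic[OF this]
  interpret split_kernel_morphism C H S A \<pi> \<sigma> s K k H' S' A' \<pi>' \<sigma>' K' k' \<phi> g
    by unfold_locales (use assms S S' monic in \<open>simp_all add: hopf_monoid_def\<close>)
  show ?thesis by (rule short_five) fact+
qed

end
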